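(* Let $n\ge2$, $1\le k\le n-1$, $r\ge2$, let $T\subset\mathbb R^n$ be an $n$-simplex, and for each sub-simplex $f$ of $T$ choose a $t$-$n$ basis. Then $$\mathbb B_r(\mathrm{div},T;\mathbb X)=\bigoplus_{\ell=1}^n\bigoplus_{f\in\Delta_\ell(T)}\mathbb B_r\mathscr T^f(\mathbb X),$$ and $$\mathrm{tr}^{\mathrm{div}}:\ \bigoplus_{\ell=0}^{n-1}\bigoplus_{f\in\Delta_\ell(T)}\mathbb B_r\mathscr N^f(\mathbb X)\to \mathrm{tr}^{\mathrm{div}}\,\mathbb P_r(T;\mathbb X)$$ is a bijection. Consequently $$\dim\mathbb B_r(\mathrm{div},T;\mathbb X)=\sum_{\ell=1}^n\binom{n+1}{\ell+1}\binom{r-1}{\ell}\left[\ell\binom nk+\binom{n-\ell}{n-k+1}-\binom n{k-1}\right].$$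
   Context: Forms. $\mathrm{Alt}^j$ is the space of alternating $j$-linear forms on $\mathbb R^n$; $\mathrm{Alt}^{k,n-1}=\mathrm{Alt}^k\otimes\mathrm{Alt}^{n-1}$. The map $s^{k,n-1}:\mathrm{Alt}^{k,n-1}\to\mathrm{Alt}^{k-1}\otimes\mathrm{Alt}^n$ is $$s^{k,n-1}\omega(w_1,\dots,w_{k-1})(v_1,\dots,v_n)=\sum_{i=1}^n(-1)^{i-1}\omega(v_i,w_1,\dots,w_{k-1})(v_1,\dots,\widehat{v_i},\dots,v_n),$$ and $\mathbb X:=\ker(s^{k,n-1})$. Index notation. $\Sigma(1:j,1:n)$ is the set of increasing sequences of length $j$ in $\{1,\dots,n\}$, identified with subsets; $\sigma^c$ is the complement in $\{1,\dots,n\}$; for $i\notin\tau$, $i+\tau=\tau\cup\{i\}$, and $\epsilon(i,\tau)$ is the sign of the permutation sorting $(i,\tau(1),\dots,\tau(k-1))$ increasingly. For a basis $\{\mathrm dy_i\}_{i=1}^n$ of $\mathrm{Alt}^1$: $\mathrm dy_\sigma=\mathrm dy_{\sigma(1)}\wedge\cdots\wedge \mathrm dy_{\sigma(k)}$ and $*\mathrm dy_i=(-1)^{i-1}\mathrm dy_1\wedge\cdots\wedge\widehat{\mathrm dy_i}\wedge\cdots\wedge \mathrm dy_n$. Constraint sequences. For $\tau\in\Sigma(1:k-1,1:n)$ write $\tau^c=\{i_1<\dots<i_{n-k+1}\}$. The constraint sequence of $\tau$ is $\{(i_m+\tau,i_m)\}_{m=1}^{n-k+1}$; its first element $(i_1+\tau,i_1)$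 is its pair index. An index $(\sigma,i)$, $\sigma\in\Sigma(1:k,1:n)$, $1\le i\le n$, is free if it is not the pair index of any constraint sequence. Oblique projection. The linear map $\pi_{\mathbb X}:\mathrm{Alt}^{k,n-1}\to\mathbb X$ is defined by $\pi_{\mathbb X}(\mathrm dy_\sigma\otimes *\mathrm dy_i)=\mathrm dy_\sigma\otimes *\mathrm dy_i$ if $i\in\sigma^c$, and, along the constraint sequence of $\tau$, with $\sigma_{i_m}=i_m+\tau$, by $\pi_{\mathbb X}(\mathrm dy_{\sigma_{i_m}}\otimes*\mathrm dy_{i_m})=\mathrm dy_{\sigma_{i_m}}\otimes*\mathrm dy_{i_m}-\epsilon(i_m,\tau)\epsilon(i_1,\tau)\,\mathrm dy_{\sigma_{i_1}}\otimes*\mathrm dy_{i_1}$. $t$-$n$ basis. $\Delta_\ell(T)$ is the set of $\ell$-dimensional sub-simplices of $T$. A $t$-$n$ basis of $f\in\Delta_\ell(T)$ consists of $\ell$ linearly independent unit vectors $\boldsymbol t^f_1,\dots,\boldsymbol t^f_\ell$ tangential to $f$ followed by $n-\ell$ linearly independent unit vectors $\boldsymbol n_1^f,\dots,\boldsymbol n^f_{n-\ell}$ orthogonal to the tangent plane of $f$. The corresponding basis of $\mathrm{Alt}^1$ is $\mathrm dy_i^f(w)=\boldsymbol t_i^f\cdot w$ for $1\le i\le\ell$ (written $i\in\mathscr T^f$) and $\mathrm dy_i^f(w)=\boldsymbol n_{i-\ell}^f\cdot w$ for $\ell+1\le i\le n$ (written $i\in\mathscr N^f$). Define $$\mathscr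 T^f(\mathbb X)=\mathrm{span}\{\pi_{\mathbb X}(\mathrm dy^f_\sigma\otimes*\mathrm dy_i^f):(\sigma,i)\text{ free},\,i\in\mathscr T^f\},\quad \mathscr N^f(\mathbb X)=\mathrm{span}\{\pi_{\mathbb X}(\mathrm dy^f_\sigma\otimes*\mathrm dy_i^f):(\sigma,i)\text{ free},\,i\in\mathscr N^f\}.$$ Polynomials. $\lambda_0,\dots,\lambda_n$ are the barycentric coordinates of $T$. For $f\in\Delta_\ell(T)$ with vertex indices $f(0),\dots,f(\ell)$, $\mathbb P_r(f)$ is regarded as a subspace of $\mathbb P_r(T)$ through its Bernstein form $\mathrm{span}\{\lambda_{f(0)}^{\alpha_0}\cdots\lambda_{f(\ell)}^{\alpha_\ell}:\alpha_0+\dots+\alpha_\ell=r\}$; $\mathbb P_r(f)=\{0\}$ for $r<0$, and $\mathbb P_r$ of a vertex is one-dimensional for $r\geq 0$. $b_f=\lambda_{f(0)}\cdots\lambda_{f(\ell)}$. Then $\mathbb B_r\mathscr T^f(\mathbb X)=b_f\mathbb P_{r-(\ell+1)}(f)\otimes\mathscr T^f(\mathbb X)$ and $\mathbb B_r\mathscr N^f(\mathbb X)=b_f\mathbb P_{r-(\ell+1)}(f)\otimes\mathscr N^f(\mathbb X)$. $\mathbb P_r(T;\mathbb X)$ is the space of $\mathbb X$-valued polynomials of degree $\le r$ on $T$. Trace. Writing $\omega=\sum_{\sigma,i}a_{\sigma,i}\,\mathrm dx_\sigma\otimes *\mathrm dx_i$ in the standard orthonormal basis $\{\mathrm dx_i\}$,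 the trace on an $(n-1)$-dimensional face $F$ with unit normal $\boldsymbol n_F$ is $\mathrm{tr}_F^{\mathrm{div}}\omega=\sum_\sigma\big(\sum_i a_{\sigma,i}(\boldsymbol n_F)_i\big)|_F\,\mathrm dx_\sigma$ (i.e. $\boldsymbol A\boldsymbol n_F$ for the matrix $\boldsymbol A=(a_{\sigma,i})$); $\mathrm{tr}^{\mathrm{div}}\omega$ is the collection of these over all $F\in\Delta_{n-1}(T)$. $\mathbb B_r(\mathrm{div},T;\mathbb X)=\mathbb P_r(T;\mathbb X)\cap\ker(\mathrm{tr}^{\mathrm{div}})$. *)

theory Defs
  imports "HOL-Analysis.Analysis" "HOL-Library.Function_Algebras"
begin

text \<open>Pointwise real vector space structure on functions, so that the library notions
  \<^const>\<open>span\<close>, \<^const>\<open>dim\<close> and \<^const>\<open>representation\<close> apply to spaces of forms and of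
  form-valued fields.\<close>

instantiation "fun" :: (type, real_vector) real_vector
begin

definition scaleR_fun_def: "c *\<^sub>R f = (\<lambda>x. c *\<^sub>R f x)"

instance
  by standard (simp_all add: scaleR_fun_def fun_eq_iff scaleR_add_right scaleR_add_left)

end


section \<open>Alternating forms\<close>

text \<open>A \<open>j\<close>-linear form is a function of the list of its arguments; it is \<open>0\<close> by convention
  on lists of length other than \<open>j\<close>.\<close>

type_synonym 'n form = "(real, 'n) vec list \<Rightarrow> real"

text \<open>Elements of \<open>Alt\<^sup>p \<otimes> Alt\<^sup>q\<close>, evaluated as \<open>\<omega>(w\<^sub>1,\<dots>,w\<^sub>p)(v\<^sub>1,\<dots>,v\<^sub>q)\<close>.\<close>

type_synonym 'n dform = "(real, 'n) vec list \<Rightarrow> (real, 'n) vec list \<Rightarrow> real"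

definition Alt :: "nat \<Rightarrow> ('n::finite) form set" where
  "Alt j = {\<alpha>. (\<forall>v. length v \<noteq> j \<longrightarrow> \<alpha> v = 0) \<and>
     (\<forall>v i. length v = j \<and> i < j \<longrightarrow> linear (\<lambda>u. \<alpha> (v[i := u]))) \<and>
     (\<forall>v i m. length v = j \<and> i < m \<and> m < j \<and> v ! i = v ! m \<longrightarrow> \<alpha> v = 0)}"

definition tensor :: "'n form \<Rightarrow> 'n form \<Rightarrow> 'n dform" (infixr "\<otimes>\<^sub>f" 70) where
  "\<alpha> \<otimes>\<^sub>f \<beta> = (\<lambda>w v. \<alpha> w * \<beta> v)"

definition Alt2 :: "nat \<Rightarrow> nat \<Rightarrow> ('n::finite) dform set" where
  "Alt2 p q = span {\<alpha> \<otimes>\<^sub>f \<beta> | \<alpha> \<beta>. \<alpha> \<in> Alt p \<and> \<beta> \<in> Alt q}"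

text \<open>The map \<open>s\<^sup>k\<^sup>,\<^sup>n\<^sup>-\<^sup>1\<close>, with \<open>0\<close>-based summation index. For \<open>\<omega>\<close> in \<open>Alt2 k (n - 1)\<close>, the value
  is automatically \<open>0\<close> unless \<open>length w = k - 1\<close>.\<close>

definition s_map :: "('n::finite) dform \<Rightarrow> 'n dform" where
  "s_map \<omega> = (\<lambda>w v. if length v = CARD('n)
     then \<Sum>i<CARD('n). (- 1) ^ i * \<omega> ((v ! i) # w) (take i v @ drop (Suc i) v)
     else 0)"

definition XX :: "nat \<Rightarrow> ('n::finite) dform set" where
  "XX k = {\<omega> \<in> Alt2 k (CARD('n) - 1). s_map \<omega> = 0}"


section \<open>Bases of forms\<close>

text \<open>Wedge product of 1-forms, normalised such that
  \<open>(\<alpha>\<^sub>1 \<and> \<dots> \<and> \<alpha>\<^sub>j)(v\<^sub>1,\<dots>,v\<^sub>j) = det (\<alpha>\<^sub>a(v\<^sub>b))\<close>.\<close>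

definition wedge :: "((real, 'n) vec \<Rightarrow> real) list \<Rightarrow> 'n form" where
  "wedge \<alpha> = (\<lambda>v. if length v = length \<alpha>
     then \<Sum>p | p permutes {..<length \<alpha>}.
            of_int (sign p) * (\<Prod>a<length \<alpha>. (\<alpha> ! a) (v ! p a))
     else 0)"

text \<open>\<open>dy\<close> is a basis of \<open>Alt\<^sup>1\<close> indexed by \<open>{1..n}\<close>; increasing sequences are represented
  by their sets of entries.\<close>

definition wedge_at :: "(nat \<Rightarrow> (real, 'n) vec \<Rightarrow> real) \<Rightarrow> nat set \<Rightarrow> 'n form" where
  "wedge_at dy \<sigma> = wedge (map dy (sorted_list_of_set \<sigma>))"

definition star :: "(nat \<Rightarrow> (real, 'n::finite) vec \<Rightarrow> real) \<Rightarrow> nat \<Rightarrow> 'n form" where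
  "star dy i = (- 1) ^ (i - 1) *\<^sub>R wedge_at dy ({1..CARD('n)} - {i})"

definition basis_el :: "(nat \<Rightarrow> (real, 'n::finite) vec \<Rightarrow> real) \<Rightarrow> nat set \<Rightarrow> nat \<Rightarrow> 'n dform" where
  "basis_el dy \<sigma> i = wedge_at dy \<sigma> \<otimes>\<^sub>f star dy i"

definition Seqs :: "nat \<Rightarrow> nat \<Rightarrow> nat set set" where
  "Seqs j n = {\<sigma>. \<sigma> \<subseteq> {1..n} \<and> card \<sigma> = j}"

text \<open>The coefficient \<open>a\<^sub>\<sigma>\<^sub>,\<^sub>i\<close> of \<open>\<omega> = \<Sum>\<^sub>\<sigma>\<^sub>,\<^sub>i a\<^sub>\<sigma>\<^sub>,\<^sub>i dy\<^sub>\<sigma> \<otimes> *dy\<^sub>i\<close>.\<close>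

definition coeff_of ::
  "nat \<Rightarrow> (nat \<Rightarrow> (real, 'n::finite) vec \<Rightarrow> real) \<Rightarrow> 'n dform \<Rightarrow> nat set \<Rightarrow> nat \<Rightarrow> real" where
  "coeff_of k dy \<omega> \<sigma> i =
     representation {basis_el dy \<rho> j | \<rho> j. \<rho> \<in> Seqs k CARD('n) \<and> j \<in> {1..CARD('n)}}
       \<omega> (basis_el dy \<sigma> i)"


section \<open>Constraint sequences and the oblique projection\<close>

definition eps :: "nat \<Rightarrow> nat set \<Rightarrow> real" where
  "eps i \<tau> = (let xs = i # sorted_list_of_set \<tau> in
     of_int (sign (THE p. p permutes {..<length xs} \<and> sorted (permute_list p xs))))"

definition constraint_seq :: "nat \<Rightarrow> nat set \<Rightarrow> (nat set \<times> nat) list" where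
  "constraint_seq n \<tau> = map (\<lambda>i. (insert i \<tau>, i)) (sorted_list_of_set ({1..n} - \<tau>))"

definition pair_index :: "nat \<Rightarrow> nat set \<Rightarrow> nat set \<times> nat" where
  "pair_index n \<tau> = hd (constraint_seq n \<tau>)"

definition free_index :: "nat \<Rightarrow> nat \<Rightarrow> nat set \<Rightarrow> nat \<Rightarrow> bool" where
  "free_index n k \<sigma> i \<longleftrightarrow> \<sigma> \<in> Seqs k n \<and> i \<in> {1..n} \<and>
     (\<forall>\<tau> \<in> Seqs (k - 1) n. (\<sigma>, i) \<noteq> pair_index n \<tau>)"

text \<open>The prescribed value of the projection on \<open>dy\<^sub>\<sigma> \<otimes> *dy\<^sub>i\<close>. If \<open>i \<in> \<sigma>\<close>, then \<open>(\<sigma>, i)\<close> lies on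
  exactly one constraint sequence, that of \<open>\<tau> = \<sigma> - {i}\<close>.\<close>

definition proj_val :: "(nat \<Rightarrow> (real, 'n::finite) vec \<Rightarrow> real) \<Rightarrow> nat set \<Rightarrow> nat \<Rightarrow> 'n dform" where
  "proj_val dy \<sigma> i =
     (if i \<notin> \<sigma> then basis_el dy \<sigma> i
      else (let \<tau> = \<sigma> - {i}; (\<sigma>\<^sub>1, i\<^sub>1) = pair_index CARD('n) \<tau>
            in basis_el dy \<sigma> i - (eps i \<tau> * eps i\<^sub>1 \<tau>) *\<^sub>R basis_el dy \<sigma>\<^sub>1 i\<^sub>1))"

text \<open>Linear extension of these values to \<open>Alt2 k (n - 1)\<close>.\<close>

definition proj_X ::
  "nat \<Rightarrow> (nat \<Rightarrow> (real, 'n::finite) vec \<Rightarrow> real) \<Rightarrow> 'n dform \<Rightarrow> 'n dform" where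
  "proj_X k dy \<omega> =
     (\<Sum>\<sigma> \<in> Seqs k CARD('n). \<Sum>i \<in> {1..CARD('n)}. coeff_of k dy \<omega> \<sigma> i *\<^sub>R proj_val dy \<sigma> i)"


section \<open>Simplices and tangential-normal bases\<close>

definition verts :: "(real, 'n::finite) vec set \<Rightarrow> (real, 'n) vec set" where
  "verts S = {v. v extreme_point_of S}"

definition subsimplices :: "nat \<Rightarrow> (real, 'n::finite) vec set \<Rightarrow> (real, 'n) vec set set" where
  "subsimplices l T = {convex hull S | S. S \<subseteq> verts T \<and> card S = l + 1}"

definition tangent_space :: "(real, 'n::finite) vec set \<Rightarrow> (real, 'n) vec set" where
  "tangent_space f = span {x - y | x y. x \<in> f \<and> y \<in> f}"

text \<open>The first \<open>l\<close> vectors are \<open>t\<^sub>1,\<dots>,t\<^sub>l\<close>, the remaining ones \<open>n\<^sub>1,\<dots>,n\<^sub>n\<^sub>-\<^sub>l\<close>.\<close>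

definition tn_basis ::
  "nat \<Rightarrow> (real, 'n::finite) vec set \<Rightarrow> (nat \<Rightarrow> (real, 'n) vec) \<Rightarrow> bool" where
  "tn_basis l f b \<longleftrightarrow>
     (\<forall>i \<in> {1..CARD('n)}. norm (b i) = 1) \<and>
     (\<forall>i \<in> {1..l}. b i \<in> tangent_space f) \<and>
     inj_on b {1..l} \<and> independent (b ` {1..l}) \<and>
     (\<forall>i \<in> {l + 1..CARD('n)}. \<forall>u \<in> tangent_space f. orthogonal (b i) u) \<and>
     inj_on b {l + 1..CARD('n)} \<and> independent (b ` {l + 1..CARD('n)})"

definition covectors :: "(nat \<Rightarrow> (real, 'n::finite) vec) \<Rightarrow> nat \<Rightarrow> (real, 'n) vec \<Rightarrow> real" where
  "covectors b i = (\<lambda>w. b i \<bullet> w)"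

definition TX :: "nat \<Rightarrow> nat \<Rightarrow> (nat \<Rightarrow> (real, 'n::finite) vec) \<Rightarrow> 'n dform set" where
  "TX k l b = span {proj_X k (covectors b) (basis_el (covectors b) \<sigma> i) | \<sigma> i.
     free_index CARD('n) k \<sigma> i \<and> i \<in> {1..l}}"

definition NX :: "nat \<Rightarrow> nat \<Rightarrow> (nat \<Rightarrow> (real, 'n::finite) vec) \<Rightarrow> 'n dform set" where
  "NX k l b = span {proj_X k (covectors b) (basis_el (covectors b) \<sigma> i) | \<sigma> i.
     free_index CARD('n) k \<sigma> i \<and> i \<in> {l + 1..CARD('n)}}"


section \<open>Polynomial spaces\<close>

text \<open>A polynomial on \<open>T\<close> is represented by the polynomial function on the whole space;
  this loses nothing because an \<open>n\<close>-simplex has nonempty interior.\<close>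

definition Poly :: "nat \<Rightarrow> ((real, 'n::finite) vec \<Rightarrow> real) set" where
  "Poly r = span {(\<lambda>x. \<Prod>j\<in>UNIV. (x $ j) ^ a j) | a. (\<Sum>j\<in>UNIV. a j) \<le> r}"

definition field_tensor ::
  "((real, 'n::finite) vec \<Rightarrow> real) set \<Rightarrow> 'n dform set \<Rightarrow> ((real, 'n) vec \<Rightarrow> 'n dform) set" where
  "field_tensor P V = span {(\<lambda>x. p x *\<^sub>R A) | p A. p \<in> P \<and> A \<in> V}"

definition PolyX :: "nat \<Rightarrow> nat \<Rightarrow> ((real, 'n::finite) vec \<Rightarrow> 'n dform) set" where
  "PolyX r k = field_tensor (Poly r) (XX k)"

text \<open>Barycentric coordinate of the vertex \<open>v\<close>, extended affinely to the whole space.\<close>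

definition bary ::
  "(real, 'n::finite) vec set \<Rightarrow> (real, 'n) vec \<Rightarrow> (real, 'n) vec \<Rightarrow> real" where
  "bary T v x = (THE c. (\<forall>u. u \<notin> verts T \<longrightarrow> c u = 0) \<and> (\<Sum>u\<in>verts T. c u) = 1 \<and>
     (\<Sum>u\<in>verts T. c u *\<^sub>R u) = x) v"

text \<open>The degree is an integer so that \<open>Bernstein T f m = {0}\<close> for \<open>m < 0\<close>.\<close>

definition Bernstein ::
  "(real, 'n::finite) vec set \<Rightarrow> (real, 'n) vec set \<Rightarrow> int \<Rightarrow> ((real, 'n) vec \<Rightarrow> real) set" where
  "Bernstein T f m =
     span {(\<lambda>x. \<Prod>v\<in>verts f. bary T v x ^ a v) | a. int (\<Sum>v\<in>verts f. a v) = m}"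

definition bubble ::
  "(real, 'n::finite) vec set \<Rightarrow> (real, 'n) vec set \<Rightarrow> (real, 'n) vec \<Rightarrow> real" where
  "bubble T f x = (\<Prod>v\<in>verts f. bary T v x)"

definition bubble_space :: "(real, 'n::finite) vec set \<Rightarrow> nat \<Rightarrow> nat \<Rightarrow> (real, 'n) vec set \<Rightarrow>
    'n dform set \<Rightarrow> ((real, 'n) vec \<Rightarrow> 'n dform) set" where
  "bubble_space T r l f V =
     field_tensor {(\<lambda>x. bubble T f x * p x) | p. p \<in> Bernstein T f (int r - int (l + 1))} V"

definition BTX :: "(real, 'n::finite) vec set \<Rightarrow> nat \<Rightarrow> nat \<Rightarrow>
    ((real, 'n) vec set \<Rightarrow> nat \<Rightarrow> (real, 'n) vec) \<Rightarrow> nat \<Rightarrow> (real, 'n) vec set \<Rightarrow>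
    ((real, 'n) vec \<Rightarrow> 'n dform) set" where
  "BTX T r k tn l f = bubble_space T r l f (TX k l (tn f))"

definition BNX :: "(real, 'n::finite) vec set \<Rightarrow> nat \<Rightarrow> nat \<Rightarrow>
    ((real, 'n) vec set \<Rightarrow> nat \<Rightarrow> (real, 'n) vec) \<Rightarrow> nat \<Rightarrow> (real, 'n) vec set \<Rightarrow>
    ((real, 'n) vec \<Rightarrow> 'n dform) set" where
  "BNX T r k tn l f = bubble_space T r l f (NX k l (tn f))"


section \<open>Trace\<close>

text \<open>The linear order of the index type enumerates the standard coordinates as \<open>1,\<dots>,n\<close>.\<close>

definition coord :: "nat \<Rightarrow> 'n::{finite,linorder}" where
  "coord i = sorted_list_of_set UNIV ! (i - 1)"

definition dx :: "nat \<Rightarrow> (real, 'n::{finite,linorder}) vec \<Rightarrow> real" where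
  "dx i = (\<lambda>w. w $ coord i)"

definition unit_normal :: "(real, 'n::finite) vec set \<Rightarrow> (real, 'n) vec \<Rightarrow> bool" where
  "unit_normal F m \<longleftrightarrow> norm m = 1 \<and> (\<forall>u \<in> tangent_space F. orthogonal m u)"

text \<open>Trace on one face with normal \<open>m\<close>; the restriction to \<open>F\<close> is extended by \<open>0\<close>.\<close>

definition tr_face :: "nat \<Rightarrow> (real, 'n::{finite,linorder}) vec set \<Rightarrow> (real, 'n) vec \<Rightarrow>
    ((real, 'n) vec \<Rightarrow> 'n dform) \<Rightarrow> (real, 'n) vec \<Rightarrow> 'n form" where
  "tr_face k F m \<omega> = (\<lambda>x. if x \<in> F
     then \<Sum>\<sigma> \<in> Seqs k CARD('n).
            (\<Sum>i \<in> {1..CARD('n)}. coeff_of k dx (\<omega> x) \<sigma> i * m $ coord i) *\<^sub>R wedge_at dx \<sigma>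
     else 0)"

text \<open>The collection of all face traces, for a choice \<open>\<nu>\<close> of unit normals.\<close>

definition tr_div :: "nat \<Rightarrow> (real, 'n::{finite,linorder}) vec set \<Rightarrow>
    ((real, 'n) vec set \<Rightarrow> (real, 'n) vec) \<Rightarrow> ((real, 'n) vec \<Rightarrow> 'n dform) \<Rightarrow>
    (real, 'n) vec set \<Rightarrow> (real, 'n) vec \<Rightarrow> 'n form" where
  "tr_div k T \<nu> \<omega> = (\<lambda>F. if F \<in> subsimplices (CARD('n) - 1) T
     then tr_face k F (\<nu> F) \<omega> else 0)"

definition Bdiv :: "nat \<Rightarrow> nat \<Rightarrow> (real, 'n::{finite,linorder}) vec set \<Rightarrow>
    ((real, 'n) vec set \<Rightarrow> (real, 'n) vec) \<Rightarrow> ((real, 'n) vec \<Rightarrow> 'n dform) set" where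
  "Bdiv r k T \<nu> = {\<omega> \<in> PolyX r k. tr_div k T \<nu> \<omega> = 0}"


section \<open>Internal direct sums\<close>

definition family_sum :: "'i set \<Rightarrow> ('i \<Rightarrow> 'v::comm_monoid_add set) \<Rightarrow> 'v set" where
  "family_sum I S = {\<Sum>i\<in>I. u i | u. \<forall>i\<in>I. u i \<in> S i}"

definition direct_family :: "'i set \<Rightarrow> ('i \<Rightarrow> 'v::comm_monoid_add set) \<Rightarrow> bool" where
  "direct_family I S \<longleftrightarrow>
     (\<forall>u. (\<forall>i\<in>I. u i \<in> S i) \<and> (\<Sum>i\<in>I. u i) = 0 \<longrightarrow> (\<forall>i\<in>I. u i = 0))"

end

theory Submission
  imports Defs
begin

text \<open>
  A polynomial \<open>\<omega>\<close> of degree \<open>r\<close> has a unique Bernstein expansion \<open>\<Sum>\<^sub>\<alpha> \<lambda>\<^sup>\<alpha> A\<^sub>\<alpha>\<close> with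
  \<open>A\<^sub>\<alpha> \<in> X\<close>, and the bubble spaces of a face \<open>f\<close> collect the terms whose exponent \<open>\<alpha>\<close> is
  supported exactly on the vertices of \<open>f\<close>. On the facet opposite to a vertex \<open>v\<close> only the terms with
  \<open>\<alpha> v = 0\<close> survive, and their restrictions are still independent; so the trace of \<open>\<omega>\<close> vanishes
  iff each single \<open>A\<^sub>\<alpha>\<close> is annihilated by the normals of all facets containing \<open>f\<close>. The dual basis
  of a \<open>t\<close>-\<open>n\<close> basis again splits into tangential and normal vectors, and the facet normals span the
  orthogonal complement of \<open>f\<close>, so this condition says precisely that the coefficients of \<open>A\<^sub>\<alpha>\<close> at normal
  indices vanish, i.e. \<open>A\<^sub>\<alpha>\<close> lies in the tangential part. The oblique basis is dual to
  the coefficients at free indices, and in a constraint sequence the pair index has the smallest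
  \<open>i\<close>; hence \<open>X\<close> is the direct sum of its tangential and normal parts.
\<close>

text \<open>The vectors of a \<open>t\<close>-\<open>n\<close> basis are in general not orthonormal,
  so coefficients are read off by evaluating forms on the biorthogonal vectors \<open>e\<close>.
  Evaluated there, the condition that \<open>s_map\<close> kills \<omega> becomes one scalar
  equation for each \<tau>, and these equations have disjoint sets of unknowns: a pair (\<sigma>, i)
  with i in \<sigma> occurs only in the equation of \<tau> = \<sigma> - {i}. Solving each equation
  for its pair index, whose factor is a sign, leaves the free coefficients as coordinates of the
  constrained space. The correction term of the oblique projection therefore always sits at a
  smaller index than the one it corrects. A tangential basis element thus has no coefficient at any
  normal index, free or not, whereas a normal one may have a tangential coefficient at a pair index.
  This one-sidedness makes the tangential part equal to a common kernel of traces, because the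
  traces see every normal coefficient and not only the free ones.\<close>

lemma scaleR_fun_apply [simp]: "(c *\<^sub>R f) x = c *\<^sub>R f x"
  by (simp add: scaleR_fun_def)

lemma sum_fun_apply [simp]: "(\<Sum>i\<in>I. f i) x = (\<Sum>i\<in>I. f i x)"
  by (induction I rule: infinite_finite_induct) auto

section \<open>Alternating forms\<close>

text \<open>Sorting by adjacent swaps: the head stays in front while the tail is rearranged, and
  then walks to its place. The prefix \<open>pre\<close> holds the entries already passed, since
  swaps may happen anywhere in the list.\<close>

lemma adjacent_swap_invariant:
  assumes swap: "\<And>xs a b ys. P (xs @ a # b # ys) \<Longrightarrow> P (xs @ b # a # ys)"
    and "mset xs = mset ys" "P (pre @ xs)"
  shows "P (pre @ ys)"
  using assms(2,3)
proof (induction xs arbitrary: ys pre)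
  case Nil
  then show ?case by simp
next
  case (Cons x xs)
  then have "x \<in> set ys" by (metis list.set_intros(1) mset_eq_setD)
  then obtain ys1 ys2 where ys: "ys = ys1 @ x # ys2" by (meson split_list)
  with Cons.prems have "mset xs = mset (ys1 @ ys2)" by simp
  then have "P ((pre @ [x]) @ (ys1 @ ys2))"
    using Cons.IH Cons.prems by (metis append_Cons append_Nil append_assoc)
  then have "P (pre @ x # zs @ ys2)" if "ys1 = zs" for zs using that by simp
  \<comment> \<open>\<open>x\<close> walks to the right past \<open>zs\<close>, one swap per
    entry.\<close>
  moreover have "P (pre @ zs @ x # ws)" if "P (pre @ x # zs @ ws)" for zs ws
    using that
  proof (induction zs arbitrary: pre)
    case (Cons z zs)
    from swap[of pre x z "zs @ ws"] Cons.prems have "P ((pre @ [z]) @ x # zs @ ws)" by simp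
    from Cons.IH[OF this] show ?case by simp
  qed simp
  ultimately show ?case using ys by blast
qed

section \<open>Linearity, vanishing and sign rules of alternating forms\<close>

lemma Alt_length: "\<alpha> \<in> Alt j \<Longrightarrow> length v \<noteq> j \<Longrightarrow> \<alpha> v = 0"
  unfolding Alt_def by blast

text \<open>For lists of the wrong total length the map is constantly 0, hence still linear; this
  spares all later uses a length condition.\<close>

lemma Alt_linear:
  assumes "\<alpha> \<in> Alt j"
  shows "linear (\<lambda>u. \<alpha> (xs @ u # ys))"
proof (cases "length xs + length ys + 1 = j")
  case True
  have "\<forall>v i. length v = j \<and> i < j \<longrightarrow> linear (\<lambda>u. \<alpha> (v[i := u]))"
    using assms unfolding Alt_def by blast
  from this[rule_format, of "xs @ 0 # ys" "length xs"] True
  have "linear (\<lambda>u. \<alpha> ((xs @ 0 # ys)[length xs := u]))" by simp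
  then show ?thesis by simp
next
  case False
  then have "(\<lambda>u. \<alpha> (xs @ u # ys)) = (\<lambda>u. 0)"
    using assms by (auto simp: Alt_length fun_eq_iff)
  then show ?thesis by (simp add: linear_zero)
qed

lemma Alt_not_distinct:
  assumes "\<alpha> \<in> Alt j" "\<not> distinct v"
  shows "\<alpha> v = 0"
proof (cases "length v = j")
  case True
  from assms(2) obtain i m where "i < length v" "m < length v" "i \<noteq> m" "v ! i = v ! m"
    by (auto simp: distinct_conv_nth)
  then consider "i < m" "m < j" "v ! i = v ! m" | "m < i" "i < j" "v ! m = v ! i"
    using True by (metis linorder_neqE_nat)
  then show ?thesis
    using assms(1) True unfolding Alt_def by cases blast+
qed (use assms Alt_length in blast)

text \<open>Polarisation: expand the vanishing value with \<open>a + b\<close> in both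
  places.\<close>

lemma adjacent_swap_minus:
  fixes \<alpha> :: "'a::real_vector list \<Rightarrow> real"
  assumes lin: "\<And>xs ys. linear (\<lambda>u. \<alpha> (xs @ u # ys))"
    and adj: "\<And>xs a ys. \<alpha> (xs @ a # a # ys) = 0"
  shows "\<alpha> (xs @ a # b # ys) = - \<alpha> (xs @ b # a # ys)"
proof -
  have l1: "\<alpha> (xs @ (p + q) # c # ys) = \<alpha> (xs @ p # c # ys) + \<alpha> (xs @ q # c # ys)" for p q c
    using linear_add[OF lin[of xs "c # ys"]] .
  have l2: "\<alpha> (xs @ c # (p + q) # ys) = \<alpha> (xs @ c # p # ys) + \<alpha> (xs @ c # q # ys)" for p q c
    using linear_add[OF lin[of "xs @ [c]" "ys"], of p q] by simp
  have "0 = \<alpha> (xs @ (a + b) # (a + b) # ys)" using adj by simp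
  also have "\<dots> = \<alpha> (xs @ a # b # ys) + \<alpha> (xs @ b # a # ys)"
    unfolding l1 l2 using adj by simp
  finally show ?thesis by simp
qed

text \<open>Equal arguments at distant positions can be brought together by adjacent swaps, each of
  which only changes the sign. Checking neighbours alone suits \<open>insertion_sum\<close>, where
  equal neighbours leave just two cancelling terms.\<close>

lemma AltI_adjacent:
  assumes len: "\<And>v. length v \<noteq> j \<Longrightarrow> \<alpha> v = 0"
    and lin: "\<And>xs ys. linear (\<lambda>u. \<alpha> (xs @ u # ys))"
    and adj: "\<And>xs a ys. \<alpha> (xs @ a # a # ys) = 0"
  shows "\<alpha> \<in> Alt j"
proof -
  have "linear (\<lambda>u. \<alpha> (v[i := u]))" if "length v = j" "i < j" for v i
  proof -
    have "v[i := u] = take i v @ u # drop (Suc i) v" for u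
      using that by (simp add: upd_conv_take_nth_drop)
    then show ?thesis using lin by simp
  qed
  moreover have "\<alpha> v = 0" if "i < m" "m < length v" "v ! i = v ! m" for v i m
  proof -
    have "\<not> distinct v" using that by (metis distinct_conv_nth less_trans nat_neq_iff)
    then obtain xs ys zs y where v: "v = xs @ [y] @ ys @ [y] @ zs"
      using not_distinct_decomp by blast
    have "\<alpha> ([] @ v) = 0"
    proof (rule adjacent_swap_invariant[where P = "\<lambda>v. \<alpha> v = 0"])
      show "mset (y # y # xs @ ys @ zs) = mset v" using v by simp
      show "\<alpha> ([] @ y # y # xs @ ys @ zs) = 0" using adj[of "[]"] by simp
      show "\<alpha> (xs @ b # a # ys) = 0" if "\<alpha> (xs @ a # b # ys) = 0" for xs a b ys
        using adjacent_swap_minus[OF lin adj, of xs a b ys] that by simp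
    qed
    then show ?thesis by simp
  qed
  ultimately show ?thesis unfolding Alt_def using len by blast
qed

lemma Alt_adjacent: "\<alpha> \<in> Alt j \<Longrightarrow> \<alpha> (xs @ a # a # ys) = 0"
  by (rule Alt_not_distinct) auto

lemma subspace_Alt: "subspace (Alt j)"
proof (rule subspaceI)
  show "0 \<in> Alt j"
    by (rule AltI_adjacent) (simp_all add: linear_zero)
next
  fix x y :: "'a form" assume xy: "x \<in> Alt j" "y \<in> Alt j"
  show "x + y \<in> Alt j"
    by (rule AltI_adjacent)
      (use xy in \<open>simp_all add: Alt_length Alt_adjacent Alt_linear linear_compose_add\<close>)
next
  fix c :: real and x :: "'a form" assume x: "x \<in> Alt j"
  show "c *\<^sub>R x \<in> Alt j"
    by (rule AltI_adjacent)
      (use x linear_compose_scale_right[OF Alt_linear[OF x], of c] in \<open>simp_all add: Alt_length Alt_adjacent\<close>)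
qed

lemma Alt_Cons:
  assumes "\<alpha> \<in> Alt (Suc j)"
  shows "(\<lambda>w. \<alpha> (u # w)) \<in> Alt j"
proof (rule AltI_adjacent)
  show "\<alpha> (u # v) = 0" if "length v \<noteq> j" for v
    using that Alt_length[OF assms] by simp
  show "linear (\<lambda>x. \<alpha> (u # xs @ x # ys))" for xs ys
    using Alt_linear[OF assms, of "u # xs" ys] by simp
  show "\<alpha> (u # xs @ a # a # ys) = 0" for xs a ys
    using Alt_adjacent[OF assms, of "u # xs"] by simp
qed

text \<open>Polarisation again, now at two arbitrary positions; \<open>V x y\<close> is
  \<open>v\<close> with these two entries overwritten.\<close>

lemma Alt_transpose:
  assumes \<alpha>: "\<alpha> \<in> Alt j" and a: "a < j" and b: "b < j" and ab: "a \<noteq> b" and v: "length v = j"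
  shows "\<alpha> (permute_list (Transposition.transpose a b) v) = - \<alpha> v"
proof -
  define V where "V x y = v[a := x, b := y]" for x y
  have lenV: "length (V x y) = j" for x y using v by (simp add: V_def)
  have l2: "linear (\<lambda>y. \<alpha> (V x y))" for x
    using \<alpha> b v unfolding V_def Alt_def by simp
  have "V x y = v[b := y, a := x]" for x y
    unfolding V_def using ab by (simp add: list_update_swap)
  then have l1: "linear (\<lambda>x. \<alpha> (V x y))" for y
    using \<alpha> a v unfolding Alt_def by simp
  have d: "\<alpha> (V x x) = 0" for x
  proof (rule Alt_not_distinct[OF \<alpha>])
    have "V x x ! a = V x x ! b" using a b ab v by (simp add: V_def)
    then show "\<not> distinct (V x x)" using a b ab lenV by (metis distinct_conv_nth)
  qed
  define p where "p = v ! a"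
  define q where "q = v ! b"
  have "0 = \<alpha> (V (p + q) (p + q))" using d by simp
  also have "\<dots> = \<alpha> (V p q) + \<alpha> (V q p)"
    using linear_add[OF l1, of p q "p + q"] linear_add[OF l2, of p p q] linear_add[OF l2, of q p q] d[of p] d[of q]
    by linarith
  finally have "\<alpha> (V q p) = - \<alpha> (V p q)" by simp
  moreover have "V p q = v" unfolding V_def p_def q_def by simp
  moreover have "V q p = permute_list (Transposition.transpose a b) v"
    unfolding V_def p_def q_def
    by (rule nth_equalityI)
      (use a b ab v in \<open>auto simp: permute_list_def Transposition.transpose_def nth_list_update\<close>)
  ultimately show ?thesis by simp
qed

lemma Alt_permute:
  assumes "p permutes {..<j}" and \<alpha>: "\<alpha> \<in> Alt j" and "length v = j"
  shows "\<alpha> (permute_list p v) = of_int (sign p) * \<alpha> v"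
  using assms(1) finite_lessThan assms(3)
proof (induction p arbitrary: v rule: permutes_induct)
  case id
  then show ?case by simp
next
  case (swap a b p)
  have t: "permutation (Transposition.transpose a b)" "permutation p"
    using swap(4) permutation_swap_id permutation_permutes finite_lessThan by metis+
  have "\<alpha> (permute_list (Transposition.transpose a b \<circ> p) v)
      = \<alpha> (permute_list p (permute_list (Transposition.transpose a b) v))"
    using swap by (simp add: permute_list_compose)
  also have "\<dots> = of_int (sign p) * \<alpha> (permute_list (Transposition.transpose a b) v)"
    using swap by simp
  also have "\<dots> = - of_int (sign p) * \<alpha> v"
    using Alt_transpose[OF \<alpha>, of a b v] swap by simp
  also have "- of_int (sign p) = real_of_int (sign (Transposition.transpose a b \<circ> p))"
    unfolding sign_compose[OF t] sign_swap_id using swap(3) by simp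
  finally show ?case .
qed

text \<open>This discharges the definite description in \<open>eps\<close>. A sorting permutation
  exists because both lists have the same multiset of entries, and it is unique because the entries
  are distinct.\<close>

lemma eps_sign:
  assumes "finite \<tau>" "i \<notin> \<tau>"
  obtains p where "p permutes {..<Suc (card \<tau>)}" "eps i \<tau> = of_int (sign p)"
    "permute_list p (i # sorted_list_of_set \<tau>) = sorted_list_of_set (insert i \<tau>)"
proof -
  let ?xs = "i # sorted_list_of_set \<tau>" and ?ys = "sorted_list_of_set (insert i \<tau>)"
  have d: "distinct ?xs" "distinct ?ys" "set ?xs = set ?ys"
    using assms set_sorted_list_of_set[of "insert i \<tau>"] distinct_sorted_list_of_set[of "insert i \<tau>"]
    by simp_all
  then have "mset ?ys = mset ?xs" using set_eq_iff_mset_eq_distinct by metis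
  then obtain p where p: "p permutes {..<length ?xs}" "permute_list p ?xs = ?ys"
    by (rule mset_eq_permutation)
  have "(THE q. q permutes {..<length ?xs} \<and> sorted (permute_list q ?xs)) = p"
  proof (rule the_equality)
    show "p permutes {..<length ?xs} \<and> sorted (permute_list p ?xs)"
      using p sorted_sorted_list_of_set by metis
    fix q assume q: "q permutes {..<length ?xs} \<and> sorted (permute_list q ?xs)"
    have "permute_list q ?xs = ?ys"
    proof (rule sorted_distinct_set_unique)
      show "set (permute_list q ?xs) = set ?ys"
        using q d by (metis set_permute_list)
      show "distinct (permute_list q ?xs)" using q d by (metis distinct_permute_list)
    qed (use q d in auto)
    \<comment> \<open>Both permutations produce the same list, and in a list without repetitions an
      entry determines its position.\<close>
    with p have eq: "permute_list q ?xs = permute_list p ?xs" by simp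
    show "q = p"
    proof
      fix x
      show "q x = p x"
      proof (cases "x < length ?xs")
        case True
        then have "?xs ! q x = ?xs ! p x"
          using eq q p by (metis permute_list_nth)
        moreover have "q x < length ?xs" "p x < length ?xs"
          using True q p by (meson lessThan_iff permutes_in_image)+
        ultimately show ?thesis using d(1) by (metis nth_eq_iff_index_eq)
      qed (use q p in \<open>metis lessThan_iff permutes_not_in\<close>)
    qed
  qed
  then have "eps i \<tau> = of_int (sign p)" unfolding eps_def Let_def by simp
  with p show ?thesis using that by simp
qed

lemma eps_square: "finite \<tau> \<Longrightarrow> i \<notin> \<tau> \<Longrightarrow> eps i \<tau> * eps i \<tau> = 1"
  by (metis eps_sign of_int_1 of_int_mult sign_idempotent)

text \<open>The source of the signs in the constraint equations: moving \<open>e i\<close> from the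
  front to its sorted place costs the sign of the sorting permutation.\<close>

lemma Alt_insert:
  fixes e :: "nat \<Rightarrow> real^'n"
  assumes \<alpha>: "\<alpha> \<in> Alt j" and fin: "finite \<tau>" "i \<notin> \<tau>" and j: "j = Suc (card \<tau>)"
  shows "\<alpha> (e i # map e (sorted_list_of_set \<tau>))
    = eps i \<tau> * \<alpha> (map e (sorted_list_of_set (insert i \<tau>)))"
proof -
  obtain p where p: "p permutes {..<Suc (card \<tau>)}" "eps i \<tau> = of_int (sign p)"
    "permute_list p (i # sorted_list_of_set \<tau>) = sorted_list_of_set (insert i \<tau>)"
    using eps_sign fin by metis
  have "map e (sorted_list_of_set (insert i \<tau>)) = permute_list p (e i # map e (sorted_list_of_set \<tau>))"
    unfolding p(3)[symmetric] using p(1) fin by (subst permute_list_map[symmetric]) auto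
  moreover have "\<alpha> (permute_list p (e i # map e (sorted_list_of_set \<tau>)))
    = eps i \<tau> * \<alpha> (e i # map e (sorted_list_of_set \<tau>))"
    using Alt_permute[OF _ \<alpha>] p j fin by simp
  \<comment> \<open>The sign was obtained on the other side; being its own inverse, it can be moved
    across.\<close>
  ultimately show ?thesis using eps_square[OF fin]
    by (metis mult.assoc mult_1)
qed

text \<open>Multilinearity extends the vanishing from \<open>E\<close> to its span, one argument at
  a time.\<close>

lemma Alt_eq_0_on_lists:
  assumes \<alpha>: "\<alpha> \<in> Alt j" and E: "span E = UNIV"
    and z: "\<And>v. set v \<subseteq> E \<Longrightarrow> length v = j \<Longrightarrow> \<alpha> v = 0"
  shows "\<alpha> = 0"
proof
  fix v
  \<comment> \<open>The unrestricted arguments form a prefix. Its last entry is treated by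
    linearity, which reduces to entries of \<open>E\<close> and so to a shorter prefix.\<close>
  have "\<alpha> (xs @ ys) = 0" if "set ys \<subseteq> E" for xs ys
    using that
  proof (induction xs arbitrary: ys rule: rev_induct)
    case Nil
    then show ?case using z \<alpha> Alt_length by (metis append_Nil)
  next
    case (snoc u xs)
    have "\<alpha> (xs @ u # ys) = 0"
    proof (rule linear_eq_0_on_span[of "\<lambda>u. \<alpha> (xs @ u # ys)" E])
      show "\<alpha> (xs @ x # ys) = 0" if "x \<in> E" for x
        using snoc.IH[of "x # ys"] snoc.prems that by simp
    qed (use Alt_linear[OF \<alpha>] E in auto)
    then show ?case by simp
  qed
  from this[of "[]" v] show "\<alpha> v = 0 v" by simp
qed

text \<open>Lists of basis vectors with a repetition contribute nothing, and all others can be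
  sorted up to sign, so increasing lists decide.\<close>

lemma Alt_eq_0:
  fixes e :: "nat \<Rightarrow> real^'n"
  assumes \<alpha>: "\<alpha> \<in> Alt j" and E: "span (e ` {1..n}) = UNIV"
    and z: "\<And>\<sigma>. \<sigma> \<in> Seqs j n \<Longrightarrow> \<alpha> (map e (sorted_list_of_set \<sigma>)) = 0"
  shows "\<alpha> = 0"
proof (rule Alt_eq_0_on_lists[OF \<alpha> E])
  fix v assume v: "set v \<subseteq> e ` {1..n}" "length v = j"
  then obtain js where js: "v = map e js" "set js \<subseteq> {1..n}"
  proof -
    from v(1) have "v \<in> map e ` lists {1..n}" unfolding lists_image[symmetric] by (simp add: lists_eq_set)
    then show thesis using that by (auto simp: lists_eq_set)
  qed
  show "\<alpha> v = 0"
  proof (cases "distinct v")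
    case True
    then have d: "distinct js" using js by (simp add: distinct_map)
    have "set js \<in> Seqs j n"
      using d js v by (auto simp: Seqs_def distinct_card)
    from z[OF this] have z': "\<alpha> ([] @ map e (sorted_list_of_set (set js))) = 0" by simp
    have m: "mset (sorted_list_of_set (set js)) = mset js"
      using d by (simp add: set_eq_iff_mset_eq_distinct[symmetric])
    have "\<alpha> ([] @ v) = 0"
    proof (rule adjacent_swap_invariant[where P = "\<lambda>v. \<alpha> v = 0", OF _ _ z'])
      show "\<alpha> (xs @ b # a # ys) = 0" if "\<alpha> (xs @ a # b # ys) = 0" for xs a b ys
        using adjacent_swap_minus[OF Alt_linear[OF \<alpha>] Alt_adjacent[OF \<alpha>], of xs a b ys] that by simp
    qed (simp add: js m)
    then show ?thesis by simp
  qed (use Alt_not_distinct[OF \<alpha>] in blast)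
qed

text \<open>This is the Leibniz formula of a determinant: each summand contains every argument in
  exactly one factor, and equal arguments make the summands cancel in pairs.\<close>

lemma wedge_in_Alt:
  assumes lin: "\<And>a. a < length \<alpha> \<Longrightarrow> linear (\<alpha> ! a)"
  shows "wedge \<alpha> \<in> Alt (length \<alpha>)"
proof -
  let ?j = "length \<alpha>" and ?P = "{p. p permutes {..<length \<alpha>}}"
  have "linear (\<lambda>u. wedge \<alpha> (v[i := u]))" if v: "length v = ?j" "i < ?j" for v i
  proof -
    have "linear (\<lambda>u. of_int (sign p) * (\<Prod>a<?j. (\<alpha> ! a) (v[i := u] ! p a)))" if "p \<in> ?P" for p
    proof -
      have p: "p permutes {..<?j}" using that by simp
      then obtain b where b: "b < ?j" "p b = i"
        using v(2) by (metis lessThan_iff permutes_in_image permutes_surj surjD)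
      \<comment> \<open>Only the factor at \<open>b\<close>, the preimage of position
        \<open>i\<close> under \<open>p\<close>, depends on \<open>u\<close>.\<close>
      have "(\<Prod>a<?j. (\<alpha> ! a) (v[i := u] ! p a))
        = (\<alpha> ! b) u * (\<Prod>a\<in>{..<?j} - {b}. (\<alpha> ! a) (v ! p a))" for u
      proof -
        have "(\<Prod>a<?j. (\<alpha> ! a) (v[i := u] ! p a))
          = (\<alpha> ! b) (v[i := u] ! p b) * (\<Prod>a\<in>{..<?j} - {b}. (\<alpha> ! a) (v[i := u] ! p a))"
          using b by (intro prod.remove) auto
        also have "(\<Prod>a\<in>{..<?j} - {b}. (\<alpha> ! a) (v[i := u] ! p a))
          = (\<Prod>a\<in>{..<?j} - {b}. (\<alpha> ! a) (v ! p a))"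
          using p b by (intro prod.cong refl) (metis DiffE insertCI nth_list_update_neq permutes_inj injD)
        finally show ?thesis using b v by simp
      qed
      then have "(\<lambda>u. of_int (sign p) * (\<Prod>a<?j. (\<alpha> ! a) (v[i := u] ! p a)))
        = (\<lambda>u. (of_int (sign p) * (\<Prod>a\<in>{..<?j} - {b}. (\<alpha> ! a) (v ! p a))) *\<^sub>R (\<alpha> ! b) u)"
        by (simp add: fun_eq_iff)
      then show ?thesis using lin[OF b(1)] by (simp only: linear_compose_scale_right)
    qed
    then have "linear (\<lambda>u. \<Sum>p\<in>?P. of_int (sign p) * (\<Prod>a<?j. (\<alpha> ! a) (v[i := u] ! p a)))"
      by (intro linear_compose_sum) auto
    then show ?thesis using v by (simp add: wedge_def)
  qed
  moreover have "wedge \<alpha> v = 0" if v: "length v = ?j" "i < m" "m < ?j" "v ! i = v ! m" for v i m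
  proof -
    let ?t = "Transposition.transpose i m"
    let ?f = "\<lambda>p. of_int (sign p) * (\<Prod>a<?j. (\<alpha> ! a) (v ! p a))"
    have t: "?t permutes {..<?j}" using v by (simp add: permutes_swap_id)
    have tv: "v ! ?t x = v ! x" for x unfolding Transposition.transpose_def using v(4) by presburger
    have st: "sign (?t \<circ> p) = - sign p" if "p permutes {..<?j}" for p
    proof -
      have "permutation p" using that permutation_permutes finite_lessThan by metis
      from sign_compose[OF permutation_swap_id this, of i m] show ?thesis
        unfolding sign_swap_id using v(2) by simp
    qed
    \<comment> \<open>Composing with the transposition of the two equal arguments permutes the
      summands and flips every sign, so the sum equals its own negative.\<close>
    have "sum ?f ?P = sum (\<lambda>p. ?f (?t \<circ> p)) ?P"
      by (rule setum_permutations_compose_left[OF t])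
    also have "\<dots> = sum (\<lambda>p. - ?f p) ?P"
      by (rule sum.cong) (use st in \<open>auto simp: tv\<close>)
    finally have "sum ?f ?P = 0" by (simp add: sum_negf)
    then show ?thesis using v by (simp add: wedge_def)
  qed
  ultimately show ?thesis unfolding Alt_def by (auto simp: wedge_def)
qed

text \<open>
  With \<open>\<beta> u = \<omega>(u, w)\<close> this is \<open>s_map \<omega> w\<close>; with \<open>\<beta> u = \<mu>(u) \<gamma>\<close> it is the wedge product of the
  1-form \<open>\<mu>\<close> with \<open>\<gamma>\<close>.
\<close>

definition insertion_sum :: "('a \<Rightarrow> 'a list \<Rightarrow> real) \<Rightarrow> 'a list \<Rightarrow> real" where
  "insertion_sum \<beta> v = (\<Sum>i<length v. (- 1) ^ i * \<beta> (v ! i) (take i v @ drop (Suc i) v))"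

text \<open>If two neighbours agree, deleting any other entry leaves a repeated argument. The two
  deletions that remain produce the same list, with opposite signs.\<close>

lemma insertion_sum_in_Alt:
  fixes \<beta> :: "real^'n \<Rightarrow> 'n form"
  assumes lin: "\<And>ys. linear (\<lambda>u. \<beta> u ys)" and \<beta>: "\<And>u. \<beta> u \<in> Alt m"
  shows "insertion_sum \<beta> \<in> Alt (Suc m)"
proof (rule AltI_adjacent)
  fix v :: "(real^'n) list" assume v: "length v \<noteq> Suc m"
  have "\<beta> (v ! i) (take i v @ drop (Suc i) v) = 0" if "i < length v" for i
    using that v by (intro Alt_length[OF \<beta>]) auto
  then show "insertion_sum \<beta> v = 0" by (simp add: insertion_sum_def)
next
  fix xs ys :: "(real^'n) list"
  have "linear (\<lambda>u. (-1) ^ i * \<beta> ((xs @ u # ys) ! i) (take i (xs @ u # ys) @ drop (Suc i) (xs @ u # ys)))"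
    if i: "i < length xs + length ys + 1" for i
  proof -
    have "linear (\<lambda>u. \<beta> ((xs @ u # ys) ! i) (take i (xs @ u # ys) @ drop (Suc i) (xs @ u # ys)))"
    proof -
      \<comment> \<open>The deleted entry lies before \<open>u\<close>, is \<open>u\<close> itself,
        or lies after it. Only in the middle case is \<open>u\<close> the parameter of \<beta>,
        where \<open>lin\<close> applies; otherwise it is an ordinary argument.\<close>
      consider (1) "i < length xs" | (2) "i = length xs" | (3) l where "i = Suc (length xs + l)" "l < length ys"
      proof (cases "i \<le> length xs")
        case False
        then have "i = Suc (length xs + (i - Suc (length xs)))" "i - Suc (length xs) < length ys"
          using i by auto
        then show ?thesis using 3 by blast
      qed (use 1 2 in linarith)
      then show ?thesis
      proof cases
        case 1
        then show ?thesis
          using Alt_linear[OF \<beta>, of "xs ! i" "take i xs @ drop (Suc i) xs" ys]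
          by (simp add: nth_append)
      next
        case 2
        then show ?thesis using lin by simp
      next
        case 3
        then show ?thesis
          using Alt_linear[OF \<beta>, of "ys ! l" xs "take l ys @ drop (Suc l) ys"]
          by (simp add: nth_append)
      qed
    qed
    from linear_compose_scale_right[OF this, of "(-1)^i"] show ?thesis by simp
  qed
  then have "linear (\<lambda>u. \<Sum>i<length xs + length ys + 1. (-1) ^ i *
    \<beta> ((xs @ u # ys) ! i) (take i (xs @ u # ys) @ drop (Suc i) (xs @ u # ys)))"
    by (intro linear_compose_sum ballI) (simp only: lessThan_iff)
  moreover have "length (xs @ u # ys) = length xs + length ys + 1" for u by simp
  ultimately show "linear (\<lambda>u. insertion_sum \<beta> (xs @ u # ys))"
    unfolding insertion_sum_def by (simp only:)
next
  fix xs ys :: "(real^'n) list" and a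
  let ?v = "xs @ a # a # ys"
  let ?f = "\<lambda>i. (-1) ^ i * \<beta> (?v ! i) (take i ?v @ drop (Suc i) ?v)"
  let ?l = "length xs"
  have "?f i = 0" if i: "i < length ?v" "i \<noteq> ?l" "i \<noteq> Suc ?l" for i
  proof -
    consider (1) "i < ?l" | (2) l where "i = Suc (Suc (?l + l))"
    proof (cases "i < ?l")
      case False
      then have "i = Suc (Suc (?l + (i - Suc (Suc ?l))))" using i by linarith
      then show ?thesis using 2 by blast
    qed (use 1 in blast)
    then have "\<not> distinct (take i ?v @ drop (Suc i) ?v)"
      by cases auto
    then show ?thesis using Alt_not_distinct[OF \<beta>] by simp
  qed
  then have "(\<Sum>i<length ?v. ?f i) = (\<Sum>i\<in>{?l, Suc ?l}. ?f i)"
    by (intro sum.mono_neutral_right) auto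
  \<comment> \<open>Deleting either copy of \<open>a\<close> gives the same list, and consecutive
    powers of -1 cancel.\<close>
  also have "\<dots> = 0" by (simp add: nth_append)
  finally show "insertion_sum \<beta> ?v = 0" unfolding insertion_sum_def .
qed

declare One_nat_def [simp del]

section \<open>Coordinates with respect to a pair of dual bases\<close>

lemma independent_family:
  fixes g :: "'i \<Rightarrow> 'v::real_vector"
  assumes fin: "finite I"
    and z: "\<And>c. (\<Sum>i\<in>I. c i *\<^sub>R g i) = 0 \<Longrightarrow> \<forall>i\<in>I. c i = 0"
  shows "inj_on g I" "independent (g ` I)"
proof -
  show inj: "inj_on g I"
  proof (rule inj_onI, rule ccontr)
    fix i j assume ij: "i \<in> I" "j \<in> I" "g i = g j" "i \<noteq> j"
    \<comment> \<open>If two indices shared a vector, 1 at \<open>i\<close> and -1 at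
      \<open>j\<close> would be a nontrivial relation.\<close>
    let ?c = "\<lambda>l. (if l = i then 1 else 0) - (if l = j then 1 else (0::real))"
    have "(\<Sum>l\<in>I. ?c l *\<^sub>R g l)
      = (\<Sum>l\<in>I. (if l = i then g l else 0)) - (\<Sum>l\<in>I. (if l = j then g l else 0))"
      unfolding sum_subtractf[symmetric] by (rule sum.cong) (auto simp: algebra_simps)
    also have "\<dots> = 0" using ij fin by (simp add: sum.delta)
    finally have "?c i = 0" using z[of ?c] ij(1) by blast
    then show False using ij by simp
  qed
  show "independent (g ` I)"
  proof
    assume "dependent (g ` I)"
    then obtain u where u: "\<exists>v\<in>g ` I. u v \<noteq> 0" "(\<Sum>v\<in>g ` I. u v *\<^sub>R v) = 0"
      using dependent_finite[of "g ` I"] fin by blast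
    from u(2) have "(\<Sum>i\<in>I. u (g i) *\<^sub>R g i) = 0" by (simp add: sum.reindex[OF inj])
    from z[OF this] u(1) show False by auto
  qed
qed

lemma dual_family_independent:
  fixes g :: "'i \<Rightarrow> 'v::real_vector" and \<phi> :: "'i \<Rightarrow> 'v \<Rightarrow> real"
  assumes fin: "finite I" and lin: "\<And>i. i \<in> I \<Longrightarrow> linear (\<phi> i)"
    and \<phi>: "\<And>i j. i \<in> I \<Longrightarrow> j \<in> I \<Longrightarrow> \<phi> i (g j) = (if i = j then 1 else 0)"
  shows "inj_on g I" "independent (g ` I)"
proof -
  have "\<forall>i\<in>I. c i = 0" if c: "(\<Sum>i\<in>I. c i *\<^sub>R g i) = 0" for c
  proof
    fix i assume i: "i \<in> I"
    have "0 = \<phi> i (\<Sum>j\<in>I. c j *\<^sub>R g j)" using c lin[OF i] by (simp add: linear_0)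
    also have "\<dots> = (\<Sum>j\<in>I. c j * \<phi> i (g j))"
      using lin[OF i] by (simp add: linear_sum linear_scale)
    also have "\<dots> = (\<Sum>j\<in>I. if j = i then c j else 0)"
      using \<phi> i by (intro sum.cong) auto
    also have "\<dots> = c i" using i fin by simp
    finally show "c i = 0" by simp
  qed
  from independent_family[OF fin, of g, OF this]
  show "inj_on g I" "independent (g ` I)" by blast+
qed

section \<open>Index sets and the membership of basis elements in the form spaces\<close>

lemma finite_Seqs [simp]: "finite (Seqs k n)"
  unfolding Seqs_def by simp

lemma Seqs_finite: "\<sigma> \<in> Seqs k n \<Longrightarrow> finite \<sigma>"
  unfolding Seqs_def using finite_subset by blast

lemma card_Seqs: "card (Seqs k n) = n choose k"
  unfolding Seqs_def using n_subsets[of "{1..n}" k] by simp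

lemma Seqs_full: "Seqs n n = {{1..n}}"
proof
  show "Seqs n n \<subseteq> {{1..n}}"
    unfolding Seqs_def using card_subset_eq[of "{1..n}"] by auto
qed (simp add: Seqs_def)

lemma Seqs_remove: "i \<in> {1..n} \<Longrightarrow> {1..n} - {i} \<in> Seqs (n - 1) n"
  unfolding Seqs_def by auto

lemma Seqs_coatom:
  assumes "\<rho> \<in> Seqs (n - 1) n" "n \<ge> 1"
  obtains i where "i \<in> {1..n}" "\<rho> = {1..n} - {i}"
proof -
  have "card ({1..n} - \<rho>) = 1"
    using assms by (subst card_Diff_subset) (auto simp: Seqs_def intro: finite_subset)
  then obtain i where i: "{1..n} - \<rho> = {i}" by (meson card_1_singletonE)
  moreover have "\<rho> \<subseteq> {1..n}" using assms by (simp add: Seqs_def)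
  ultimately have "i \<in> {1..n}" "\<rho> = {1..n} - {i}" by blast+
  then show ?thesis using that by blast
qed

lemma linear_covector: "linear (covectors b i)"
  unfolding covectors_def by (rule bounded_linear.linear[OF bounded_linear_inner_right])

lemma wedge_at_in_Alt:
  assumes "\<sigma> \<in> Seqs j n"
  shows "wedge_at (covectors b) \<sigma> \<in> Alt j"
proof -
  have "wedge (map (covectors b) (sorted_list_of_set \<sigma>))
    \<in> Alt (length (map (covectors b) (sorted_list_of_set \<sigma>)))"
    by (rule wedge_in_Alt) (simp add: linear_covector)
  then show ?thesis using assms Seqs_finite[OF assms] by (simp add: wedge_at_def Seqs_def)
qed

lemma star_in_Alt:
  assumes "i \<in> {1..CARD('n)}"
  shows "star (covectors b) i \<in> (Alt (CARD('n) - 1) :: 'n::finite form set)"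
  unfolding star_def
  by (intro subspace_scale[OF subspace_Alt] wedge_at_in_Alt[OF Seqs_remove] assms)

lemma tensor_in_Alt2: "\<alpha> \<in> Alt p \<Longrightarrow> \<beta> \<in> Alt q \<Longrightarrow> \<alpha> \<otimes>\<^sub>f \<beta> \<in> Alt2 p q"
  unfolding Alt2_def by (rule span_base) blast

lemma basis_el_in_Alt2:
  assumes "\<sigma> \<in> Seqs k CARD('n)" "i \<in> {1..CARD('n)}"
  shows "basis_el (covectors b) \<sigma> i \<in> (Alt2 k (CARD('n) - 1) :: 'n::finite dform set)"
  unfolding basis_el_def by (intro tensor_in_Alt2 wedge_at_in_Alt[OF assms(1)] star_in_Alt assms)

text \<open>Together with \<open>Alt2_snd\<close> this replaces the span of pure tensors by
  membership in each slot, so that the vanishing criteria for \<open>Alt\<close> can be applied slot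
  by slot.\<close>

lemma Alt2_fst: "\<omega> \<in> Alt2 p q \<Longrightarrow> (\<lambda>w. \<omega> w v) \<in> Alt p"
  unfolding Alt2_def
proof (induction rule: span_induct_alt)
  case base
  then show ?case using subspace_0[OF subspace_Alt] by (simp add: zero_fun_def)
next
  case (step c x y)
  then obtain \<alpha> \<beta> where x: "x = \<alpha> \<otimes>\<^sub>f \<beta>" "\<alpha> \<in> Alt p" by blast
  have "(\<lambda>w. (c *\<^sub>R x + y) w v) = (c * \<beta> v) *\<^sub>R \<alpha> + (\<lambda>w. y w v)"
    by (auto simp: x tensor_def)
  then show ?case
    using x step by (simp add: subspace_add[OF subspace_Alt] subspace_scale[OF subspace_Alt])
qed

lemma Alt2_snd: "\<omega> \<in> Alt2 p q \<Longrightarrow> \<omega> w \<in> Alt q"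
  unfolding Alt2_def
proof (induction rule: span_induct_alt)
  case base
  then show ?case using subspace_0[OF subspace_Alt] by (simp add: zero_fun_def)
next
  case (step c x y)
  then obtain \<alpha> \<beta> where x: "x = \<alpha> \<otimes>\<^sub>f \<beta>" "\<beta> \<in> Alt q" by blast
  have e: "(c *\<^sub>R x + y) w = (c * \<alpha> w) *\<^sub>R \<beta> + y w"
    by (auto simp: x tensor_def)
  show ?case
    unfolding e using x step by (intro subspace_add[OF subspace_Alt] subspace_scale[OF subspace_Alt])
qed

lemma subspace_Alt2: "subspace (Alt2 p q)"
  unfolding Alt2_def by (rule subspace_span)

text \<open>List positions start at 0 while indices start at 1, so deleting position
  \<open>i\<close> removes the index \<open>Suc i\<close>.\<close>

lemma sorted_list_remove_nth:
  assumes "i < n"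
  shows "sorted_list_of_set ({1..n} - {Suc i}) = take i [1..<Suc n] @ drop (Suc i) [1..<Suc n]"
proof (rule sorted_distinct_set_unique)
  have e: "take i [1..<Suc n] @ drop (Suc i) [1..<Suc n] = [1..<Suc i] @ [Suc (Suc i)..<Suc n]"
    using assms by (simp add: take_upt drop_upt One_nat_def del: upt_Suc)
  show "sorted (take i [1..<Suc n] @ drop (Suc i) [1..<Suc n])"
    "distinct (take i [1..<Suc n] @ drop (Suc i) [1..<Suc n])"
    "set (sorted_list_of_set ({1..n} - {Suc i})) = set (take i [1..<Suc n] @ drop (Suc i) [1..<Suc n])"
    unfolding e using assms by (auto simp: sorted_append simp del: upt_Suc)
qed simp_all

text \<open>After the shift to indices from 1, sign and deleted index are those of
  \<open>star\<close>; this is how the coefficients \<open>cf\<close> enter both the constraint and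
  the trace.\<close>

lemma insertion_sum_basis:
  "insertion_sum \<beta> (map e (sorted_list_of_set {1..n}))
    = (\<Sum>i=1..n. (- 1) ^ (i - 1) * \<beta> (e i) (map e (sorted_list_of_set ({1..n} - {i}))))"
proof -
  have l: "sorted_list_of_set {1..n} = [1..<Suc n]"
    by (metis atLeastLessThanSuc_atLeastAtMost sorted_list_of_set_range)
  have "insertion_sum \<beta> (map e (sorted_list_of_set {1..n}))
    = (\<Sum>i<n. (- 1) ^ i * \<beta> (e (Suc i)) (map e (sorted_list_of_set ({1..n} - {Suc i}))))"
    unfolding insertion_sum_def l
    by (rule sum.cong)
      (simp_all add: sorted_list_remove_nth take_map drop_map plus_1_eq_Suc del: upt_Suc take_upt drop_upt)
  also have "\<dots> = (\<Sum>i=1..n. (- 1) ^ (i - 1) * \<beta> (e i) (map e (sorted_list_of_set ({1..n} - {i}))))"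
    by (rule sum.reindex_bij_witness[of _ "\<lambda>i. i - 1" Suc]) auto
  finally show ?thesis .
qed

text \<open>Covectors are given by \<open>b\<close> and evaluation points by \<open>e\<close>.
  Keeping the two apart handles oblique \<open>t\<close>-\<open>n\<close> bases, and the self-dual
  standard basis is the instance where they agree.\<close>

locale dual_bases =
  fixes b e :: "nat \<Rightarrow> real^'n::finite"
  assumes dual: "i \<in> {1..CARD('n)} \<Longrightarrow> j \<in> {1..CARD('n)} \<Longrightarrow> b i \<bullet> e j = (if i = j then 1 else 0)"
begin

abbreviation (input) "dy \<equiv> covectors b"

lemma
  shows inj_e: "inj_on e {1..CARD('n)}" and independent_e: "independent (e ` {1..CARD('n)})"
  using dual_family_independent[of "{1..CARD('n)}" "covectors b" e] linear_covector dual
  by (auto simp: covectors_def)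

lemma span_e: "span (e ` {1..CARD('n)}) = UNIV"
proof -
  have "card (e ` {1..CARD('n)}) = DIM(real^'n)" using inj_e by (simp add: card_image)
  then show ?thesis using independent_e
    by (metis card_eq_dim dim_UNIV independent_imp_finite subset_UNIV top.extremum_uniqueI)
qed

lemma expand_e: "x = (\<Sum>j=1..CARD('n). (b j \<bullet> x) *\<^sub>R e j)"
proof -
  have "x \<in> span (e ` {1..CARD('n)})" using span_e by simp
  then obtain u where "x = (\<Sum>v\<in>e ` {1..CARD('n)}. u v *\<^sub>R v)"
    by (auto simp: span_finite)
  then have u: "x = (\<Sum>j=1..CARD('n). u (e j) *\<^sub>R e j)"
    using sum.reindex[OF inj_e, of "\<lambda>v. u v *\<^sub>R v"] by simp
  have "b i \<bullet> x = u (e i)" if i: "i \<in> {1..CARD('n)}" for i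
  proof -
    have "b i \<bullet> x = (\<Sum>j=1..CARD('n). u (e j) * (b i \<bullet> e j))"
      by (subst u) (simp add: inner_sum_right)
    also have "\<dots> = (\<Sum>j=1..CARD('n). if j = i then u (e j) else 0)"
      using i dual by (intro sum.cong) auto
    finally show ?thesis using i by simp
  qed
  then show ?thesis by (subst (1) u) (rule sum.cong, auto)
qed

lemma expand_b: "x = (\<Sum>j=1..CARD('n). (x \<bullet> e j) *\<^sub>R b j)"
proof -
  interpret flip: dual_bases e b by standard (use dual in \<open>auto simp: inner_commute\<close>)
  show ?thesis using flip.expand_e[of x] by (simp add: inner_commute)
qed

text \<open>This is a minor of the identity matrix with rows \<rho> and columns \<sigma>. For equal
  sets a permutation other than the identity mismatches two increasing lists; for different sets of
  equal size some row index is missing among the columns and kills every summand.\<close>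

lemma wedge_at_dual:
  assumes \<rho>: "\<rho> \<in> Seqs j CARD('n)" and \<sigma>: "\<sigma> \<in> Seqs j CARD('n)"
  shows "wedge_at dy \<rho> (map e (sorted_list_of_set \<sigma>)) = (if \<rho> = \<sigma> then 1 else 0)"
proof -
  let ?r = "sorted_list_of_set \<rho>" and ?s = "sorted_list_of_set \<sigma>"
  have fin: "finite \<rho>" "finite \<sigma>" using Seqs_finite \<rho> \<sigma> by blast+
  have len: "length ?r = j" "length ?s = j" using \<rho> \<sigma> by (auto simp: Seqs_def)
  have rs: "?r ! a \<in> \<rho>" "?s ! a \<in> \<sigma>" if "a < j" for a
    using that len fin by (metis nth_mem set_sorted_list_of_set)+
  have ent: "(map dy ?r ! a) (map e ?s ! p a) = (if ?r ! a = ?s ! p a then 1 else 0)"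
    if "p permutes {..<j}" "a < j" for p a
  proof -
    have pa: "p a < j" using that by (meson lessThan_iff permutes_in_image)
    have "?r ! a \<in> {1..CARD('n)}" "?s ! p a \<in> {1..CARD('n)}"
      using rs(1)[OF that(2)] rs(2)[OF pa] \<rho> \<sigma> unfolding Seqs_def by blast+
    then show ?thesis using dual that(2) pa len by (simp add: covectors_def)
  qed
  have "wedge_at dy \<rho> (map e ?s)
    = (\<Sum>p | p permutes {..<j}. of_int (sign p) * (\<Prod>a<j. (map dy ?r ! a) (map e ?s ! p a)))"
    unfolding wedge_at_def wedge_def using len by simp
  also have "\<dots> = (\<Sum>p | p permutes {..<j}. if p = id then (if \<rho> = \<sigma> then 1 else 0) else 0)"
  proof (rule sum.cong[OF refl])
    fix p assume "p \<in> {p. p permutes {..<j}}"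
    then have p: "p permutes {..<j}" by simp
    have z: "(\<Prod>a<j. (map dy ?r ! a) (map e ?s ! p a)) = 0" if "a < j" "?r ! a \<noteq> ?s ! p a" for a
      using that ent[OF p] by (intro prod_zero) auto
    show "of_int (sign p) * (\<Prod>a<j. (map dy ?r ! a) (map e ?s ! p a))
      = (if p = id then if \<rho> = \<sigma> then 1 else 0 else 0)"
    proof (cases "\<rho> = \<sigma>")
      case True
      show ?thesis
      proof (cases "p = id")
        case False
        then obtain a where a: "p a \<noteq> a" by (auto simp: fun_eq_iff)
        then have "a < j" using p by (metis lessThan_iff permutes_not_in)
        moreover from this have "p a < j" using p by (meson lessThan_iff permutes_in_image)
        ultimately have "?r ! a \<noteq> ?s ! p a"
          using True a len by (metis distinct_sorted_list_of_set nth_eq_iff_index_eq)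
        from z[OF \<open>a < j\<close> this] show ?thesis using False by (simp only: mult_zero_right if_False)
      qed (use True ent[OF p] in simp)
    next
      case False
      have "\<not> \<rho> \<subseteq> \<sigma>" using False fin \<rho> \<sigma> card_subset_eq[of \<sigma> \<rho>] by (auto simp: Seqs_def)
      then obtain x where "x \<in> \<rho>" "x \<notin> \<sigma>" by blast
      then obtain a where a: "a < j" "?r ! a = x"
        using fin len by (metis in_set_conv_nth set_sorted_list_of_set)
      then have "?r ! a \<noteq> ?s ! p a"
        using rs(2)[of "p a"] \<open>x \<notin> \<sigma>\<close> p by (metis lessThan_iff permutes_in_image)
      from z[OF a(1) this] show ?thesis using False by (simp only: mult_zero_right if_False if_cancel)
    qed
  qed
  also have "\<dots> = (if \<rho> = \<sigma> then 1 else 0)"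
    using permutes_id[of "{..<j}"] by (simp add: finite_permutations)
  finally show ?thesis .
qed

text \<open>An explicit linear functional on all double forms, unlike \<open>coeff_of\<close>, which
  goes through \<open>representation\<close>. The sign in front cancels that of
  \<open>star\<close>.\<close>

definition cf :: "'n dform \<Rightarrow> nat set \<Rightarrow> nat \<Rightarrow> real" where
  "cf \<omega> \<sigma> i = (- 1) ^ (i - 1) *
     \<omega> (map e (sorted_list_of_set \<sigma>)) (map e (sorted_list_of_set ({1..CARD('n)} - {i})))"

lemma linear_cf: "linear (\<lambda>\<omega>. cf \<omega> \<sigma> i)"
  by (rule linearI) (simp_all add: cf_def algebra_simps)

lemma cf_simps [simp]:
  "cf (\<omega> + \<eta>) \<sigma> i = cf \<omega> \<sigma> i + cf \<eta> \<sigma> i" "cf (\<omega> - \<eta>) \<sigma> i = cf \<omega> \<sigma> i - cf \<eta> \<sigma> i"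
  "cf (c *\<^sub>R \<omega>) \<sigma> i = c * cf \<omega> \<sigma> i" "cf 0 \<sigma> i = 0"
  "cf (sum f A) \<sigma> i = (\<Sum>x\<in>A. cf (f x) \<sigma> i)"
  by (simp_all add: cf_def algebra_simps sum_distrib_left)

lemma cf_basis_el:
  assumes "\<rho> \<in> Seqs k CARD('n)" "\<sigma> \<in> Seqs k CARD('n)" "i \<in> {1..CARD('n)}" "j \<in> {1..CARD('n)}"
  shows "cf (basis_el dy \<rho> j) \<sigma> i = (if \<rho> = \<sigma> \<and> j = i then 1 else 0)"
proof -
  have "({1..CARD('n)} - {j} = {1..CARD('n)} - {i}) = (j = i)"
    using assms(4) by (metis DiffD2 DiffI singletonD singletonI)
  then show ?thesis
    using wedge_at_dual[OF assms(1,2)] wedge_at_dual[OF Seqs_remove[OF assms(4)] Seqs_remove[OF assms(3)]]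
    by (simp add: cf_def basis_el_def tensor_def star_def)
qed

text \<open>\<open>Alt_eq_0\<close> is used once per slot. In the second slot the increasing lists
  of length \<open>n - 1\<close> are the complements of single indices, which is what
  \<open>cf\<close> evaluates on.\<close>

lemma Alt2_eq_0:
  assumes \<omega>: "\<omega> \<in> Alt2 k (CARD('n) - 1)"
    and z: "\<And>\<sigma> i. \<sigma> \<in> Seqs k CARD('n) \<Longrightarrow> i \<in> {1..CARD('n)} \<Longrightarrow> cf \<omega> \<sigma> i = 0"
  shows "\<omega> = 0"
proof
  fix w
  have "\<omega> w = 0"
  proof (rule Alt_eq_0[OF Alt2_snd[OF \<omega>] span_e])
    fix \<rho> assume "\<rho> \<in> Seqs (CARD('n) - 1) CARD('n)"
    then obtain i where i: "i \<in> {1..CARD('n)}" "\<rho> = {1..CARD('n)} - {i}"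
      using Seqs_coatom by (metis One_nat_def Suc_leI zero_less_card_finite)
    have "(\<lambda>w. \<omega> w (map e (sorted_list_of_set \<rho>))) = 0"
    proof (rule Alt_eq_0[OF Alt2_fst[OF \<omega>] span_e])
      show "\<omega> (map e (sorted_list_of_set \<sigma>)) (map e (sorted_list_of_set \<rho>)) = 0"
        if "\<sigma> \<in> Seqs k CARD('n)" for \<sigma>
        using z[OF that i(1)] by (simp add: cf_def i(2))
    qed
    then show "\<omega> w (map e (sorted_list_of_set \<rho>)) = 0" by (simp add: fun_eq_iff)
  qed
  then show "\<omega> w = 0 w" by simp
qed

lemma Alt2_expand:
  assumes \<omega>: "\<omega> \<in> Alt2 k (CARD('n) - 1)"
  shows "\<omega> = (\<Sum>(\<sigma>, i)\<in>Seqs k CARD('n) \<times> {1..CARD('n)}. cf \<omega> \<sigma> i *\<^sub>R basis_el dy \<sigma> i)"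
    (is "\<omega> = ?s")
proof -
  have "\<omega> - ?s = 0"
  proof (rule Alt2_eq_0)
    show "\<omega> - ?s \<in> Alt2 k (CARD('n) - 1)"
      by (intro subspace_diff subspace_Alt2 \<omega> subspace_sum)
        (auto intro!: subspace_scale[OF subspace_Alt2] basis_el_in_Alt2)
    fix \<rho> j assume r: "\<rho> \<in> Seqs k CARD('n)" and j: "j \<in> {1..CARD('n)}"
    have "cf ?s \<rho> j = (\<Sum>p\<in>Seqs k CARD('n) \<times> {1..CARD('n)}.
      if p = (\<rho>, j) then cf \<omega> \<rho> j else 0)"
      unfolding cf_simps by (rule sum.cong) (use r j in \<open>auto simp: cf_basis_el split: if_splits\<close>)
    also have "\<dots> = cf \<omega> \<rho> j" using r j by (simp add: sum.delta)
    finally show "cf (\<omega> - ?s) \<rho> j = 0" by simp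
  qed
  then show ?thesis by simp
qed

lemma
  shows inj_basis_el: "inj_on (\<lambda>(\<sigma>, i). basis_el dy \<sigma> i) (Seqs k CARD('n) \<times> {1..CARD('n)})"
    and independent_basis_el:
      "independent {basis_el dy \<rho> j | \<rho> j. \<rho> \<in> Seqs k CARD('n) \<and> j \<in> {1..CARD('n)}}"
proof -
  let ?I = "Seqs k CARD('n) \<times> {1..CARD('n)}"
  have e: "{basis_el dy \<rho> j | \<rho> j. \<rho> \<in> Seqs k CARD('n) \<and> j \<in> {1..CARD('n)}}
    = (\<lambda>(\<sigma>, i). basis_el dy \<sigma> i) ` ?I" by force
  have d: "(case p of (\<sigma>, i) \<Rightarrow> \<lambda>\<omega>. cf \<omega> \<sigma> i) (case q of (\<sigma>, i) \<Rightarrow> basis_el dy \<sigma> i)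
    = (if p = q then 1 else 0)" if "p \<in> ?I" "q \<in> ?I" for p q
    using that by (auto simp: cf_basis_el split: if_splits)
  have l: "linear (case p of (\<sigma>, i) \<Rightarrow> \<lambda>\<omega>. cf \<omega> \<sigma> i)" for p
    by (cases p) (simp add: linear_cf)
  from dual_family_independent[of ?I "\<lambda>(\<sigma>, i) \<omega>. cf \<omega> \<sigma> i" "\<lambda>(\<sigma>, i). basis_el dy \<sigma> i", OF _ l d]
  show "inj_on (\<lambda>(\<sigma>, i). basis_el dy \<sigma> i) ?I"
    "independent {basis_el dy \<rho> j | \<rho> j. \<rho> \<in> Seqs k CARD('n) \<and> j \<in> {1..CARD('n)}}"
    unfolding e by simp_all
qed

text \<open>Applying the functional \<open>cf\<close> to the expansion given by
  \<open>representation\<close> isolates one coefficient. From here on the definitions of projection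
  and trace can be handled by evaluation.\<close>

lemma coeff_of_eq_cf:
  assumes \<omega>: "\<omega> \<in> Alt2 k (CARD('n) - 1)"
    and \<sigma>: "\<sigma> \<in> Seqs k CARD('n)" and i: "i \<in> {1..CARD('n)}"
  shows "coeff_of k dy \<omega> \<sigma> i = cf \<omega> \<sigma> i"
proof -
  let ?I = "Seqs k CARD('n) \<times> {1..CARD('n)}"
  let ?B = "{basis_el dy \<rho> j | \<rho> j. \<rho> \<in> Seqs k CARD('n) \<and> j \<in> {1..CARD('n)}}"
  have e: "?B = (\<lambda>(\<sigma>, i). basis_el dy \<sigma> i) ` ?I" by force
  have "\<omega> \<in> span ?B"
    unfolding e by (subst Alt2_expand[OF \<omega>]) (auto intro!: span_sum span_scale intro: span_base)
  then have "\<omega> = (\<Sum>v\<in>?B. representation ?B \<omega> v *\<^sub>R v)"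
    using sum_representation_eq[OF independent_basis_el, of \<omega> k ?B] e by simp
  also have "\<dots> = (\<Sum>p\<in>?I. representation ?B \<omega> (case p of (\<sigma>, i) \<Rightarrow> basis_el dy \<sigma> i)
      *\<^sub>R (case p of (\<sigma>, i) \<Rightarrow> basis_el dy \<sigma> i))"
    by (subst (2) e) (simp add: sum.reindex[OF inj_basis_el])
  finally have "cf \<omega> \<sigma> i = cf (\<Sum>p\<in>?I. representation ?B \<omega> (case p of (\<sigma>, i) \<Rightarrow> basis_el dy \<sigma> i)
      *\<^sub>R (case p of (\<sigma>, i) \<Rightarrow> basis_el dy \<sigma> i)) \<sigma> i" by simp
  also have "\<dots> = (\<Sum>p\<in>?I. if p = (\<sigma>, i) then representation ?B \<omega> (basis_el dy \<sigma> i) else 0)"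
    unfolding cf_simps by (rule sum.cong) (use \<sigma> i in \<open>auto simp: cf_basis_el split: if_splits\<close>)
  also have "\<dots> = representation ?B \<omega> (basis_el dy \<sigma> i)" using \<sigma> i by (simp add: sum.delta)
  finally show ?thesis by (simp add: coeff_of_def)
qed

text \<open>For fixed \<open>w\<close> the value is an \<open>n\<close>-form and hence determined on
  the full list of basis vectors; as a function of \<open>w\<close> it is alternating again, so
  sorted lists \<tau> suffice. Summands with i in \<tau> vanish by repetition, and in the others
  \<open>e i\<close> is sorted into \<tau>, which yields the sign.\<close>

lemma s_map_eq_0_iff:
  assumes \<omega>: "\<omega> \<in> Alt2 k (CARD('n) - 1)" and k: "k \<ge> 1"
  shows "s_map \<omega> = 0 \<longleftrightarrow>
    (\<forall>\<tau>\<in>Seqs (k - 1) CARD('n). (\<Sum>i\<in>{1..CARD('n)} - \<tau>. eps i \<tau> * cf \<omega> (insert i \<tau>) i) = 0)"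
proof -
  let ?N = "CARD('n)"
  let ?e = "map e (sorted_list_of_set {1..?N})"
  have N: "Suc (?N - 1) = ?N" by simp
  have Sk: "Suc (k - 1) = k" using k by simp
  have fst: "(\<lambda>w. \<omega> (u # w) v) \<in> Alt (k - 1)" for u v
    using Alt_Cons[of "\<lambda>w. \<omega> w v" "k - 1" u] Alt2_fst[OF \<omega>, of v] Sk by simp
  have lin: "linear (\<lambda>u. \<omega> (u # w) v)" for w v
    using Alt_linear[OF Alt2_fst[OF \<omega>], of "[]" w v] by simp
  have ins: "insertion_sum (\<lambda>u. \<omega> (u # w)) \<in> Alt ?N" for w
    using insertion_sum_in_Alt[of "\<lambda>u. \<omega> (u # w)" "?N - 1", OF lin Alt2_snd[OF \<omega>]] by simp
  have s: "s_map \<omega> w = insertion_sum (\<lambda>u. \<omega> (u # w))" for w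
    using Alt_length[OF ins] by (auto simp: s_map_def insertion_sum_def fun_eq_iff)
  have sA: "(\<lambda>w. s_map \<omega> w ?e) \<in> Alt (k - 1)"
  proof -
    have "(\<lambda>w. s_map \<omega> w ?e) = (\<Sum>i=1..?N. (- 1) ^ (i - 1) *\<^sub>R
      (\<lambda>w. \<omega> (e i # w) (map e (sorted_list_of_set ({1..?N} - {i})))))"
      unfolding s insertion_sum_basis by (simp add: fun_eq_iff)
    then show ?thesis
      using fst by (simp add: subspace_sum[OF subspace_Alt] subspace_scale[OF subspace_Alt])
  qed
  have val: "s_map \<omega> (map e (sorted_list_of_set \<tau>)) ?e
    = (\<Sum>i\<in>{1..?N} - \<tau>. eps i \<tau> * cf \<omega> (insert i \<tau>) i)" if \<tau>: "\<tau> \<in> Seqs (k - 1) ?N" for \<tau>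
  proof -
    have fin: "finite \<tau>" using Seqs_finite[OF \<tau>] .
    have card: "card \<tau> = k - 1" using \<tau> by (simp add: Seqs_def)
    have "\<omega> (e i # map e (sorted_list_of_set \<tau>)) v = 0" if "i \<in> \<tau>" for i v
      by (rule Alt_not_distinct[OF Alt2_fst[OF \<omega>]]) (use that fin in auto)
    then have "s_map \<omega> (map e (sorted_list_of_set \<tau>)) ?e
      = (\<Sum>i\<in>{1..?N} - \<tau>. (- 1) ^ (i - 1) *
        \<omega> (e i # map e (sorted_list_of_set \<tau>)) (map e (sorted_list_of_set ({1..?N} - {i}))))"
      unfolding s insertion_sum_basis by (intro sum.mono_neutral_right) auto
    also have "\<dots> = (\<Sum>i\<in>{1..?N} - \<tau>. eps i \<tau> * cf \<omega> (insert i \<tau>) i)"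
    proof (rule sum.cong[OF refl])
      fix i assume "i \<in> {1..?N} - \<tau>"
      then have "i \<notin> \<tau>" by simp
      from Alt_insert[OF Alt2_fst[OF \<omega>] fin this, of e] card Sk
      show "(- 1) ^ (i - 1) * \<omega> (e i # map e (sorted_list_of_set \<tau>))
          (map e (sorted_list_of_set ({1..?N} - {i}))) = eps i \<tau> * cf \<omega> (insert i \<tau>) i"
        unfolding cf_def by simp
    qed
    finally show ?thesis .
  qed
  show ?thesis
  proof
    assume "s_map \<omega> = 0"
    then show "\<forall>\<tau>\<in>Seqs (k - 1) ?N. (\<Sum>i\<in>{1..?N} - \<tau>. eps i \<tau> * cf \<omega> (insert i \<tau>) i) = 0"
      using val by (simp flip: val)
  next
    assume z: "\<forall>\<tau>\<in>Seqs (k - 1) ?N. (\<Sum>i\<in>{1..?N} - \<tau>. eps i \<tau> * cf \<omega> (insert i \<tau>) i) = 0"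
    have z': "(\<lambda>w. s_map \<omega> w ?e) = 0"
      by (rule Alt_eq_0[OF sA span_e]) (use z val in simp)
    show "s_map \<omega> = 0"
    proof
      fix w
      have "s_map \<omega> w = 0"
      proof (rule Alt_eq_0[OF _ span_e])
        show "s_map \<omega> w \<in> Alt ?N" using ins by (simp add: s)
        show "s_map \<omega> w (map e (sorted_list_of_set \<sigma>)) = 0" if "\<sigma> \<in> Seqs ?N ?N" for \<sigma>
          using z' that by (simp add: Seqs_full fun_eq_iff)
      qed
      then show "s_map \<omega> w = 0 w" by simp
    qed
  qed
qed

end

section \<open>The constrained space and its oblique basis\<close>

text \<open>The index \<open>i_1\<close> of the constraint sequence of \<tau>, obtained without its
  list.\<close>

definition first_index :: "nat \<Rightarrow> nat set \<Rightarrow> nat" where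
  "first_index n \<tau> = Min ({1..n} - \<tau>)"

lemma first_index:
  assumes "\<tau> \<in> Seqs j n" "j < n"
  shows "first_index n \<tau> \<in> {1..n} - \<tau>"
    and "i \<in> {1..n} - \<tau> \<Longrightarrow> first_index n \<tau> \<le> i"
    and "pair_index n \<tau> = (insert (first_index n \<tau>) \<tau>, first_index n \<tau>)"
proof -
  have ne: "{1..n} - \<tau> \<noteq> {}"
  proof
    assume "{1..n} - \<tau> = {}"
    then have "{1..n} \<subseteq> \<tau>" by blast
    from card_mono[OF Seqs_finite[OF assms(1)] this] assms show False by (simp add: Seqs_def)
  qed
  then show "first_index n \<tau> \<in> {1..n} - \<tau>"
    unfolding first_index_def by (intro Min_in) auto
  show "i \<in> {1..n} - \<tau> \<Longrightarrow> first_index n \<tau> \<le> i"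
    unfolding first_index_def by (intro Min_le) auto
  show "pair_index n \<tau> = (insert (first_index n \<tau>) \<tau>, first_index n \<tau>)"
    using ne by (simp add: pair_index_def constraint_seq_def sorted_list_of_set_nonempty first_index_def)
qed

lemma Seqs_delete:
  "\<sigma> \<in> Seqs k n \<Longrightarrow> i \<in> \<sigma> \<Longrightarrow> \<sigma> - {i} \<in> Seqs (k - 1) n"
  unfolding Seqs_def by (auto simp: card_Diff_singleton)

lemma Seqs_insert:
  "\<tau> \<in> Seqs (k - 1) n \<Longrightarrow> 1 \<le> k \<Longrightarrow> i \<in> {1..n} - \<tau> \<Longrightarrow> insert i \<tau> \<in> Seqs k n"
  using Seqs_finite[of \<tau> "k - 1" n] unfolding Seqs_def by simp

text \<open>A pair index (\<sigma>, i) can only come from \<tau> = \<sigma> - {i}, so the quantifier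
  over all constraint sequences collapses to a test on this single one.\<close>

lemma free_index_iff:
  assumes "1 \<le> k" "k \<le> n"
  shows "free_index n k \<sigma> i \<longleftrightarrow>
    \<sigma> \<in> Seqs k n \<and> i \<in> {1..n} \<and> \<not> (i \<in> \<sigma> \<and> first_index n (\<sigma> - {i}) = i)"
proof -
  have lt: "k - 1 < n" using assms by simp
  have "(\<exists>\<tau>\<in>Seqs (k - 1) n. (\<sigma>, i) = pair_index n \<tau>) \<longleftrightarrow> i \<in> \<sigma> \<and> first_index n (\<sigma> - {i}) = i"
    if \<sigma>: "\<sigma> \<in> Seqs k n"
  proof
    assume "\<exists>\<tau>\<in>Seqs (k - 1) n. (\<sigma>, i) = pair_index n \<tau>"
    then obtain \<tau> where \<tau>: "\<tau> \<in> Seqs (k - 1) n" "\<sigma> = insert i \<tau>" "i = first_index n \<tau>"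
      using first_index(3)[OF _ lt] by auto
    moreover have "i \<notin> \<tau>" using first_index(1)[OF \<tau>(1) lt] \<tau>(3) by simp
    ultimately show "i \<in> \<sigma> \<and> first_index n (\<sigma> - {i}) = i" by simp
  next
    assume i: "i \<in> \<sigma> \<and> first_index n (\<sigma> - {i}) = i"
    then have "\<sigma> - {i} \<in> Seqs (k - 1) n" using Seqs_delete \<sigma> by blast
    moreover from first_index(3)[OF this lt] i have "(\<sigma>, i) = pair_index n (\<sigma> - {i})"
      by (simp add: insert_absorb)
    ultimately show "\<exists>\<tau>\<in>Seqs (k - 1) n. (\<sigma>, i) = pair_index n \<tau>" by blast
  qed
  then show ?thesis unfolding free_index_def by blast
qed

lemma subspace_XX: "subspace (XX k :: 'a::finite dform set)"
proof -
  have "s_map (\<omega> + \<eta>) = s_map \<omega> + s_map \<eta>" "s_map (c *\<^sub>R \<omega>) = c *\<^sub>R s_map \<omega>" "s_map 0 = 0"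
    for \<omega> \<eta> :: "'a dform" and c
    by (auto simp: s_map_def fun_eq_iff sum.distrib distrib_left sum_distrib_left mult.left_commute)
  then show ?thesis
    unfolding XX_def using subspace_Alt2[of k "CARD('a) - 1"] by (auto simp: subspace_def)
qed

definition free_indices :: "nat \<Rightarrow> nat \<Rightarrow> nat set \<Rightarrow> (nat set \<times> nat) set" where
  "free_indices n k S = {(\<sigma>, i). free_index n k \<sigma> i \<and> i \<in> S}"

lemma free_indices_subset: "free_indices n k S \<subseteq> Seqs k n \<times> {1..n}"
  unfolding free_indices_def free_index_def by auto

lemma finite_free_indices: "finite (free_indices n k S)"
  by (rule finite_subset[OF free_indices_subset]) simp

text \<open>Count what is missing. The pair indices with i \<le> l correspond to the sets \<tau>
  whose first free position is at most l, that is, to those not containing {1..l}. The sets that do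
  contain it have as complements the (n-k+1)-subsets of {l+1..n}, whence the second binomial
  coefficient.\<close>

lemma card_free_indices:
  assumes k: "1 \<le> k" "k \<le> n" and l: "l \<le> n"
  shows "int (card (free_indices n k {1..l}))
    = int l * int (n choose k) + int ((n - l) choose (n - k + 1)) - int (n choose (k - 1))"
proof -
  have lt: "k - 1 < n" using k by simp
  let ?P = "{\<tau> \<in> Seqs (k - 1) n. first_index n \<tau> \<le> l}"
  let ?Q = "{\<tau> \<in> Seqs (k - 1) n. {1..l} \<subseteq> \<tau>}"
  let ?h = "\<lambda>\<tau>. (insert (first_index n \<tau>) \<tau>, first_index n \<tau>)"
  have fi: "first_index n \<tau> \<in> {1..n} - \<tau>" if "\<tau> \<in> Seqs (k - 1) n" for \<tau>
    using first_index(1)[OF that lt] .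
  have compl: "Seqs k n \<times> {1..l} - free_indices n k {1..l} = ?h ` ?P"
  proof (intro equalityI subsetI)
    fix p assume "p \<in> Seqs k n \<times> {1..l} - free_indices n k {1..l}"
    then obtain \<sigma> i where p: "p = (\<sigma>, i)" "\<sigma> \<in> Seqs k n" "i \<in> {1..l}" "\<not> free_index n k \<sigma> i"
      unfolding free_indices_def by blast
    then have i: "i \<in> \<sigma>" "first_index n (\<sigma> - {i}) = i"
      using l unfolding free_index_iff[OF k] by auto
    then have "p = ?h (\<sigma> - {i})" "\<sigma> - {i} \<in> ?P"
      using p Seqs_delete[OF p(2) i(1)] by (auto simp: insert_absorb)
    then show "p \<in> ?h ` ?P" by blast
  next
    fix p assume "p \<in> ?h ` ?P"
    then obtain \<tau> where \<tau>: "\<tau> \<in> Seqs (k - 1) n" "first_index n \<tau> \<le> l" "p = ?h \<tau>" by blast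
    then show "p \<in> Seqs k n \<times> {1..l} - free_indices n k {1..l}"
      using fi[OF \<tau>(1)] Seqs_insert[OF \<tau>(1) k(1) fi[OF \<tau>(1)]]
      by (auto simp: free_indices_def free_index_iff[OF k])
  qed
  have inj: "inj_on ?h ?P"
  proof (rule inj_onI)
    fix \<tau> \<rho> assume a: "\<tau> \<in> ?P" "\<rho> \<in> ?P" "?h \<tau> = ?h \<rho>"
    then have "first_index n \<tau> \<notin> \<tau>" "first_index n \<tau> \<notin> \<rho>" using fi[of \<tau>] fi[of \<rho>] by auto
    then show "\<tau> = \<rho>" using a(3) by (metis Pair_inject insert_ident)
  qed
  have PQ: "?P = Seqs (k - 1) n - ?Q"
  proof -
    have "first_index n \<tau> \<le> l \<longleftrightarrow> \<not> {1..l} \<subseteq> \<tau>" if \<tau>: "\<tau> \<in> Seqs (k - 1) n" for \<tau>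
    proof
      assume "first_index n \<tau> \<le> l"
      then show "\<not> {1..l} \<subseteq> \<tau>" using fi[OF \<tau>] by auto
    next
      assume "\<not> {1..l} \<subseteq> \<tau>"
      then obtain i where "i \<in> {1..l}" "i \<notin> \<tau>" by blast
      then show "first_index n \<tau> \<le> l" using first_index(2)[OF \<tau> lt, of i] l by auto
    qed
    then show ?thesis by blast
  qed
  \<comment> \<open>Complementation turns a superset of {1..l} into a subset of {l+1..n}.\<close>
  have "bij_betw (\<lambda>\<tau>. {1..n} - \<tau>) ?Q {\<rho>. \<rho> \<subseteq> {l + 1..n} \<and> card \<rho> = n - k + 1}"
  proof (rule bij_betw_byWitness[where f' = "\<lambda>\<tau>. {1..n} - \<tau>"])
    show "\<forall>\<tau>\<in>?Q. {1..n} - ({1..n} - \<tau>) = \<tau>" by (auto simp: Seqs_def)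
    show "\<forall>\<rho>\<in>{\<rho>. \<rho> \<subseteq> {l + 1..n} \<and> card \<rho> = n - k + 1}. {1..n} - ({1..n} - \<rho>) = \<rho>"
      by auto
    show "(\<lambda>\<tau>. {1..n} - \<tau>) ` ?Q \<subseteq> {\<rho>. \<rho> \<subseteq> {l + 1..n} \<and> card \<rho> = n - k + 1}"
    proof clarify
      fix \<tau> assume \<tau>: "\<tau> \<in> Seqs (k - 1) n" "{1..l} \<subseteq> \<tau>"
      have "card ({1..n} - \<tau>) = n - k + 1"
        using \<tau> k Seqs_finite[OF \<tau>(1)] by (subst card_Diff_subset) (auto simp: Seqs_def)
      moreover have "{1..n} - \<tau> \<subseteq> {l + 1..n}"
      proof
        fix x assume x: "x \<in> {1..n} - \<tau>"
        then have "x \<notin> {1..l}" using \<tau>(2) by blast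
        then show "x \<in> {l + 1..n}" using x by auto
      qed
      ultimately show "{1..n} - \<tau> \<subseteq> {l + 1..n} \<and> card ({1..n} - \<tau>) = n - k + 1" by blast
    qed
    show "(\<lambda>\<tau>. {1..n} - \<tau>) ` {\<rho>. \<rho> \<subseteq> {l + 1..n} \<and> card \<rho> = n - k + 1} \<subseteq> ?Q"
    proof clarify
      fix \<rho> assume \<rho>: "\<rho> \<subseteq> {l + 1..n}" "card \<rho> = n - k + 1"
      then have "\<rho> \<subseteq> {1..n}" by auto
      then have "card ({1..n} - \<rho>) = k - 1"
        using \<rho> k finite_subset[of \<rho>] by (subst card_Diff_subset) auto
      moreover have "{1..l} \<subseteq> {1..n} - \<rho>" using \<rho> l by fastforce
      ultimately show "{1..n} - \<rho> \<in> Seqs (k - 1) n \<and> {1..l} \<subseteq> {1..n} - \<rho>"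
        by (auto simp: Seqs_def)
    qed
  qed
  then have cQ: "card ?Q = (n - l) choose (n - k + 1)"
    using bij_betw_same_card n_subsets[of "{l + 1..n}" "n - k + 1"] by fastforce
  have "card ?P = (n choose (k - 1)) - ((n - l) choose (n - k + 1))"
    unfolding PQ using card_Diff_subset[of ?Q "Seqs (k - 1) n"] by (simp add: cQ card_Seqs)
  moreover have "card ?Q \<le> card (Seqs (k - 1) n)" by (rule card_mono) auto
  ultimately have P: "int (card ?P) = int (n choose (k - 1)) - int ((n - l) choose (n - k + 1))"
    unfolding cQ card_Seqs by simp
  have sub: "free_indices n k {1..l} \<subseteq> Seqs k n \<times> {1..l}"
    by (auto simp: free_indices_def free_index_def)
  have "card (?h ` ?P) = card (Seqs k n \<times> {1..l}) - card (free_indices n k {1..l})"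
    unfolding compl[symmetric] by (rule card_Diff_subset[OF finite_free_indices sub])
  moreover have "card (free_indices n k {1..l}) \<le> card (Seqs k n \<times> {1..l})"
    by (rule card_mono[OF _ sub]) simp
  ultimately have "int (card ?P) = int l * int (n choose k) - int (card (free_indices n k {1..l}))"
    using card_image[OF inj] by (simp add: card_Seqs card_cartesian_product)
  with P show ?thesis by simp
qed

section \<open>The oblique basis and its tangential and normal spans\<close>

context dual_bases
begin

context
  fixes k :: nat
  assumes k: "1 \<le> k" "k \<le> CARD('n)"
begin

lemma k_less: "k - 1 < CARD('n)"
  using k by simp

text \<open>In the second case freeness excludes that \<open>i\<close> is itself the first index, so
  the correction sits at a strictly smaller \<open>j\<close>. This strict inequality carries the
  whole splitting.\<close>

lemma proj_val_cases:
  assumes f: "free_index CARD('n) k \<sigma> i"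
  obtains "i \<notin> \<sigma>" "proj_val dy \<sigma> i = basis_el dy \<sigma> i"
  | \<tau> j where "i \<in> \<sigma>" "\<tau> = \<sigma> - {i}" "\<tau> \<in> Seqs (k - 1) CARD('n)" "j = first_index CARD('n) \<tau>"
    "j < i" "j \<in> {1..CARD('n)} - \<tau>"
    "proj_val dy \<sigma> i = basis_el dy \<sigma> i - (eps i \<tau> * eps j \<tau>) *\<^sub>R basis_el dy (insert j \<tau>) j"
proof (cases "i \<in> \<sigma>")
  case False
  then show ?thesis using that(1) by (simp add: proj_val_def)
next
  case True
  have \<sigma>: "\<sigma> \<in> Seqs k CARD('n)" "i \<in> {1..CARD('n)}" "first_index CARD('n) (\<sigma> - {i}) \<noteq> i"
    using f True unfolding free_index_iff[OF k] by auto
  from Seqs_delete[OF \<sigma>(1) True] have \<tau>: "\<sigma> - {i} \<in> Seqs (k - 1) CARD('n)" .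
  show ?thesis
  proof (rule that(2)[of "\<sigma> - {i}" "first_index CARD('n) (\<sigma> - {i})"])
    show "first_index CARD('n) (\<sigma> - {i}) < i"
      using first_index(2)[OF \<tau> k_less, of i] \<sigma> by simp
    show "proj_val dy \<sigma> i = basis_el dy \<sigma> i - (eps i (\<sigma> - {i}) *
      eps (first_index CARD('n) (\<sigma> - {i})) (\<sigma> - {i})) *\<^sub>R
      basis_el dy (insert (first_index CARD('n) (\<sigma> - {i})) (\<sigma> - {i})) (first_index CARD('n) (\<sigma> - {i}))"
      using True first_index(3)[OF \<tau> k_less] by (simp add: proj_val_def Let_def)
  qed (use True \<tau> first_index(1)[OF \<tau> k_less] in auto)
qed

lemma XX_iff: "\<omega> \<in> XX k \<longleftrightarrow> \<omega> \<in> Alt2 k (CARD('n) - 1) \<and>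
  (\<forall>\<tau>\<in>Seqs (k - 1) CARD('n). (\<Sum>i\<in>{1..CARD('n)} - \<tau>. eps i \<tau> * cf \<omega> (insert i \<tau>) i) = 0)"
  using s_map_eq_0_iff[OF _ k(1)] by (auto simp: XX_def)

text \<open>If i is not in \<sigma>, no constraint equation involves the coefficient at (\<sigma>,
  i). Otherwise only the equation of \<tau> sees the two terms, and the sign product is chosen so
  that they cancel, because the square of a sign is 1.\<close>

lemma proj_val_in_XX:
  assumes f: "free_index CARD('n) k \<sigma> i"
  shows "proj_val dy \<sigma> i \<in> XX k"
proof -
  have \<sigma>: "\<sigma> \<in> Seqs k CARD('n)" "i \<in> {1..CARD('n)}" using f unfolding free_index_def by auto
  show ?thesis
  proof (cases rule: proj_val_cases[OF f])
    case 1
    have "cf (basis_el dy \<sigma> i) (insert j \<rho>) j = 0"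
      if "\<rho> \<in> Seqs (k - 1) CARD('n)" "j \<in> {1..CARD('n)} - \<rho>" for \<rho> j
      using 1 cf_basis_el[OF \<sigma>(1) Seqs_insert[OF that(1) k(1) that(2)] _ \<sigma>(2), of j] that(2) by auto
    then show ?thesis
      unfolding XX_iff 1(2) using basis_el_in_Alt2[OF \<sigma>] by simp
  next
    case (2 \<tau> j)
    have j: "j \<in> {1..CARD('n)}" "insert j \<tau> \<in> Seqs k CARD('n)"
      using 2 Seqs_insert[OF 2(3) k(1)] by auto
    have fin: "finite \<tau>" "i \<notin> \<tau>" "j \<notin> \<tau>" using 2 Seqs_finite[OF 2(3)] by auto
    have A: "proj_val dy \<sigma> i \<in> Alt2 k (CARD('n) - 1)"
      unfolding 2(7)
      by (intro subspace_diff[OF subspace_Alt2] subspace_scale[OF subspace_Alt2]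
        basis_el_in_Alt2 \<sigma> j)
    have "(\<Sum>m\<in>{1..CARD('n)} - \<rho>. eps m \<rho> * cf (proj_val dy \<sigma> i) (insert m \<rho>) m) = 0"
      if \<rho>: "\<rho> \<in> Seqs (k - 1) CARD('n)" for \<rho>
    proof -
      have c: "cf (proj_val dy \<sigma> i) (insert m \<rho>) m
        = (if \<rho> = \<tau> \<and> m = i then 1 else 0) - (eps i \<tau> * eps j \<tau>) * (if \<rho> = \<tau> \<and> m = j then 1 else 0)"
        if m: "m \<in> {1..CARD('n)} - \<rho>" for m
      proof -
        have ins: "insert m \<rho> \<in> Seqs k CARD('n)" "m \<in> {1..CARD('n)}"
          using Seqs_insert[OF \<rho> k(1) m] m by auto
        have "(\<sigma> = insert m \<rho> \<and> i = m) = (\<rho> = \<tau> \<and> m = i)"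
          using m 2(1,2) by auto
        moreover have "(insert j \<tau> = insert m \<rho> \<and> j = m) = (\<rho> = \<tau> \<and> m = j)"
          using m fin(3) by (metis DiffD2 insert_ident)
        ultimately show ?thesis
          unfolding 2(7) using cf_basis_el[OF \<sigma>(1) ins(1,2) \<sigma>(2)] cf_basis_el[OF j(2) ins j(1)]
          by simp
      qed
      show ?thesis
      proof (cases "\<rho> = \<tau>")
        case False
        then show ?thesis using c by simp
      next
        case True
        have ij: "i \<in> {1..CARD('n)} - \<tau>" "j \<in> {1..CARD('n)} - \<tau>" "i \<noteq> j"
          using \<sigma> fin 2 by auto
        have "(\<Sum>m\<in>{1..CARD('n)} - \<rho>. eps m \<rho> * cf (proj_val dy \<sigma> i) (insert m \<rho>) m)
          = (\<Sum>m\<in>{i, j}. eps m \<rho> * cf (proj_val dy \<sigma> i) (insert m \<rho>) m)"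
          using ij True c by (intro sum.mono_neutral_right) auto
        also have "\<dots> = eps i \<tau> - eps j \<tau> * (eps i \<tau> * eps j \<tau>)"
          using ij c True by simp
        also have "\<dots> = eps i \<tau> - eps i \<tau> * (eps j \<tau> * eps j \<tau>)" by (simp only: ac_simps)
        also have "\<dots> = 0" using eps_square[OF fin(1,3)] by simp
        finally show ?thesis .
      qed
    qed
    then show ?thesis unfolding XX_iff using A by blast
  qed
qed

text \<open>The correction term sits at a pair index, hence at no free index: on free indices the
  oblique elements look like the plain basis elements.\<close>

lemma cf_proj_val:
  assumes f: "free_index CARD('n) k \<sigma> i" and g: "free_index CARD('n) k \<rho> j"
  shows "cf (proj_val dy \<sigma> i) \<rho> j = (if \<sigma> = \<rho> \<and> i = j then 1 else 0)"
proof -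
  have \<sigma>: "\<sigma> \<in> Seqs k CARD('n)" "i \<in> {1..CARD('n)}" and \<rho>: "\<rho> \<in> Seqs k CARD('n)" "j \<in> {1..CARD('n)}"
    using f g unfolding free_index_def by auto
  show ?thesis
  proof (cases rule: proj_val_cases[OF f])
    case 1
    then show ?thesis using cf_basis_el \<sigma> \<rho> by simp
  next
    case (2 \<tau> m)
    have m: "m \<in> {1..CARD('n)}" "insert m \<tau> \<in> Seqs k CARD('n)" "m \<notin> \<tau>"
      using 2 Seqs_insert[OF 2(3) k(1)] by auto
    have "\<not> (insert m \<tau> = \<rho> \<and> m = j)"
    proof
      assume "insert m \<tau> = \<rho> \<and> m = j"
      then have "j \<in> \<rho>" "\<rho> - {j} = \<tau>" using m(3) by auto
      then show False using g 2(4) \<open>insert m \<tau> = \<rho> \<and> m = j\<close> unfolding free_index_iff[OF k] by blast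
    qed
    then show ?thesis
      unfolding 2(7) cf_simps cf_basis_el[OF \<sigma>(1) \<rho>(1,2) \<sigma>(2)] cf_basis_el[OF m(2) \<rho> m(1)]
      by auto
  qed
qed

text \<open>Triangularity: the correction lies below \<open>i\<close>. Unlike
  \<open>cf_proj_val\<close> this also covers coefficients at pair indices.\<close>

lemma cf_proj_val_above:
  assumes f: "free_index CARD('n) k \<sigma> i" and \<rho>: "\<rho> \<in> Seqs k CARD('n)" "j \<in> {1..CARD('n)}" and "i < j"
  shows "cf (proj_val dy \<sigma> i) \<rho> j = 0"
proof -
  have \<sigma>: "\<sigma> \<in> Seqs k CARD('n)" "i \<in> {1..CARD('n)}" using f unfolding free_index_def by auto
  show ?thesis
  proof (cases rule: proj_val_cases[OF f])
    case 1
    then show ?thesis using cf_basis_el \<sigma> \<rho> \<open>i < j\<close> by simp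
  next
    case (2 \<tau> m)
    have m: "m \<in> {1..CARD('n)}" "insert m \<tau> \<in> Seqs k CARD('n)"
      using 2 Seqs_insert[OF 2(3) k(1)] by auto
    show ?thesis
      unfolding 2(7) cf_simps cf_basis_el[OF \<sigma>(1) \<rho>(1,2) \<sigma>(2)] cf_basis_el[OF m(2) \<rho> m(1)]
      using 2 \<open>i < j\<close> by simp
  qed
qed

text \<open>Each constraint equation contains exactly one coefficient that is not free, the one at
  its pair index, with a sign as factor; if the free ones vanish, so does it.\<close>

lemma XX_eq_0:
  assumes \<omega>: "\<omega> \<in> XX k" and z: "\<And>\<sigma> i. free_index CARD('n) k \<sigma> i \<Longrightarrow> cf \<omega> \<sigma> i = 0"
  shows "\<omega> = 0"
proof (rule Alt2_eq_0)
  show "\<omega> \<in> Alt2 k (CARD('n) - 1)" using \<omega> by (simp add: XX_def)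
  fix \<sigma> i assume \<sigma>: "\<sigma> \<in> Seqs k CARD('n)" "i \<in> {1..CARD('n)}"
  show "cf \<omega> \<sigma> i = 0"
  proof (cases "free_index CARD('n) k \<sigma> i")
    case False
    then have i: "i \<in> \<sigma>" "first_index CARD('n) (\<sigma> - {i}) = i"
      using \<sigma> unfolding free_index_iff[OF k] by auto
    let ?\<tau> = "\<sigma> - {i}"
    have \<tau>: "?\<tau> \<in> Seqs (k - 1) CARD('n)" using Seqs_delete[OF \<sigma>(1) i(1)] .
    have z': "cf \<omega> (insert j ?\<tau>) j = 0" if j: "j \<in> {1..CARD('n)} - ?\<tau>" "j \<noteq> i" for j
    proof (rule z)
      have "insert j ?\<tau> - {j} = ?\<tau>" using j by auto
      then show "free_index CARD('n) k (insert j ?\<tau>) j"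
        unfolding free_index_iff[OF k] using Seqs_insert[OF \<tau> k(1) j(1)] j i(2) by auto
    qed
    have "(\<Sum>j\<in>{1..CARD('n)} - ?\<tau>. eps j ?\<tau> * cf \<omega> (insert j ?\<tau>) j)
      = (\<Sum>j\<in>{i}. eps j ?\<tau> * cf \<omega> (insert j ?\<tau>) j)"
    proof (rule sum.mono_neutral_right)
      show "\<forall>j\<in>({1..CARD('n)} - ?\<tau>) - {i}. eps j ?\<tau> * cf \<omega> (insert j ?\<tau>) j = 0"
      proof
        fix j assume "j \<in> ({1..CARD('n)} - ?\<tau>) - {i}"
        then have "cf \<omega> (insert j ?\<tau>) j = 0" by (intro z') auto
        then show "eps j ?\<tau> * cf \<omega> (insert j ?\<tau>) j = 0" by simp
      qed
    qed (use \<sigma>(2) in auto)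
    then have "eps i ?\<tau> * cf \<omega> \<sigma> i = 0"
      using \<omega> \<tau> i(1) by (simp add: XX_iff insert_absorb)
    moreover have "eps i ?\<tau> \<noteq> 0"
      using eps_square[of ?\<tau> i] Seqs_finite[OF \<tau>] by auto
    ultimately show ?thesis by simp
  qed (rule z)
qed

text \<open>The difference lies in the constrained space and has no free coefficients. The set
  \<open>S\<close> allows the same expansion for tangential and for normal indices.\<close>

lemma XX_expand:
  assumes \<omega>: "\<omega> \<in> XX k" and S: "\<And>\<sigma> i. free_index CARD('n) k \<sigma> i \<Longrightarrow> i \<notin> S \<Longrightarrow> cf \<omega> \<sigma> i = 0"
  shows "\<omega> = (\<Sum>(\<sigma>, i)\<in>free_indices CARD('n) k S. cf \<omega> \<sigma> i *\<^sub>R proj_val dy \<sigma> i)" (is "_ = ?s")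
proof -
  have "\<omega> - ?s = 0"
  proof (rule XX_eq_0)
    show "\<omega> - ?s \<in> XX k"
      by (intro subspace_diff[OF subspace_XX] \<omega> subspace_sum[OF subspace_XX])
        (auto intro!: subspace_scale[OF subspace_XX] proj_val_in_XX simp: free_indices_def)
    fix \<rho> j assume f: "free_index CARD('n) k \<rho> j"
    have "cf ?s \<rho> j = (\<Sum>p\<in>free_indices CARD('n) k S. if p = (\<rho>, j) then cf \<omega> \<rho> j else 0)"
      unfolding cf_simps
      by (rule sum.cong) (use f in \<open>auto simp: free_indices_def cf_proj_val split: if_splits\<close>)
    also have "\<dots> = cf \<omega> \<rho> j"
      using f S[OF f] finite_free_indices[of "CARD('n)" k S]
      by (auto simp: sum.delta free_indices_def)
    finally show "cf (\<omega> - ?s) \<rho> j = 0" by simp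
  qed
  then show ?thesis by simp
qed

lemma proj_X_basis_el:
  assumes "\<sigma> \<in> Seqs k CARD('n)" "i \<in> {1..CARD('n)}"
  shows "proj_X k dy (basis_el dy \<sigma> i) = proj_val dy \<sigma> i"
proof -
  have "proj_X k dy (basis_el dy \<sigma> i)
    = (\<Sum>\<rho>\<in>Seqs k CARD('n). \<Sum>j\<in>{1..CARD('n)}. if \<rho> = \<sigma> \<and> j = i then proj_val dy \<sigma> i else 0)"
    unfolding proj_X_def
  proof (intro sum.cong refl)
    fix \<rho> j assume "\<rho> \<in> Seqs k CARD('n)" "j \<in> {1..CARD('n)}"
    then show "coeff_of k dy (basis_el dy \<sigma> i) \<rho> j *\<^sub>R proj_val dy \<rho> j
      = (if \<rho> = \<sigma> \<and> j = i then proj_val dy \<sigma> i else 0)"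
      using coeff_of_eq_cf[OF basis_el_in_Alt2[OF assms]] cf_basis_el[OF assms(1) _ _ assms(2)]
      by simp
  qed
  also have "\<dots> = (\<Sum>p\<in>Seqs k CARD('n) \<times> {1..CARD('n)}. if p = (\<sigma>, i) then proj_val dy \<sigma> i else 0)"
    by (simp add: sum.cartesian_product case_prod_unfold prod_eq_iff)
  also have "\<dots> = proj_val dy \<sigma> i" using assms by (simp add: sum.delta)
  finally show ?thesis .
qed

lemma span_proj_val_iff:
  "\<omega> \<in> span ((\<lambda>(\<sigma>, i). proj_val dy \<sigma> i) ` free_indices CARD('n) k S) \<longleftrightarrow>
    \<omega> \<in> XX k \<and> (\<forall>\<sigma> i. free_index CARD('n) k \<sigma> i \<longrightarrow> i \<notin> S \<longrightarrow> cf \<omega> \<sigma> i = 0)"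
    (is "_ \<in> span ?G \<longleftrightarrow> ?r \<omega>")
proof
  have "subspace {\<omega>. ?r \<omega>}"
    using subspace_XX[of k] by (auto simp: subspace_def)
  moreover have "?G \<subseteq> {\<omega>. ?r \<omega>}"
    by (auto simp: free_indices_def proj_val_in_XX cf_proj_val)
  ultimately have "span ?G \<subseteq> {\<omega>. ?r \<omega>}" by (rule span_minimal[rotated])
  then show "\<omega> \<in> span ?G \<Longrightarrow> ?r \<omega>" by blast
next
  assume r: "?r \<omega>"
  then have e: "\<omega> = (\<Sum>(\<sigma>, i)\<in>free_indices CARD('n) k S. cf \<omega> \<sigma> i *\<^sub>R proj_val dy \<sigma> i)"
    by (intro XX_expand) auto
  have "(\<Sum>(\<sigma>, i)\<in>free_indices CARD('n) k S. cf \<omega> \<sigma> i *\<^sub>R proj_val dy \<sigma> i) \<in> span ?G"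
    by (rule span_sum) (auto intro!: span_scale intro: span_base)
  with e show "\<omega> \<in> span ?G" by simp
qed

lemma proj_val_basis:
  "inj_on (\<lambda>(\<sigma>, i). proj_val dy \<sigma> i) (free_indices CARD('n) k S)" (is ?a)
  "independent ((\<lambda>(\<sigma>, i). proj_val dy \<sigma> i) ` free_indices CARD('n) k S)" (is ?b)
proof -
  have d: "(case p of (\<sigma>, i) \<Rightarrow> \<lambda>\<omega>. cf \<omega> \<sigma> i) (case q of (\<sigma>, i) \<Rightarrow> proj_val dy \<sigma> i)
    = (if p = q then 1 else 0)"
    if "p \<in> free_indices CARD('n) k S" "q \<in> free_indices CARD('n) k S" for p q
    using that by (auto simp: cf_proj_val free_indices_def split: if_splits)
  have l: "linear (case p of (\<sigma>, i) \<Rightarrow> \<lambda>\<omega>. cf \<omega> \<sigma> i)" for p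
    by (cases p) (simp add: linear_cf)
  from dual_family_independent[of _ "\<lambda>(\<sigma>, i) \<omega>. cf \<omega> \<sigma> i" "\<lambda>(\<sigma>, i). proj_val dy \<sigma> i",
      OF finite_free_indices l d]
  show ?a ?b by blast+
qed

lemma proj_X_image:
  "{proj_X k dy (basis_el dy \<sigma> i) | \<sigma> i. free_index CARD('n) k \<sigma> i \<and> i \<in> S}
    = (\<lambda>(\<sigma>, i). proj_val dy \<sigma> i) ` free_indices CARD('n) k S"
proof -
  have "proj_X k dy (basis_el dy \<sigma> i) = proj_val dy \<sigma> i" if "free_index CARD('n) k \<sigma> i" for \<sigma> i
    using that proj_X_basis_el unfolding free_index_def by blast
  then have "{proj_X k dy (basis_el dy \<sigma> i) | \<sigma> i. free_index CARD('n) k \<sigma> i \<and> i \<in> S}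
    = {proj_val dy \<sigma> i | \<sigma> i. free_index CARD('n) k \<sigma> i \<and> i \<in> S}"
    by (intro Collect_cong iff_exI) auto
  also have "\<dots> = (\<lambda>(\<sigma>, i). proj_val dy \<sigma> i) ` free_indices CARD('n) k S"
    unfolding free_indices_def by force
  finally show ?thesis .
qed

lemma TX_eq: "TX k l b = span ((\<lambda>(\<sigma>, i). proj_val dy \<sigma> i) ` free_indices CARD('n) k {1..l})"
  unfolding TX_def proj_X_image ..

lemma NX_eq:
  "NX k l b = span ((\<lambda>(\<sigma>, i). proj_val dy \<sigma> i) ` free_indices CARD('n) k {l + 1..CARD('n)})"
  unfolding NX_def proj_X_image ..

text \<open>By triangularity all normal coefficients vanish, pair indices included. Conversely,
  vanishing at the free normal indices already leaves only tangential terms in the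
  expansion.\<close>

lemma TX_iff:
  "\<omega> \<in> TX k l b \<longleftrightarrow>
    \<omega> \<in> XX k \<and> (\<forall>\<sigma>\<in>Seqs k CARD('n). \<forall>i\<in>{l + 1..CARD('n)}. cf \<omega> \<sigma> i = 0)"
proof
  assume "\<omega> \<in> TX k l b"
  then have r: "\<omega> \<in> XX k" "\<And>\<sigma> i. free_index CARD('n) k \<sigma> i \<Longrightarrow> i \<notin> {1..l} \<Longrightarrow> cf \<omega> \<sigma> i = 0"
    unfolding TX_eq span_proj_val_iff by auto
  have "cf \<omega> \<rho> j = 0" if \<rho>: "\<rho> \<in> Seqs k CARD('n)" "j \<in> {l + 1..CARD('n)}" for \<rho> j
  proof -
    have "cf \<omega> \<rho> j = (\<Sum>(\<sigma>, i)\<in>free_indices CARD('n) k {1..l}. cf \<omega> \<sigma> i * cf (proj_val dy \<sigma> i) \<rho> j)"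
      by (subst XX_expand[OF r]) (simp_all add: case_prod_unfold)
    also have "\<dots> = 0"
      by (rule sum.neutral) (use \<rho> in \<open>auto simp: free_indices_def intro!: cf_proj_val_above\<close>)
    finally show ?thesis .
  qed
  with r show "\<omega> \<in> XX k \<and> (\<forall>\<sigma>\<in>Seqs k CARD('n). \<forall>i\<in>{l + 1..CARD('n)}. cf \<omega> \<sigma> i = 0)" by blast
next
  assume r: "\<omega> \<in> XX k \<and> (\<forall>\<sigma>\<in>Seqs k CARD('n). \<forall>i\<in>{l + 1..CARD('n)}. cf \<omega> \<sigma> i = 0)"
  then show "\<omega> \<in> TX k l b"
    unfolding TX_eq span_proj_val_iff by (auto simp: free_index_def)
qed

text \<open>Only free coefficients are controlled here: a normal element may carry a tangential
  coefficient at a pair index, so there is no counterpart of \<open>TX_iff\<close> for all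
  indices.\<close>

lemma NX_iff:
  "\<omega> \<in> NX k l b \<longleftrightarrow> \<omega> \<in> XX k \<and> (\<forall>\<sigma> i. free_index CARD('n) k \<sigma> i \<longrightarrow> i \<le> l \<longrightarrow> cf \<omega> \<sigma> i = 0)"
  unfolding NX_eq span_proj_val_iff by (auto simp: free_index_def)

lemma TX_inter_NX: "TX k l b \<inter> NX k l b = {0}"
proof -
  have "\<omega> = 0" if "\<omega> \<in> TX k l b" "\<omega> \<in> NX k l b" for \<omega>
  proof (rule XX_eq_0)
    show "cf \<omega> \<sigma> i = 0" if f: "free_index CARD('n) k \<sigma> i" for \<sigma> i
      using f \<open>\<omega> \<in> TX k l b\<close> \<open>\<omega> \<in> NX k l b\<close> unfolding TX_iff NX_iff
      by (cases "i \<le> l") (auto simp: free_index_def)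
  qed (use that TX_iff in blast)
  moreover have "0 \<in> TX k l b" "0 \<in> NX k l b" unfolding TX_def NX_def by (rule span_zero)+
  ultimately show ?thesis by blast
qed

lemma XX_split:
  assumes "\<omega> \<in> XX k"
  obtains \<eta> \<theta> where "\<eta> \<in> TX k l b" "\<theta> \<in> NX k l b" "\<omega> = \<eta> + \<theta>"
proof -
  define \<eta> where
    "\<eta> = (\<Sum>(\<sigma>, i)\<in>free_indices CARD('n) k {1..l}. cf \<omega> \<sigma> i *\<^sub>R proj_val dy \<sigma> i)"
  have \<eta>: "\<eta> \<in> TX k l b"
    unfolding \<eta>_def TX_eq by (rule span_sum) (auto intro!: span_scale intro: span_base)
  have c: "cf \<eta> \<rho> j = cf \<omega> \<rho> j" if f: "free_index CARD('n) k \<rho> j" and "j \<le> l" for \<rho> j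
  proof -
    have "cf \<eta> \<rho> j = (\<Sum>p\<in>free_indices CARD('n) k {1..l}. if p = (\<rho>, j) then cf \<omega> \<rho> j else 0)"
      unfolding \<eta>_def cf_simps
      by (rule sum.cong) (use f in \<open>auto simp: free_indices_def cf_proj_val split: if_splits\<close>)
    also have "\<dots> = cf \<omega> \<rho> j"
      using that finite_free_indices[of "CARD('n)" k "{1..l}"]
      by (auto simp: sum.delta free_indices_def free_index_def)
    finally show ?thesis .
  qed
  have "\<omega> - \<eta> \<in> NX k l b"
    unfolding NX_iff using c \<eta> assms by (auto simp: TX_iff intro: subspace_diff[OF subspace_XX])
  with \<eta> that show ?thesis by force
qed

end

text \<open>
  The condition \<open>m \<and> \<omega>(w) = 0\<close> for all \<open>w\<close>, with \<open>m\<close> read as a 1-form: a description of the kernel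
  of the trace that does not refer to a basis, and thus links the standard basis to a \<open>t\<close>-\<open>n\<close> basis.
\<close>

definition (in -) contraction_zero :: "real^'m \<Rightarrow> ('m::finite) dform \<Rightarrow> bool" where
  "contraction_zero m \<omega> \<longleftrightarrow> (\<forall>w. insertion_sum (\<lambda>u. (m \<bullet> u) *\<^sub>R \<omega> w) = 0)"

text \<open>The same two reductions as for \<open>s_map\<close>: an \<open>n\<close>-form is tested
  on one list, and the dependence on \<open>w\<close> on sorted lists. In the standard basis the
  sums are the components of the coefficient matrix applied to \<open>m\<close>.\<close>

lemma contraction_zero_iff:
  assumes \<omega>: "\<omega> \<in> Alt2 k (CARD('n) - 1)"
  shows "contraction_zero m \<omega> \<longleftrightarrow>
    (\<forall>\<sigma>\<in>Seqs k CARD('n). (\<Sum>i=1..CARD('n). (m \<bullet> e i) * cf \<omega> \<sigma> i) = 0)"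
proof -
  let ?N = "CARD('n)"
  let ?e = "map e (sorted_list_of_set {1..?N})"
  let ?g = "\<lambda>w. insertion_sum (\<lambda>u. (m \<bullet> u) *\<^sub>R \<omega> w)"
  have "insertion_sum (\<lambda>u. (m \<bullet> u) *\<^sub>R \<omega> w) \<in> Alt (Suc (?N - 1))" for w
  proof (rule insertion_sum_in_Alt)
    show "linear (\<lambda>u. ((m \<bullet> u) *\<^sub>R \<omega> w) ys)" for ys
      by (rule linearI) (simp_all add: inner_add_right algebra_simps)
    show "(m \<bullet> u) *\<^sub>R \<omega> w \<in> Alt (?N - 1)" for u
      by (intro subspace_scale[OF subspace_Alt] Alt2_snd[OF \<omega>])
  qed
  then have gA: "?g w \<in> Alt ?N" for w by simp
  have gw: "?g w = 0 \<longleftrightarrow> ?g w ?e = 0" for w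
    using Alt_eq_0[OF gA span_e, of w] by (auto simp: Seqs_full)
  have A: "(\<lambda>w. ?g w ?e) \<in> Alt k"
  proof -
    have "(\<lambda>w. ?g w ?e) = (\<Sum>i=1..?N. ((- 1) ^ (i - 1) * (m \<bullet> e i)) *\<^sub>R
      (\<lambda>w. \<omega> w (map e (sorted_list_of_set ({1..?N} - {i})))))"
      unfolding insertion_sum_basis by (simp add: fun_eq_iff mult.assoc)
    then show ?thesis
      using Alt2_fst[OF \<omega>] by (simp add: subspace_sum[OF subspace_Alt] subspace_scale[OF subspace_Alt])
  qed
  have v: "?g (map e (sorted_list_of_set \<sigma>)) ?e = (\<Sum>i=1..?N. (m \<bullet> e i) * cf \<omega> \<sigma> i)" for \<sigma>
    unfolding insertion_sum_basis cf_def by (simp add: mult.left_commute)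
  show ?thesis
  proof
    assume "contraction_zero m \<omega>"
    then show "\<forall>\<sigma>\<in>Seqs k ?N. (\<Sum>i=1..?N. (m \<bullet> e i) * cf \<omega> \<sigma> i) = 0"
      unfolding contraction_zero_def by (simp flip: v)
  next
    assume "\<forall>\<sigma>\<in>Seqs k ?N. (\<Sum>i=1..?N. (m \<bullet> e i) * cf \<omega> \<sigma> i) = 0"
    then have "(\<lambda>w. ?g w ?e) = 0"
      by (intro Alt_eq_0[OF A span_e]) (simp add: v)
    then show "contraction_zero m \<omega>"
      unfolding contraction_zero_def gw by (simp add: fun_eq_iff)
  qed
qed

end

section \<open>Simplices and their faces\<close>

lemma tangent_space_base: "x \<in> f \<Longrightarrow> y \<in> f \<Longrightarrow> x - y \<in> tangent_space f"
  unfolding tangent_space_def by (rule span_base) blast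

lemma tangent_space_mono: "f \<subseteq> g \<Longrightarrow> tangent_space f \<subseteq> tangent_space g"
  unfolding tangent_space_def by (rule span_mono) blast

text \<open>Each group is independent by itself and the two groups are orthogonal to each other, so
  the whole family is independent. The dual vectors represent its coordinate functionals.\<close>

lemma tn_basis_dual:
  fixes b :: "nat \<Rightarrow> real^'n::finite"
  assumes tn: "tn_basis l f b" and l: "l \<le> CARD('n)"
  obtains e where "dual_bases b e"
proof -
  let ?N = "CARD('n)"
  have U: "{1..?N} = {1..l} \<union> {l + 1..?N}" "{1..l} \<inter> {l + 1..?N} = {}" using l by auto
  have z: "\<forall>i\<in>{1..?N}. c i = 0" if c: "(\<Sum>i\<in>{1..?N}. c i *\<^sub>R b i) = 0" for c
  proof -
    let ?t = "\<Sum>i\<in>{1..l}. c i *\<^sub>R b i" and ?s = "\<Sum>i\<in>{l + 1..?N}. c i *\<^sub>R b i"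
    have ts: "?t + ?s = 0"
      using c unfolding U(1) by (subst (asm) sum.union_disjoint) (use U(2) in auto)
    have "?t \<in> tangent_space f"
      using tn unfolding tn_basis_def tangent_space_def by (auto intro!: span_sum span_scale)
    then have "orthogonal (b i) ?t" if "i \<in> {l + 1..?N}" for i
      using tn that unfolding tn_basis_def by blast
    \<comment> \<open>The two parts of a vanishing combination are opposite and orthogonal, so both
      are zero.\<close>
    then have "?s \<bullet> ?t = 0" by (simp add: inner_sum_left orthogonal_def)
    moreover have "?s = - ?t" using ts by (simp add: eq_neg_iff_add_eq_0 add.commute)
    ultimately have t: "?t = 0" by simp
    with ts have s: "?s = 0" by simp
    have "c i = 0" if I: "inj_on b I" "independent (b ` I)" "finite I"
      and 0: "(\<Sum>i\<in>I. c i *\<^sub>R b i) = 0" and i: "i \<in> I" for I i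
    proof -
      have "(\<Sum>v\<in>b ` I. c (the_inv_into I b v) *\<^sub>R v) = 0"
        using 0 I by (simp add: sum.reindex the_inv_into_f_f)
      then have "c (the_inv_into I b (b i)) = 0"
        using I i independentD[OF I(2), of "b ` I" "\<lambda>v. c (the_inv_into I b v)" "b i"] by simp
      then show ?thesis using I i by (simp add: the_inv_into_f_f)
    qed
    then show ?thesis using t s tn U(1) unfolding tn_basis_def by (metis UnE finite_atLeastAtMost)
  qed
  have inj: "inj_on b {1..?N}" and ind: "independent (b ` {1..?N})"
    using independent_family[of "{1..?N}" b] z by blast+
  have "\<exists>e. \<forall>i\<in>{1..?N}. b i \<bullet> e = (if i = j then 1 else 0)" for j
  proof -
    obtain g :: "real^'n \<Rightarrow> real" where g: "linear g"
      "\<And>x. x \<in> b ` {1..?N} \<Longrightarrow> g x = (if the_inv_into {1..?N} b x = j then 1 else 0)"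
      using linear_independent_extend[OF ind, of "\<lambda>x. if the_inv_into {1..?N} b x = j then 1 else 0"]
      by blast
    \<comment> \<open>The Riesz vector of the functional \<open>g\<close>, which picks out the
      coefficient of \<open>b j\<close>.\<close>
    have "x \<bullet> (\<Sum>i\<in>Basis. g i *\<^sub>R i) = g x" for x
    proof -
      have "g x = g (\<Sum>i\<in>Basis. (x \<bullet> i) *\<^sub>R i)" by (simp add: euclidean_representation)
      also have "\<dots> = (\<Sum>i\<in>Basis. (x \<bullet> i) * g i)"
        using g(1) by (simp only: linear_sum[OF g(1)] linear_scale[OF g(1)] real_scaleR_def)
      finally show ?thesis by (simp add: inner_sum_right mult.commute)
    qed
    then show ?thesis using g(2) inj
      by (intro exI[of _ "\<Sum>i\<in>Basis. g i *\<^sub>R i"]) (simp add: the_inv_into_f_f)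
  qed
  then obtain e where "\<And>j i. i \<in> {1..?N} \<Longrightarrow> b i \<bullet> e j = (if i = j then 1 else 0)" by metis
  then have "dual_bases b e" by unfold_locales
  then show ?thesis by (rule that)
qed

text \<open>Equivalently, the first \<open>l\<close> dual vectors lie in the tangent space. The
  numbers \<open>m \<bullet> e i\<close> are the coefficients of \<open>m\<close> in the basis
  \<open>b\<close>, and the tangential part of \<open>m\<close> has to vanish.\<close>

lemma dual_orthogonal_tangent:
  fixes b :: "nat \<Rightarrow> real^'n::finite"
  assumes "dual_bases b e" and tn: "tn_basis l f b" and l: "l \<le> CARD('n)"
    and m: "\<And>u. u \<in> tangent_space f \<Longrightarrow> m \<bullet> u = 0" and i: "i \<in> {1..l}"
  shows "m \<bullet> e i = 0"
proof -
  interpret dual_bases b e by fact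
  let ?N = "CARD('n)"
  have U: "{1..?N} = {1..l} \<union> {l + 1..?N}" "{1..l} \<inter> {l + 1..?N} = {}" using l by auto
  let ?t = "\<Sum>i\<in>{1..l}. (m \<bullet> e i) *\<^sub>R b i" and ?s = "\<Sum>i\<in>{l + 1..?N}. (m \<bullet> e i) *\<^sub>R b i"
  have ts: "m = ?t + ?s"
    by (subst (1) expand_b[of m], subst U(1), rule sum.union_disjoint) (use U(2) in auto)
  have t: "?t \<in> tangent_space f"
    using tn unfolding tn_basis_def tangent_space_def by (auto intro!: span_sum span_scale)
  then have "orthogonal (b i) ?t" if "i \<in> {l + 1..?N}" for i
    using tn that unfolding tn_basis_def by blast
  then have "?s \<bullet> ?t = 0" by (simp add: inner_sum_left orthogonal_def)
  moreover have "(?t + ?s) \<bullet> ?t = 0" using m[OF t] unfolding ts[symmetric] .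
  \<comment> \<open>The tangential part is orthogonal to \<open>m\<close> and to the normal part,
    hence to itself.\<close>
  ultimately have "?t \<bullet> ?t = 0" unfolding inner_add_left by linarith
  then have "?t = 0" by simp
  then have "0 = ?t \<bullet> e i" by simp
  also have "\<dots> = (\<Sum>j\<in>{1..l}. if j = i then m \<bullet> e j else 0)"
    unfolding inner_sum_left using i l by (intro sum.cong refl) (simp add: dual)
  also have "\<dots> = m \<bullet> e i" using i by simp
  finally show ?thesis by simp
qed

text \<open>The simplex is represented by its vertex set, so that its faces become subsets of
  \<open>V\<close>.\<close>

locale full_simplex =
  fixes V :: "(real^'n::finite) set"
  assumes indep: "\<not> affine_dependent V" and card_V: "card V = CARD('n) + 1"
begin

lemma finite_V [simp]: "finite V"
  using card_V by (metis card.infinite add_is_0 one_neq_zero)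

lemma verts_hull: "S \<subseteq> V \<Longrightarrow> verts (convex hull S) = S"
  using extreme_point_of_convex_hull_affine_independent affine_independent_subset[OF indep]
  unfolding verts_def by blast

lemma subsimplices_eq: "subsimplices l (convex hull V) = {convex hull S | S. S \<subseteq> V \<and> card S = l + 1}"
  unfolding subsimplices_def verts_hull[OF order_refl] ..

abbreviation L :: "real^'n \<Rightarrow> real^'n \<Rightarrow> real" where "L \<equiv> bary (convex hull V)"

lemma affine_coords_unique:
  assumes "(\<Sum>u\<in>V. c u) = (\<Sum>u\<in>V. d u)" "(\<Sum>u\<in>V. c u *\<^sub>R u) = (\<Sum>u\<in>V. d u *\<^sub>R u)" "v \<in> V"
  shows "c v = d v"
proof (rule ccontr)
  assume "c v \<noteq> d v"
  moreover have "(\<Sum>u\<in>V. c u - d u) = 0" "(\<Sum>u\<in>V. (c u - d u) *\<^sub>R u) = 0"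
    using assms by (simp_all add: sum_subtractf scaleR_diff_left)
  ultimately have "affine_dependent V"
    using assms(3) by (subst affine_dependent_explicit_finite) (auto intro!: exI[of _ "\<lambda>u. c u - d u"])
  then show False using indep by simp
qed

text \<open>This resolves the definite description in \<open>bary\<close>: any affine coordinates of
  a point, once exhibited, are its barycentric ones.\<close>

lemma L_eq:
  assumes c: "(\<Sum>u\<in>V. c u) = 1" "(\<Sum>u\<in>V. c u *\<^sub>R u) = x" and v: "v \<in> V"
  shows "L v x = c v"
proof -
  let ?c = "\<lambda>u. if u \<in> V then c u else 0"
  have "(THE c. (\<forall>u. u \<notin> V \<longrightarrow> c u = 0) \<and> (\<Sum>u\<in>V. c u) = 1 \<and> (\<Sum>u\<in>V. c u *\<^sub>R u) = x) = ?c"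
  proof (rule the_equality)
    show "(\<forall>u. u \<notin> V \<longrightarrow> ?c u = 0) \<and> (\<Sum>u\<in>V. ?c u) = 1 \<and> (\<Sum>u\<in>V. ?c u *\<^sub>R u) = x"
      using c by simp
    fix d :: "real^'n \<Rightarrow> real"
    assume "(\<forall>u. u \<notin> V \<longrightarrow> d u = 0) \<and> (\<Sum>u\<in>V. d u) = 1 \<and> (\<Sum>u\<in>V. d u *\<^sub>R u) = x"
    then show "d = ?c" using affine_coords_unique[of d c] c by (auto simp: fun_eq_iff)
  qed
  then show ?thesis using v unfolding bary_def verts_hull[OF order_refl] by simp
qed

lemma
  shows sum_L: "(\<Sum>u\<in>V. L u x) = 1" and sum_L_scaleR: "(\<Sum>u\<in>V. L u x *\<^sub>R u) = x"
proof -
  have "affine hull V = UNIV"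
    using affine_independent_span_eq[OF indep] card_V by simp
  then obtain c where c: "(\<Sum>u\<in>V. c u) = 1" "(\<Sum>u\<in>V. c u *\<^sub>R u) = x"
    using affine_hull_finite[OF finite_V] by blast
  then show "(\<Sum>u\<in>V. L u x) = 1" "(\<Sum>u\<in>V. L u x *\<^sub>R u) = x"
    using L_eq[OF c] by simp_all
qed

lemma L_face:
  assumes S: "S \<subseteq> V" and x: "x \<in> convex hull S" and v: "v \<in> V - S"
  shows "L v x = 0"
proof -
  have fS: "finite S" using S finite_V finite_subset by blast
  from x obtain c where c: "sum c S = 1" "(\<Sum>u\<in>S. c u *\<^sub>R u) = x"
    unfolding convex_hull_finite[OF fS] by blast
  let ?c = "\<lambda>u. if u \<in> S then c u else 0"
  have "(\<Sum>u\<in>V. ?c u) = 1"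
    using sum.mono_neutral_cong_right[OF finite_V S, of ?c c] c(1) by simp
  moreover have "(\<Sum>u\<in>V. ?c u *\<^sub>R u) = x"
    using sum.mono_neutral_cong_right[OF finite_V S, of "\<lambda>u. ?c u *\<^sub>R u" "\<lambda>u. c u *\<^sub>R u"] c(2) by simp
  ultimately show ?thesis using L_eq[of ?c x v] v by simp
qed

text \<open>The linear part of the affine function \<open>L v\<close>: the inner product of its
  constant gradient with \<open>z\<close>.\<close>

definition D :: "real^'n \<Rightarrow> real^'n \<Rightarrow> real" where
  "D v z = L v z - L v 0"

lemma
  shows sum_D: "(\<Sum>u\<in>V. D u z) = 0" and sum_D_scaleR: "(\<Sum>u\<in>V. D u z *\<^sub>R u) = z"
  by (simp_all add: D_def sum_subtractf scaleR_diff_left sum_L sum_L_scaleR)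

text \<open>Since the numbers \<open>D u z\<close> sum to 0, \<open>z\<close> is a combination of
  the edge vectors \<open>u - u0\<close>. Taking \<open>u0\<close> in a face removes all terms of
  that face on which \<open>m\<close> vanishes.\<close>

lemma D_shift:
  assumes u0: "u0 \<in> V"
  shows "m \<bullet> z = (\<Sum>u\<in>V. D u z * (m \<bullet> (u - u0)))"
proof -
  have "(\<Sum>u\<in>V. D u z * (m \<bullet> (u - u0))) = m \<bullet> (\<Sum>u\<in>V. D u z *\<^sub>R u) - (\<Sum>u\<in>V. D u z) * (m \<bullet> u0)"
    by (simp add: inner_sum_right inner_diff_right right_diff_distrib sum_subtractf sum_distrib_right)
  then show ?thesis by (simp add: sum_D sum_D_scaleR)
qed

text \<open>With \<open>u0\<close> in the facet only the opposite vertex \<open>v\<close>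
  contributes, so the normal is a multiple of the gradient of \<open>L v\<close>. The factor is
  \<nu> \<bullet> (v - u0), and it cannot be 0 because \<nu> has length 1.\<close>

lemma facet_normal:
  assumes v: "v \<in> V" and \<nu>: "unit_normal (convex hull (V - {v})) \<nu>"
  obtains K where "K \<noteq> 0" "\<And>z. \<nu> \<bullet> z = K * D v z"
proof -
  have "card (V - {v}) \<noteq> 0" using v card_V by simp
  then obtain u0 where u0: "u0 \<in> V - {v}" by (metis card.empty ex_in_conv)
  have 0: "\<nu> \<bullet> (u - u0) = 0" if "u \<in> V - {v}" for u
    using \<nu> tangent_space_base[of u "convex hull (V - {v})" u0] that u0
    unfolding unit_normal_def orthogonal_def by (metis hull_inc)
  have e: "\<nu> \<bullet> z = \<nu> \<bullet> (v - u0) * D v z" for z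
  proof -
    have "\<nu> \<bullet> z = (\<Sum>u\<in>V. D u z * (\<nu> \<bullet> (u - u0)))" using u0 by (intro D_shift) auto
    also have "\<dots> = (\<Sum>u\<in>{v}. D u z * (\<nu> \<bullet> (u - u0)))"
      using v 0 by (intro sum.mono_neutral_right) auto
    finally show ?thesis by simp
  qed
  have "\<nu> \<bullet> \<nu> = 1" using \<nu> unfolding unit_normal_def by (simp add: norm_eq_1)
  then have "\<nu> \<bullet> (v - u0) \<noteq> 0" using e[of \<nu>] by auto
  with e that show ?thesis by blast
qed

text \<open>Facet normals at \<open>f\<close> pair to 0 with the tangential dual vectors, so the
  contractions involve only normal coefficients. Conversely, these normals are many enough to detect
  all of them.\<close>

lemma TX_iff_contraction:
  assumes S: "S \<subseteq> V" "card S = l + 1" and k: "1 \<le> k" "k \<le> CARD('n)"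
    and tn: "tn_basis l (convex hull S) b"
    and \<nu>: "\<And>v. v \<in> V - S \<Longrightarrow> unit_normal (convex hull (V - {v})) (\<nu> v)"
    and A: "A \<in> XX k"
  shows "A \<in> TX k l b \<longleftrightarrow> (\<forall>v\<in>V - S. contraction_zero (\<nu> v) A)"
proof -
  have "card S \<le> card V" using S(1) by (intro card_mono) auto
  then have l: "l \<le> CARD('n)" using S card_V by simp
  obtain e where de: "dual_bases b e" using tn_basis_dual[OF tn l] .
  interpret dual_bases b e by fact
  let ?N = "CARD('n)"
  have AA: "A \<in> Alt2 k (?N - 1)" using A by (simp add: XX_def)
  have \<nu>e: "\<nu> v \<bullet> e i = 0" if v: "v \<in> V - S" and i: "i \<in> {1..l}" for v i
  proof (rule dual_orthogonal_tangent[OF de tn l _ i])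
    fix u assume "u \<in> tangent_space (convex hull S)"
    moreover have "convex hull S \<subseteq> convex hull (V - {v})" using S v by (intro hull_mono) auto
    ultimately have "u \<in> tangent_space (convex hull (V - {v}))" using tangent_space_mono by blast
    then show "\<nu> v \<bullet> u = 0" using \<nu>[OF v] unfolding unit_normal_def orthogonal_def by blast
  qed
  have red: "(\<Sum>i=1..?N. (\<nu> v \<bullet> e i) * cf A \<sigma> i) = (\<Sum>i=l+1..?N. (\<nu> v \<bullet> e i) * cf A \<sigma> i)"
    if v: "v \<in> V - S" for v \<sigma>
    by (rule sum.mono_neutral_right) (use \<nu>e[OF v] l in auto)
  show ?thesis
  proof
    assume "A \<in> TX k l b"
    then have "\<forall>\<sigma>\<in>Seqs k ?N. \<forall>i\<in>{l + 1..?N}. cf A \<sigma> i = 0" using TX_iff[OF k] by blast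
    then show "\<forall>v\<in>V - S. contraction_zero (\<nu> v) A"
      unfolding contraction_zero_iff[OF AA] by (simp add: red)
  next
    assume c: "\<forall>v\<in>V - S. contraction_zero (\<nu> v) A"
    have "cf A \<sigma> j = 0" if \<sigma>: "\<sigma> \<in> Seqs k ?N" and j: "j \<in> {l + 1..?N}" for \<sigma> j
    proof -
      \<comment> \<open>\<open>z\<close> encodes the normal coefficients in row \<sigma>. Since all
        facet normals annihilate it, it is tangent to the face, hence orthogonal to the normal
        vector \<open>b j\<close>; but \<open>b j \<bullet> z\<close> is the coefficient
        sought.\<close>
      define z where "z = (\<Sum>i=l+1..?N. cf A \<sigma> i *\<^sub>R e i)"
      have Dz: "D v z = 0" if v: "v \<in> V - S" for v
      proof -
        have "\<nu> v \<bullet> z = (\<Sum>i=1..?N. (\<nu> v \<bullet> e i) * cf A \<sigma> i)"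
          unfolding red[OF v] z_def by (simp add: inner_sum_right mult.commute)
        also have "\<dots> = 0" using c v \<sigma> contraction_zero_iff[OF AA] by blast
        finally show ?thesis using facet_normal[OF _ \<nu>[OF v]] v
          by (metis DiffD1 mult_eq_0_iff)
      qed
      have "card S \<noteq> 0" using S by simp
      then obtain u0 where u0: "u0 \<in> S" by (metis card.empty ex_in_conv)
      have bj: "b j \<bullet> (u - u0) = 0" if "u \<in> S" for u
      proof -
        have "u - u0 \<in> tangent_space (convex hull S)"
          using that u0 by (intro tangent_space_base hull_inc)
        then show ?thesis using tn j unfolding tn_basis_def orthogonal_def by blast
      qed
      have "b j \<bullet> z = (\<Sum>i=l+1..?N. if i = j then cf A \<sigma> i else 0)"
        unfolding z_def inner_sum_right using j by (intro sum.cong refl) (simp add: dual)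
      also have "\<dots> = cf A \<sigma> j" using j by simp
      finally have "cf A \<sigma> j = (\<Sum>u\<in>V. D u z * (b j \<bullet> (u - u0)))"
        using D_shift[of u0 "b j" z] u0 S by auto
      \<comment> \<open>Vertices outside \<open>S\<close> drop out by \<open>Dz\<close>, and those
        in \<open>S\<close> because \<open>b j\<close> is orthogonal to the edges of the
        face.\<close>
      also have "\<dots> = 0" by (rule sum.neutral) (use Dz bj in auto)
      finally show ?thesis .
    qed
    then show "A \<in> TX k l b" using A TX_iff[OF k] by blast
  qed
qed

end

section \<open>Polynomial combinations of forms\<close>

text \<open>Only positive points are tested, since these can be rescaled to points of the simplex.
  With all variables but one fixed, a polynomial in the last one has infinitely many zeros, so its
  coefficients vanish and the induction continues with them.\<close>

lemma monomials_independent: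
  fixes c :: "('a \<Rightarrow> nat) \<Rightarrow> real"
  assumes "finite S" "finite I" and "\<And>\<alpha> u. \<alpha> \<in> I \<Longrightarrow> u \<notin> S \<Longrightarrow> \<alpha> u = 0"
    and "\<And>t. (\<And>u. u \<in> S \<Longrightarrow> 0 < t u) \<Longrightarrow> (\<Sum>\<alpha>\<in>I. c \<alpha> * (\<Prod>u\<in>S. t u ^ \<alpha> u)) = 0"
    and "\<alpha> \<in> I"
  shows "c \<alpha> = 0"
  using assms
proof (induction S arbitrary: I c \<alpha> rule: finite_induct)
  case empty
  have "\<beta> = (\<lambda>_. 0)" if "\<beta> \<in> I" for \<beta> using empty(2)[OF that] by auto
  then have "I = {\<alpha>}" using empty(4) by blast
  then show ?case using empty(3)[of "\<lambda>_. 1"] by simp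
next
  case (insert w S)
  let ?J = "{\<beta> \<in> I. \<beta> w = \<alpha> w}"
  have z: "(\<Sum>\<beta>\<in>?J. c \<beta> * (\<Prod>u\<in>S. t u ^ \<beta> u)) = 0" if t: "\<And>u. u \<in> S \<Longrightarrow> 0 < t u" for t
  proof -
    define N where "N = Max ((\<lambda>\<beta>. \<beta> w) ` I)"
    have N: "\<beta> w \<le> N" if "\<beta> \<in> I" for \<beta> using that insert(4) by (simp add: N_def)
    \<comment> \<open>The coefficient of \<open>y ^ j\<close> when \<open>w\<close> takes the value
      \<open>y\<close> and the other variables stay fixed.\<close>
    define d where "d j = (\<Sum>\<beta>\<in>{\<beta> \<in> I. \<beta> w = j}. c \<beta> * (\<Prod>u\<in>S. t u ^ \<beta> u))" for j
    have "(\<Sum>j\<le>N. d j * y ^ j) = 0" if y: "0 < y" for y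
    proof -
      let ?t = "t(w := y)"
      have "0 = (\<Sum>\<beta>\<in>I. c \<beta> * (\<Prod>u\<in>insert w S. ?t u ^ \<beta> u))"
        using t y by (intro insert(6)[symmetric]) auto
      also have "\<dots> = (\<Sum>\<beta>\<in>I. c \<beta> * (\<Prod>u\<in>S. t u ^ \<beta> u) * y ^ \<beta> w)"
      proof (rule sum.cong[OF refl])
        fix \<beta>
        have "(\<Prod>u\<in>S. ?t u ^ \<beta> u) = (\<Prod>u\<in>S. t u ^ \<beta> u)"
          using insert(2) by (intro prod.cong) auto
        then show "c \<beta> * (\<Prod>u\<in>insert w S. ?t u ^ \<beta> u) = c \<beta> * (\<Prod>u\<in>S. t u ^ \<beta> u) * y ^ \<beta> w"
          using insert(1,2) by simp
      qed
      also have "\<dots> = (\<Sum>j\<le>N. \<Sum>\<beta>\<in>{\<beta> \<in> I. \<beta> w = j}. c \<beta> * (\<Prod>u\<in>S. t u ^ \<beta> u) * y ^ \<beta> w)"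
        using insert(4) N by (intro sum.group[symmetric]) auto
      also have "\<dots> = (\<Sum>j\<le>N. d j * y ^ j)"
        unfolding d_def sum_distrib_right by (intro sum.cong) auto
      finally show ?thesis by simp
    qed
    then have "{0<..} \<subseteq> {y. (\<Sum>j\<le>N. d j * y ^ j) = 0}" by auto
    then have "infinite {y. (\<Sum>j\<le>N. d j * y ^ j) = 0}"
      using infinite_Ioi finite_subset by blast
    then have "\<forall>j\<le>N. d j = 0" unfolding polyfun_finite_roots by blast
    then have "d (\<alpha> w) = 0" using N insert(7) by blast
    then show ?thesis by (simp add: d_def)
  qed
  \<comment> \<open>Resetting the entry at \<open>w\<close> turns the exponents with the common
    value \<open>\<alpha> w\<close> there into exponents on \<open>S\<close>, and loses
    nothing.\<close>
  let ?r = "\<lambda>\<beta>. \<beta>(w := 0)"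
  have inj: "inj_on ?r ?J"
    by (rule inj_onI) (metis (mono_tags, lifting) fun_upd_idem_iff fun_upd_upd mem_Collect_eq)
  have "c ((?r \<alpha>)(w := \<alpha> w)) = 0"
  proof (rule insert.IH[of "?r ` ?J" "\<lambda>\<beta>. c (\<beta>(w := \<alpha> w))" "?r \<alpha>"])
    show "\<beta> u = 0" if "\<beta> \<in> ?r ` ?J" "u \<notin> S" for \<beta> u
      using that insert(5) by (auto split: if_splits)
    show "?r \<alpha> \<in> ?r ` ?J" using insert(7) by blast
    fix t :: "'a \<Rightarrow> real" assume t: "\<And>u. u \<in> S \<Longrightarrow> 0 < t u"
    have "(\<Sum>\<beta>\<in>?r ` ?J. c (\<beta>(w := \<alpha> w)) * (\<Prod>u\<in>S. t u ^ \<beta> u))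
      = (\<Sum>\<beta>\<in>?J. c \<beta> * (\<Prod>u\<in>S. t u ^ \<beta> u))"
      unfolding sum.reindex[OF inj] comp_def
    proof (rule sum.cong[OF refl])
      fix \<beta> assume "\<beta> \<in> ?J"
      then have "(?r \<beta>)(w := \<alpha> w) = \<beta>" by auto
      moreover have "(\<Prod>u\<in>S. t u ^ (?r \<beta>) u) = (\<Prod>u\<in>S. t u ^ \<beta> u)"
        using insert(2) by (intro prod.cong) auto
      ultimately show "c ((?r \<beta>)(w := \<alpha> w)) * (\<Prod>u\<in>S. t u ^ (?r \<beta>) u)
        = c \<beta> * (\<Prod>u\<in>S. t u ^ \<beta> u)" by simp
    qed
    then show "(\<Sum>\<beta>\<in>?r ` ?J. c (\<beta>(w := \<alpha> w)) * (\<Prod>u\<in>S. t u ^ \<beta> u)) = 0"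
      using z[OF t] by simp
  qed (use insert(4) in simp)
  then show ?case by simp
qed

text \<open>The coefficient space \<open>W\<close> may vary with the exponent: tangential and normal
  parts depend on the face that carries it, so a single tensor product would not do.\<close>

definition comb :: "('a \<Rightarrow> 'x \<Rightarrow> real) \<Rightarrow> 'a set \<Rightarrow> ('a \<Rightarrow> 'd::real_vector set) \<Rightarrow> ('x \<Rightarrow> 'd) set" where
  "comb \<beta> I W = {(\<lambda>x. \<Sum>\<alpha>\<in>I. \<beta> \<alpha> x *\<^sub>R A \<alpha>) | A. \<forall>\<alpha>\<in>I. A \<alpha> \<in> W \<alpha>}"

text \<open>Testing on a set \<open>X\<close> matters for traces, where independence is needed on a
  single facet.\<close>

definition indep_on :: "('a \<Rightarrow> 'x \<Rightarrow> real) \<Rightarrow> 'a set \<Rightarrow> 'x set \<Rightarrow> bool" where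
  "indep_on \<beta> I X \<longleftrightarrow>
    (\<forall>c. (\<forall>x\<in>X. (\<Sum>\<alpha>\<in>I. \<beta> \<alpha> x * c \<alpha>) = 0) \<longrightarrow> (\<forall>\<alpha>\<in>I. c \<alpha> = 0))"

lemma indep_on_subset:
  assumes "J \<subseteq> I" "finite I" "indep_on \<beta> I X"
  shows "indep_on \<beta> J X"
  unfolding indep_on_def
proof (intro allI impI ballI)
  fix c \<alpha> assume c: "\<forall>x\<in>X. (\<Sum>\<alpha>\<in>J. \<beta> \<alpha> x * c \<alpha>) = 0" and \<alpha>: "\<alpha> \<in> J"
  let ?c = "\<lambda>\<alpha>. if \<alpha> \<in> J then c \<alpha> else 0"
  have "(\<Sum>\<alpha>\<in>I. \<beta> \<alpha> x * ?c \<alpha>) = (\<Sum>\<alpha>\<in>J. \<beta> \<alpha> x * c \<alpha>)" for x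
    using assms(1,2) by (intro sum.mono_neutral_cong_right) auto
  then have "?c \<alpha> = 0"
    using assms(3)[unfolded indep_on_def, rule_format, of ?c \<alpha>] c \<alpha> assms(1) by auto
  then show "c \<alpha> = 0" using \<alpha> by simp
qed

lemma indep_on_forms:
  fixes A :: "'a \<Rightarrow> 'b \<Rightarrow> 'c \<Rightarrow> real"
  assumes "indep_on \<beta> I X" "\<And>x. x \<in> X \<Longrightarrow> (\<Sum>\<alpha>\<in>I. \<beta> \<alpha> x *\<^sub>R A \<alpha>) = 0" "\<alpha> \<in> I"
  shows "A \<alpha> = 0"
proof (intro ext)
  fix w v
  have "(\<Sum>\<alpha>\<in>I. \<beta> \<alpha> x * A \<alpha> w v) = 0" if "x \<in> X" for x
  proof -
    have "(\<Sum>\<alpha>\<in>I. \<beta> \<alpha> x *\<^sub>R A \<alpha>) w v = 0" using assms(2)[OF that] by simp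
    then show ?thesis by simp
  qed
  then show "A \<alpha> w v = 0 w v"
    using assms(1)[unfolded indep_on_def, rule_format, of "\<lambda>\<alpha>. A \<alpha> w v"] assms(3) by simp
qed

lemma subspace_comb:
  assumes W: "\<And>\<alpha>. \<alpha> \<in> I \<Longrightarrow> subspace (W \<alpha>)"
  shows "subspace (comb \<beta> I W)"
proof (rule subspaceI)
  show "0 \<in> comb \<beta> I W"
    unfolding comb_def using subspace_0[OF W] by (auto intro!: exI[of _ "\<lambda>_. 0"] simp: zero_fun_def)
next
  fix f g assume "f \<in> comb \<beta> I W" "g \<in> comb \<beta> I W"
  then obtain A B where "f = (\<lambda>x. \<Sum>\<alpha>\<in>I. \<beta> \<alpha> x *\<^sub>R A \<alpha>)" "\<forall>\<alpha>\<in>I. A \<alpha> \<in> W \<alpha>"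
    "g = (\<lambda>x. \<Sum>\<alpha>\<in>I. \<beta> \<alpha> x *\<^sub>R B \<alpha>)" "\<forall>\<alpha>\<in>I. B \<alpha> \<in> W \<alpha>"
    unfolding comb_def by blast
  then show "f + g \<in> comb \<beta> I W"
    unfolding comb_def using subspace_add[OF W]
    by (auto intro!: exI[of _ "\<lambda>\<alpha>. A \<alpha> + B \<alpha>"] simp: fun_eq_iff scaleR_add_right sum.distrib)
next
  fix c f assume "f \<in> comb \<beta> I W"
  then obtain A where "f = (\<lambda>x. \<Sum>\<alpha>\<in>I. \<beta> \<alpha> x *\<^sub>R A \<alpha>)" "\<forall>\<alpha>\<in>I. A \<alpha> \<in> W \<alpha>"
    unfolding comb_def by blast
  then show "c *\<^sub>R f \<in> comb \<beta> I W"
    unfolding comb_def using subspace_scale[OF W]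
    by (auto intro!: exI[of _ "\<lambda>\<alpha>. c *\<^sub>R A \<alpha>"] simp: fun_eq_iff scaleR_sum_right mult.commute)
qed

lemma comb_base:
  assumes I: "finite I" and W: "\<And>\<alpha>. \<alpha> \<in> I \<Longrightarrow> subspace (W \<alpha>)" and \<alpha>: "\<alpha> \<in> I" "A \<in> W \<alpha>"
  shows "(\<lambda>x. \<beta> \<alpha> x *\<^sub>R A) \<in> comb \<beta> I W"
proof -
  have "(\<lambda>x. \<beta> \<alpha> x *\<^sub>R A) = (\<lambda>x. \<Sum>\<gamma>\<in>I. \<beta> \<gamma> x *\<^sub>R (if \<gamma> = \<alpha> then A else 0))"
    using I \<alpha>(1) by (simp add: if_distrib[of "\<lambda>z. _ *\<^sub>R z"] cong: if_cong)
  then show ?thesis unfolding comb_def using subspace_0[OF W] \<alpha>(2) by auto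
qed

text \<open>With \<open>G\<close> equal to \<open>W\<close> this describes tensor products of
  fields; with \<open>G\<close> a basis of \<open>W\<close> it produces a basis of the whole
  space.\<close>

lemma span_eq_comb:
  assumes I: "finite I" and G: "\<And>\<alpha>. \<alpha> \<in> I \<Longrightarrow> span (G \<alpha>) = W \<alpha>"
  shows "span {(\<lambda>x. \<beta> \<alpha> x *\<^sub>R A) | \<alpha> A. \<alpha> \<in> I \<and> A \<in> G \<alpha>} = comb \<beta> I W" (is "span ?G = _")
proof
  have W: "subspace (W \<alpha>)" if "\<alpha> \<in> I" for \<alpha> using G[OF that] subspace_span by metis
  have "A \<in> W \<alpha>" if "\<alpha> \<in> I" "A \<in> G \<alpha>" for A \<alpha> using G[OF that(1)] span_base[OF that(2)] by simp
  then show "span ?G \<subseteq> comb \<beta> I W"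
    by (intro span_minimal subspace_comb W) (auto intro!: comb_base[where W = W, OF I W])
  have lin: "linear (\<lambda>A x. \<beta> \<alpha> x *\<^sub>R A)" for \<alpha>
    by (rule linearI) (simp_all add: fun_eq_iff scaleR_add_right)
  have b: "(\<lambda>x. \<beta> \<alpha> x *\<^sub>R A) \<in> span ?G" if "\<alpha> \<in> I" "A \<in> W \<alpha>" for \<alpha> A
  proof -
    have "(\<lambda>x. \<beta> \<alpha> x *\<^sub>R A) \<in> (\<lambda>A x. \<beta> \<alpha> x *\<^sub>R A) ` span (G \<alpha>)" using that G by auto
    also have "\<dots> = span ((\<lambda>A x. \<beta> \<alpha> x *\<^sub>R A) ` G \<alpha>)" by (rule linear_span_image[OF lin, symmetric])
    also have "\<dots> \<subseteq> span ?G" using that(1) by (intro span_mono) auto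
    finally show ?thesis .
  qed
  show "comb \<beta> I W \<subseteq> span ?G"
  proof
    fix f assume "f \<in> comb \<beta> I W"
    then obtain A where f: "f = (\<lambda>x. \<Sum>\<alpha>\<in>I. \<beta> \<alpha> x *\<^sub>R A \<alpha>)" "\<forall>\<alpha>\<in>I. A \<alpha> \<in> W \<alpha>"
      unfolding comb_def by blast
    then have "f = (\<Sum>\<alpha>\<in>I. (\<lambda>x. \<beta> \<alpha> x *\<^sub>R A \<alpha>))" by (simp add: fun_eq_iff)
    then show "f \<in> span ?G" using f(2) b by (auto intro!: span_sum)
  qed
qed

lemma field_tensor_span:
  "field_tensor (span G) W = span {(\<lambda>x. g x *\<^sub>R A) | g A. g \<in> G \<and> A \<in> W}" (is "_ = span ?G")
  unfolding field_tensor_def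
proof (rule span_eq[THEN iffD2], intro conjI subsetI)
  fix f assume "f \<in> {(\<lambda>x. p x *\<^sub>R A) | p A. p \<in> span G \<and> A \<in> W}"
  then obtain p A where f: "f = (\<lambda>x. p x *\<^sub>R A)" "p \<in> span G" "A \<in> W" by blast
  have lin: "linear (\<lambda>p x. p x *\<^sub>R A)"
    by (rule linearI) (simp_all add: fun_eq_iff scaleR_add_left)
  have "f \<in> (\<lambda>p x. p x *\<^sub>R A) ` span G" using f by blast
  also have "\<dots> = span ((\<lambda>p x. p x *\<^sub>R A) ` G)" by (rule linear_span_image[OF lin, symmetric])
  also have "\<dots> \<subseteq> span ?G" using f(3) by (intro span_mono) auto
  finally show "f \<in> span ?G" .
next
  fix f assume "f \<in> ?G"
  then show "f \<in> span {(\<lambda>x. p x *\<^sub>R A) | p A. p \<in> span G \<and> A \<in> W}"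
    using span_base by (intro span_base) blast
qed

lemma field_tensor_comb:
  assumes "finite I" "subspace W"
  shows "field_tensor (span (\<beta> ` I)) W = comb \<beta> I (\<lambda>_. W)"
proof -
  have "{(\<lambda>x. g x *\<^sub>R A) | g A. g \<in> \<beta> ` I \<and> A \<in> W} = {(\<lambda>x. \<beta> \<alpha> x *\<^sub>R A) | \<alpha> A. \<alpha> \<in> I \<and> A \<in> W}"
    by blast
  then show ?thesis
    unfolding field_tensor_span
    using span_eq_comb[OF assms(1), of "\<lambda>_. W" "\<lambda>_. W" \<beta>] assms(2) by (simp add: span_eq_iff)
qed

text \<open>Used to remove the exponents with trivial coefficient space, namely vertices for the
  tangential and the full simplex for the normal part.\<close>

lemma comb_restrict:
  assumes "finite I" "J \<subseteq> I" and z: "\<And>\<alpha>. \<alpha> \<in> I - J \<Longrightarrow> W \<alpha> = {0}"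
  shows "comb \<beta> I W = comb \<beta> J W"
proof (intro equalityI subsetI)
  fix f assume "f \<in> comb \<beta> I W"
  then obtain A where f: "f = (\<lambda>x. \<Sum>\<alpha>\<in>I. \<beta> \<alpha> x *\<^sub>R A \<alpha>)" "\<forall>\<alpha>\<in>I. A \<alpha> \<in> W \<alpha>"
    unfolding comb_def by blast
  then have "f = (\<lambda>x. \<Sum>\<alpha>\<in>J. \<beta> \<alpha> x *\<^sub>R A \<alpha>)"
    using assms by (auto simp: fun_eq_iff intro!: sum.mono_neutral_right)
  then show "f \<in> comb \<beta> J W" unfolding comb_def using f(2) assms(2) by blast
next
  fix f assume "f \<in> comb \<beta> J W"
  then obtain A where f: "f = (\<lambda>x. \<Sum>\<alpha>\<in>J. \<beta> \<alpha> x *\<^sub>R A \<alpha>)" "\<forall>\<alpha>\<in>J. A \<alpha> \<in> W \<alpha>"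
    unfolding comb_def by blast
  let ?A = "\<lambda>\<alpha>. if \<alpha> \<in> J then A \<alpha> else 0"
  have "f = (\<lambda>x. \<Sum>\<alpha>\<in>I. \<beta> \<alpha> x *\<^sub>R ?A \<alpha>)"
    using assms(1,2) unfolding f(1) by (auto simp: fun_eq_iff intro!: sum.mono_neutral_cong_left)
  moreover have "\<forall>\<alpha>\<in>I. ?A \<alpha> \<in> W \<alpha>" using f(2) z by auto
  ultimately show "f \<in> comb \<beta> I W" unfolding comb_def by (intro CollectI exI[of _ ?A] conjI)
qed

lemma sum_comb_grouped:
  fixes \<iota> :: "'a \<Rightarrow> 'j"
  assumes "finite J" "finite I" "\<iota> ` I \<subseteq> J"
  shows "(\<Sum>j\<in>J. (\<lambda>x. \<Sum>\<alpha>\<in>{\<alpha> \<in> I. \<iota> \<alpha> = j}. \<beta> \<alpha> x *\<^sub>R A j \<alpha>))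
    = (\<lambda>x. \<Sum>\<alpha>\<in>I. \<beta> \<alpha> x *\<^sub>R A (\<iota> \<alpha>) \<alpha>)"
proof
  fix x
  have "(\<Sum>j\<in>J. \<Sum>\<alpha>\<in>{\<alpha> \<in> I. \<iota> \<alpha> = j}. \<beta> \<alpha> x *\<^sub>R A j \<alpha>)
    = (\<Sum>j\<in>J. \<Sum>\<alpha>\<in>{\<alpha> \<in> I. \<iota> \<alpha> = j}. \<beta> \<alpha> x *\<^sub>R A (\<iota> \<alpha>) \<alpha>)"
    by (intro sum.cong) auto
  also have "\<dots> = (\<Sum>\<alpha>\<in>I. \<beta> \<alpha> x *\<^sub>R A (\<iota> \<alpha>) \<alpha>)"
    using assms by (intro sum.group) auto
  finally show "(\<Sum>j\<in>J. (\<lambda>x. \<Sum>\<alpha>\<in>{\<alpha> \<in> I. \<iota> \<alpha> = j}. \<beta> \<alpha> x *\<^sub>R A j \<alpha>)) x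
    = (\<Sum>\<alpha>\<in>I. \<beta> \<alpha> x *\<^sub>R A (\<iota> \<alpha>) \<alpha>)" by simp
qed

text \<open>Here \<iota> sends an exponent to the summand that owns it; as every exponent has one
  owner, coefficient choices for the summands merge into one global choice.\<close>

lemma family_sum_comb:
  fixes \<iota> :: "'a \<Rightarrow> 'j"
  assumes "finite J" "finite I" "\<iota> ` I \<subseteq> J"
    and S: "\<And>j. j \<in> J \<Longrightarrow> S j = comb \<beta> {\<alpha> \<in> I. \<iota> \<alpha> = j} (\<lambda>_. W j)"
  shows "family_sum J S = comb \<beta> I (\<lambda>\<alpha>. W (\<iota> \<alpha>))"
proof (intro equalityI subsetI)
  fix f assume "f \<in> family_sum J S"
  then obtain u where u: "f = (\<Sum>j\<in>J. u j)" "\<forall>j\<in>J. u j \<in> S j" unfolding family_sum_def by blast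
  then have "\<forall>j\<in>J. \<exists>A. u j = (\<lambda>x. \<Sum>\<alpha>\<in>{\<alpha> \<in> I. \<iota> \<alpha> = j}. \<beta> \<alpha> x *\<^sub>R A \<alpha>) \<and>
    (\<forall>\<alpha>\<in>{\<alpha> \<in> I. \<iota> \<alpha> = j}. A \<alpha> \<in> W j)"
    unfolding comb_def S[symmetric] using S unfolding comb_def by auto
  then obtain A where A: "\<And>j. j \<in> J \<Longrightarrow> u j = (\<lambda>x. \<Sum>\<alpha>\<in>{\<alpha> \<in> I. \<iota> \<alpha> = j}. \<beta> \<alpha> x *\<^sub>R A j \<alpha>)"
    "\<And>j \<alpha>. j \<in> J \<Longrightarrow> \<alpha> \<in> I \<Longrightarrow> \<iota> \<alpha> = j \<Longrightarrow> A j \<alpha> \<in> W j"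
    unfolding bchoice_iff by blast
  have "f = (\<lambda>x. \<Sum>\<alpha>\<in>I. \<beta> \<alpha> x *\<^sub>R A (\<iota> \<alpha>) \<alpha>)"
    unfolding u(1) sum_comb_grouped[OF assms(1-3), symmetric] using A(1) by (rule sum.cong[OF refl])
  then show "f \<in> comb \<beta> I (\<lambda>\<alpha>. W (\<iota> \<alpha>))" unfolding comb_def using A(2) assms(3)
    by (intro CollectI exI[of _ "\<lambda>\<alpha>. A (\<iota> \<alpha>) \<alpha>"]) auto
next
  fix f assume "f \<in> comb \<beta> I (\<lambda>\<alpha>. W (\<iota> \<alpha>))"
  then obtain A where f: "f = (\<lambda>x. \<Sum>\<alpha>\<in>I. \<beta> \<alpha> x *\<^sub>R A \<alpha>)" "\<forall>\<alpha>\<in>I. A \<alpha> \<in> W (\<iota> \<alpha>)"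
    unfolding comb_def by blast
  let ?u = "\<lambda>j x. \<Sum>\<alpha>\<in>{\<alpha> \<in> I. \<iota> \<alpha> = j}. \<beta> \<alpha> x *\<^sub>R A \<alpha>"
  have "f = (\<Sum>j\<in>J. ?u j)" unfolding f(1) by (rule sum_comb_grouped[OF assms(1-3), symmetric])
  moreover have "\<forall>j\<in>J. ?u j \<in> S j" using f(2) S unfolding comb_def by auto
  ultimately show "f \<in> family_sum J S"
    unfolding family_sum_def by (intro CollectI exI[of _ ?u] conjI)
qed

text \<open>In a vanishing sum each exponent occurs only in the summand that owns it, so
  independence forces every coefficient to be 0.\<close>

lemma direct_family_comb:
  fixes \<iota> :: "'a \<Rightarrow> 'j" and S :: "'j \<Rightarrow> ('x \<Rightarrow> 'b \<Rightarrow> 'c \<Rightarrow> real) set"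
  assumes "finite J" "finite I" "\<iota> ` I \<subseteq> J"
    and S: "\<And>j. j \<in> J \<Longrightarrow> S j = comb \<beta> {\<alpha> \<in> I. \<iota> \<alpha> = j} (\<lambda>_. W j)"
    and ind: "indep_on \<beta> I UNIV"
  shows "direct_family J S"
  unfolding direct_family_def
proof (intro allI impI, elim conjE)
  fix u assume u: "\<forall>j\<in>J. u j \<in> S j" "(\<Sum>j\<in>J. u j) = 0"
  then have "\<forall>j\<in>J. \<exists>A. u j = (\<lambda>x. \<Sum>\<alpha>\<in>{\<alpha> \<in> I. \<iota> \<alpha> = j}. \<beta> \<alpha> x *\<^sub>R A \<alpha>)"
    using S unfolding comb_def by auto
  then obtain A where A: "\<And>j. j \<in> J \<Longrightarrow> u j = (\<lambda>x. \<Sum>\<alpha>\<in>{\<alpha> \<in> I. \<iota> \<alpha> = j}. \<beta> \<alpha> x *\<^sub>R A j \<alpha>)"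
    unfolding bchoice_iff by blast
  have "(\<Sum>j\<in>J. u j) = (\<lambda>x. \<Sum>\<alpha>\<in>I. \<beta> \<alpha> x *\<^sub>R A (\<iota> \<alpha>) \<alpha>)"
    unfolding sum_comb_grouped[OF assms(1-3), symmetric] using A(1) by (rule sum.cong[OF refl])
  with u(2) have "(\<lambda>x. \<Sum>\<alpha>\<in>I. \<beta> \<alpha> x *\<^sub>R A (\<iota> \<alpha>) \<alpha>) = 0" by simp
  then have "(\<Sum>\<alpha>\<in>I. \<beta> \<alpha> x *\<^sub>R A (\<iota> \<alpha>) \<alpha>) = 0" for x by (rule fun_cong[THEN trans]) simp
  then have "A (\<iota> \<alpha>) \<alpha> = 0" if "\<alpha> \<in> I" for \<alpha>
    using indep_on_forms[OF ind, of "\<lambda>\<alpha>. A (\<iota> \<alpha>) \<alpha>" \<alpha>] that by simp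
  then show "\<forall>j\<in>J. u j = 0" using A by (auto simp: fun_eq_iff intro!: sum.neutral)
qed

lemma dim_comb:
  fixes W :: "'a \<Rightarrow> ('b \<Rightarrow> 'c \<Rightarrow> real) set"
  assumes I: "finite I" and ind: "indep_on \<beta> I UNIV"
    and W: "\<And>\<alpha>. \<alpha> \<in> I \<Longrightarrow> span (G \<alpha>) = W \<alpha>"
    and G: "\<And>\<alpha>. \<alpha> \<in> I \<Longrightarrow> independent (G \<alpha>)" "\<And>\<alpha>. \<alpha> \<in> I \<Longrightarrow> finite (G \<alpha>)"
  shows "dim (comb \<beta> I W) = (\<Sum>\<alpha>\<in>I. card (G \<alpha>))"
proof -
  let ?P = "SIGMA \<alpha>:I. G \<alpha>" and ?g = "\<lambda>(\<alpha>, A) x. \<beta> \<alpha> x *\<^sub>R A"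
  have fin: "finite ?P" using I G by auto
  have z: "\<forall>p\<in>?P. c p = 0" if c: "(\<Sum>p\<in>?P. c p *\<^sub>R ?g p) = 0" for c
  proof -
    have "(\<Sum>\<alpha>\<in>I. \<beta> \<alpha> x *\<^sub>R (\<Sum>A\<in>G \<alpha>. c (\<alpha>, A) *\<^sub>R A)) = 0" for x
    proof -
      have "(\<Sum>p\<in>?P. c p *\<^sub>R ?g p) x = (\<Sum>\<alpha>\<in>I. \<Sum>A\<in>G \<alpha>. c (\<alpha>, A) *\<^sub>R \<beta> \<alpha> x *\<^sub>R A)"
        using I G by (simp add: sum.Sigma case_prod_unfold)
      then show ?thesis using c by (simp add: scaleR_sum_right mult.commute)
    qed
    then have "(\<Sum>A\<in>G \<alpha>. c (\<alpha>, A) *\<^sub>R A) = 0" if "\<alpha> \<in> I" for \<alpha>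
      using indep_on_forms[OF ind, of "\<lambda>\<alpha>. \<Sum>A\<in>G \<alpha>. c (\<alpha>, A) *\<^sub>R A" \<alpha>] that by simp
    then have "c (\<alpha>, A) = 0" if "\<alpha> \<in> I" "A \<in> G \<alpha>" for \<alpha> A
      using independentD[OF G(1), of \<alpha> "G \<alpha>" "\<lambda>A. c (\<alpha>, A)" A] G(2) that by blast
    then show ?thesis by auto
  qed
  from independent_family[OF fin, of ?g, OF z]
  have inj: "inj_on ?g ?P" and ig: "independent (?g ` ?P)" by blast+
  have "?g ` ?P = {(\<lambda>x. \<beta> \<alpha> x *\<^sub>R A) | \<alpha> A. \<alpha> \<in> I \<and> A \<in> G \<alpha>}" by force
  then have "comb \<beta> I W = span (?g ` ?P)" using span_eq_comb[where G = G and W = W and \<beta> = \<beta>, OF I W] by simp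
  then have "dim (comb \<beta> I W) = card ?P"
    using dim_span_eq_card_independent[OF ig] card_image[OF inj] by simp
  then show ?thesis using I G by simp
qed

text \<open>Exponents vanish outside \<open>S\<close>, so those of a face are literally exponents of
  the simplex, and equal monomials have equal exponents.\<close>

definition exponents :: "'a set \<Rightarrow> nat \<Rightarrow> ('a \<Rightarrow> nat) set" where
  "exponents S r = {\<alpha>. (\<forall>u. u \<notin> S \<longrightarrow> \<alpha> u = 0) \<and> (\<Sum>u\<in>S. \<alpha> u) = r}"

definition supp :: "('a \<Rightarrow> nat) \<Rightarrow> 'a set" where
  "supp \<alpha> = {u. \<alpha> u \<noteq> 0}"

lemma finite_exponents:
  assumes "finite S"
  shows "finite (exponents S r)"
proof (rule finite_subset)
  show "exponents S r \<subseteq> {\<alpha>. \<forall>u. (u \<in> S \<longrightarrow> \<alpha> u \<in> {..r}) \<and> (u \<notin> S \<longrightarrow> \<alpha> u = 0)}"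
    using member_le_sum[OF _ _ assms] by (fastforce simp: exponents_def)
  show "finite {\<alpha>. \<forall>u. (u \<in> S \<longrightarrow> \<alpha> u \<in> {..r}) \<and> (u \<notin> S \<longrightarrow> \<alpha> u = 0)}"
    using assms by (intro finite_set_of_finite_funs) auto
qed

lemma exponents_mono:
  assumes "S \<subseteq> V" "finite V"
  shows "\<alpha> \<in> exponents S r \<longleftrightarrow> \<alpha> \<in> exponents V r \<and> supp \<alpha> \<subseteq> S"
proof -
  have "(\<Sum>u\<in>S. \<alpha> u) = (\<Sum>u\<in>V. \<alpha> u)" if "\<forall>u. u \<notin> S \<longrightarrow> \<alpha> u = 0"
    using that assms by (intro sum.mono_neutral_left) auto
  moreover have "supp \<alpha> \<subseteq> S \<longleftrightarrow> (\<forall>u. u \<notin> S \<longrightarrow> \<alpha> u = 0)" by (auto simp: supp_def)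
  moreover have "\<forall>u. u \<notin> V \<longrightarrow> \<alpha> u = 0" if "\<forall>u. u \<notin> S \<longrightarrow> \<alpha> u = 0"
    using that assms(1) by blast
  ultimately show ?thesis
    by (cases "\<forall>u. u \<notin> S \<longrightarrow> \<alpha> u = 0") (simp_all add: exponents_def)
qed

text \<open>Stars and bars: lowering each of the l+1 positive entries by 1 leaves an arbitrary tuple
  of sum r-l-1. For r < l+1 both sides are 0.\<close>

lemma card_exponents_supp:
  assumes S: "finite S" "card S = Suc l" and r: "r \<ge> 1"
  shows "card {\<alpha> \<in> exponents S r. supp \<alpha> = S} = (r - 1) choose l"
proof -
  obtain xs where xs: "set xs = S" "distinct xs" using finite_distinct_list[OF S(1)] by blast
  then have len: "length xs = Suc l" using S(2) distinct_card by fastforce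
  let ?E = "{\<alpha> \<in> exponents S r. supp \<alpha> = S}" and ?h = "\<lambda>\<alpha>. map (\<lambda>u. \<alpha> u - 1) xs"
  have ES: "(\<Sum>u\<in>S. \<alpha> u) = (\<Sum>u\<in>S. \<alpha> u - 1) + Suc l" if "\<forall>u\<in>S. \<alpha> u \<noteq> 0" for \<alpha> :: "'a \<Rightarrow> nat"
  proof -
    have "(\<Sum>u\<in>S. \<alpha> u) = (\<Sum>u\<in>S. (\<alpha> u - 1) + 1)" using that by (intro sum.cong) auto
    then show ?thesis using S by (simp only: sum.distrib) simp
  qed
  have sl: "sum_list (?h \<alpha>) = (\<Sum>u\<in>S. \<alpha> u - 1)" for \<alpha> :: "'a \<Rightarrow> nat"
    using xs by (simp add: sum_list_distinct_conv_sum_set)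
  show ?thesis
  proof (cases "Suc l \<le> r")
    case False
    then have "?E = {}" using ES by (fastforce simp: exponents_def supp_def)
    moreover have "(r - 1) choose l = 0" using False r by (intro binomial_eq_0) simp
    ultimately show ?thesis by (simp only: card.empty)
  next
    case True
    have "bij_betw ?h ?E {ys. length ys = Suc l \<and> sum_list ys = r - Suc l}"
      unfolding bij_betw_def
    proof
      show "inj_on ?h ?E"
      proof (rule inj_onI, rule ext)
        fix \<alpha> \<gamma> u assume a: "\<alpha> \<in> ?E" "\<gamma> \<in> ?E" "?h \<alpha> = ?h \<gamma>"
        show "\<alpha> u = \<gamma> u"
        proof (cases "u \<in> S")
          case True
          then have "\<alpha> u \<noteq> 0" "\<gamma> u \<noteq> 0" "\<alpha> u - 1 = \<gamma> u - 1" using a xs(1) by (auto simp: supp_def)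
          then show ?thesis by simp
        qed (use a in \<open>auto simp: exponents_def\<close>)
      qed
      show "?h ` ?E = {ys. length ys = Suc l \<and> sum_list ys = r - Suc l}"
      proof (intro equalityI subsetI)
        fix ys assume "ys \<in> ?h ` ?E"
        then obtain \<alpha> where \<alpha>: "\<alpha> \<in> ?E" "ys = ?h \<alpha>" by blast
        then have "r = (\<Sum>u\<in>S. \<alpha> u - 1) + Suc l" using ES[of \<alpha>] by (auto simp: exponents_def supp_def)
        then show "ys \<in> {ys. length ys = Suc l \<and> sum_list ys = r - Suc l}"
          using \<alpha>(2) sl[of \<alpha>] len by simp
      next
        fix ys :: "nat list" assume "ys \<in> {ys. length ys = Suc l \<and> sum_list ys = r - Suc l}"
        then have ys: "length ys = length xs" "sum_list ys = r - Suc l" using len by auto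
        \<comment> \<open>The inverse of \<open>?h\<close>: the entries of \<open>ys\<close> are
          raised by 1 again, and everything outside \<open>xs\<close> gets 0.\<close>
        define \<alpha> where "\<alpha> u = (case map_of (zip xs ys) u of None \<Rightarrow> 0 | Some y \<Rightarrow> Suc y)" for u
        have \<alpha>0: "\<alpha> u = 0" if "u \<notin> S" for u
        proof -
          have "u \<notin> set xs" using that xs(1) by simp
          then have "map_of (zip xs ys) u = None" using ys(1) by simp
          then show ?thesis by (simp add: \<alpha>_def)
        qed
        have \<alpha>n: "\<alpha> (xs ! i) = Suc (ys ! i)" if "i < length xs" for i
          using map_of_zip_nth[OF ys(1)[symmetric] xs(2), of i] that ys(1) by (simp add: \<alpha>_def)
        have \<alpha>1: "\<alpha> u \<noteq> 0" if "u \<in> S" for u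
          using \<alpha>n that xs(1) by (metis in_set_conv_nth nat.simps(3))
        have h: "?h \<alpha> = ys" by (rule nth_equalityI) (use ys \<alpha>n in auto)
        then have "(\<Sum>u\<in>S. \<alpha> u) = r" using ES[of \<alpha>] \<alpha>1 sl[of \<alpha>] ys(2) True by simp
        moreover have "supp \<alpha> = S"
        proof (rule set_eqI)
          show "u \<in> supp \<alpha> \<longleftrightarrow> u \<in> S" for u
            using \<alpha>0[of u] \<alpha>1[of u] by (cases "u \<in> S") (simp_all add: supp_def)
        qed
        ultimately have "\<alpha> \<in> ?E" using \<alpha>0 by (simp add: exponents_def)
        then show "ys \<in> ?h ` ?E" using h by blast
      qed
    qed
    then have "card ?E = (r - Suc l + Suc l - 1) choose (r - Suc l)"
      using bij_betw_same_card[of ?h ?E] card_length_sum_list[of "Suc l" "r - Suc l"] by simp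
    also have "\<dots> = (r - 1) choose l"
    proof -
      have "r - 1 - l = r - Suc l" "r - Suc l + Suc l - 1 = r - 1" "l \<le> r - 1" using True by simp_all
      then show ?thesis using binomial_symmetric[of l "r - 1"] by presburger
    qed
    finally show ?thesis .
  qed
qed

section \<open>The Bernstein basis\<close>

lemma span_mult:
  fixes h :: "'x \<Rightarrow> real"
  assumes "\<And>g. g \<in> G \<Longrightarrow> (\<lambda>x. h x * g x) \<in> span H" "p \<in> span G"
  shows "(\<lambda>x. h x * p x) \<in> span H"
proof -
  have lin: "linear (\<lambda>p x. h x * p x)"
    by (rule linearI) (simp_all add: fun_eq_iff algebra_simps)
  have "(\<lambda>x. h x * p x) \<in> (\<lambda>p x. h x * p x) ` span G" using assms(2) by blast
  also have "\<dots> = span ((\<lambda>p x. h x * p x) ` G)" by (rule linear_span_image[OF lin, symmetric])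
  also have "\<dots> \<subseteq> span H" using assms(1) by (intro span_minimal subspace_span) auto
  finally show ?thesis .
qed

lemma Poly_mono: "d \<le> d' \<Longrightarrow> Poly d \<subseteq> Poly d'"
  unfolding Poly_def by (intro span_mono) auto

lemma Poly_mult_coord:
  fixes p :: "real^'n::finite \<Rightarrow> real"
  assumes "p \<in> Poly d"
  shows "(\<lambda>x. x $ j * p x) \<in> Poly (Suc d)"
  unfolding Poly_def
proof (rule span_mult[OF _ assms[unfolded Poly_def]])
  fix g assume "g \<in> {\<lambda>x::real^'n. \<Prod>j\<in>UNIV. x $ j ^ a j |a. sum a UNIV \<le> d}"
  then obtain a where a: "g = (\<lambda>x. \<Prod>j\<in>UNIV. x $ j ^ a j)" "sum a UNIV \<le> d" by blast
  let ?a = "a(j := Suc (a j))"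
  have "(\<lambda>x. x $ j * g x) = (\<lambda>x. \<Prod>i\<in>UNIV. x $ i ^ ?a i)"
    unfolding a by (simp add: fun_eq_iff prod.remove[of UNIV j])
  moreover have "sum ?a UNIV \<le> Suc d"
    using a(2) by (simp add: sum.remove[of UNIV j])
  ultimately show "(\<lambda>x. x $ j * g x)
    \<in> span {\<lambda>x::real^'n. \<Prod>j\<in>UNIV. x $ j ^ a j |a. sum a UNIV \<le> Suc d}"
    by (intro span_base) blast
qed

text \<open>By uniqueness it suffices that the right-hand sides, taken over all vertices, are affine
  coordinates of \<open>x\<close>; both required sums follow from those at 0 and at the unit
  vectors.\<close>

lemma (in full_simplex) L_affine:
  "L v x = L v 0 + (\<Sum>j\<in>UNIV. x $ j * (L v (axis j 1) - L v 0))" if "v \<in> V"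
proof (rule L_eq[OF _ _ that])
  show "(\<Sum>u\<in>V. L u 0 + (\<Sum>j\<in>UNIV. x $ j * (L u (axis j 1) - L u 0))) = 1"
    unfolding sum.distrib sum.swap[of _ UNIV]
    by (simp add: sum_L sum_distrib_left[symmetric] sum_subtractf)
  have "(\<Sum>u\<in>V. (L u 0 + (\<Sum>j\<in>UNIV. x $ j * (L u (axis j 1) - L u 0))) *\<^sub>R u)
    = (\<Sum>u\<in>V. L u 0 *\<^sub>R u) + (\<Sum>j\<in>UNIV. x $ j *\<^sub>R ((\<Sum>u\<in>V. L u (axis j 1) *\<^sub>R u) - (\<Sum>u\<in>V. L u 0 *\<^sub>R u)))"
    unfolding scaleR_add_left sum.distrib scaleR_sum_left sum.swap[of _ UNIV]
    by (simp add: scaleR_sum_right sum_subtractf[symmetric] scaleR_diff_left scaleR_diff_right right_diff_distrib)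
  also have "\<dots> = x"
    by (simp add: sum_L_scaleR vec_eq_iff axis_def if_distrib cong: if_cong)
  finally show "(\<Sum>u\<in>V. (L u 0 + (\<Sum>j\<in>UNIV. x $ j * (L u (axis j 1) - L u 0))) *\<^sub>R u) = x" .
qed

context full_simplex
begin

definition bern :: "(real^'n \<Rightarrow> nat) \<Rightarrow> real^'n \<Rightarrow> real" where
  "bern \<alpha> x = (\<Prod>v\<in>V. L v x ^ \<alpha> v)"

lemma bern_Suc:
  assumes "v \<in> V"
  shows "bern (\<alpha>(v := Suc (\<alpha> v))) x = L v x * bern \<alpha> x"
  unfolding bern_def using assms by (simp add: prod.remove[of V v])

lemma bern_in_Poly: "(\<Sum>v\<in>V. \<alpha> v) = d \<Longrightarrow> bern \<alpha> \<in> Poly d"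
proof (induction d arbitrary: \<alpha>)
  case 0
  then have "bern \<alpha> = (\<lambda>x. \<Prod>j\<in>UNIV. x $ j ^ (\<lambda>_. 0) j)" by (simp add: bern_def fun_eq_iff)
  then show ?case unfolding Poly_def by (intro span_base) force
next
  case (Suc d)
  then have "(\<Sum>v\<in>V. \<alpha> v) \<noteq> 0" by simp
  then obtain v where v: "v \<in> V" "\<alpha> v \<noteq> 0" by (meson sum.neutral)
  let ?\<alpha> = "\<alpha>(v := \<alpha> v - 1)"
  have "(\<Sum>u\<in>V. ?\<alpha> u) = d" using Suc.prems v by (simp add: sum.remove[of V v])
  from Suc.IH[OF this] have P: "bern ?\<alpha> \<in> Poly d" .
  have "?\<alpha>(v := Suc (?\<alpha> v)) = \<alpha>" using v by simp
  with bern_Suc[OF v(1), of ?\<alpha>] have "bern \<alpha> = (\<lambda>x. L v x * bern ?\<alpha> x)"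
    by (metis ext)
  also have "\<dots> = L v 0 *\<^sub>R bern ?\<alpha> + (\<Sum>j\<in>UNIV. (L v (axis j 1) - L v 0) *\<^sub>R (\<lambda>x. x $ j * bern ?\<alpha> x))"
    by (subst L_affine[OF v(1)])
      (simp add: fun_eq_iff distrib_left sum_distrib_left mult.assoc mult.commute mult.left_commute)
  also have "\<dots> \<in> Poly (Suc d)"
    using P Poly_mono[of d "Suc d"] Poly_mult_coord[OF P] unfolding Poly_def
    by (intro span_add span_scale span_sum) auto
  finally show ?case .
qed

text \<open>\<open>c\<close> lists the vertex values of an affine function. The choice 1 gives
  degree elevation, as the barycentric coordinates sum to 1; the choice \<open>v $ j\<close> gives
  multiplication by a coordinate.\<close>

lemma Bernstein_mult_affine:
  assumes "p \<in> span (bern ` exponents V d)"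
  shows "(\<lambda>x. (\<Sum>v\<in>V. L v x * c v) * p x) \<in> span (bern ` exponents V (Suc d))"
proof -
  have "(\<lambda>x. L v x * p x) \<in> span (bern ` exponents V (Suc d))" if v: "v \<in> V" for v
  proof (rule span_mult[OF _ assms])
    fix g assume "g \<in> bern ` exponents V d"
    then obtain \<alpha> where \<alpha>: "g = bern \<alpha>" "\<alpha> \<in> exponents V d" by blast
    have "\<alpha>(v := Suc (\<alpha> v)) \<in> exponents V (Suc d)"
      using \<alpha>(2) v by (auto simp: exponents_def sum.remove[of V v])
    moreover have "(\<lambda>x. L v x * g x) = bern (\<alpha>(v := Suc (\<alpha> v)))"
      unfolding \<alpha>(1) using bern_Suc[OF v] by (simp add: fun_eq_iff)
    ultimately show "(\<lambda>x. L v x * g x) \<in> span (bern ` exponents V (Suc d))"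
      by (simp add: span_base)
  qed
  then have "(\<Sum>v\<in>V. c v *\<^sub>R (\<lambda>x. L v x * p x)) \<in> span (bern ` exponents V (Suc d))"
    by (intro span_sum span_scale)
  moreover have "(\<Sum>v\<in>V. c v *\<^sub>R (\<lambda>x. L v x * p x)) = (\<lambda>x. (\<Sum>v\<in>V. L v x * c v) * p x)"
    by (simp add: fun_eq_iff sum_distrib_left mult.assoc mult.commute mult.left_commute)
  ultimately show ?thesis by simp
qed

lemma Bernstein_Suc: "span (bern ` exponents V d) \<subseteq> span (bern ` exponents V (Suc d))"
  using Bernstein_mult_affine[of _ d "\<lambda>_. 1"] by (auto simp: sum_L)

lemma monomial_in_Bernstein:
  "(\<Sum>j\<in>UNIV. a j) = d \<Longrightarrow> (\<lambda>x. \<Prod>j\<in>UNIV. x $ j ^ a j) \<in> span (bern ` exponents V d)"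
proof (induction d arbitrary: a)
  case 0
  have "(\<lambda>x. \<Prod>j\<in>UNIV. x $ j ^ a j) = bern (\<lambda>_. 0)" using 0 by (simp add: bern_def fun_eq_iff)
  moreover have "(\<lambda>_. 0) \<in> exponents V 0" by (simp add: exponents_def)
  ultimately show ?case by (simp add: span_base)
next
  case (Suc d)
  then have "(\<Sum>j\<in>UNIV. a j) \<noteq> 0" by simp
  then obtain j where j: "a j \<noteq> 0" by (meson sum.neutral)
  let ?a = "a(j := a j - 1)"
  have "(\<Sum>i\<in>UNIV. ?a i) = d" using Suc.prems j by (simp add: sum.remove[of UNIV j])
  from Bernstein_mult_affine[OF Suc.IH[OF this], of "\<lambda>v. v $ j"]
  have "(\<lambda>x. (\<Sum>v\<in>V. L v x * v $ j) * (\<Prod>i\<in>UNIV. x $ i ^ ?a i)) \<in> span (bern ` exponents V (Suc d))" .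
  moreover have "(\<Sum>v\<in>V. L v x * v $ j) = x $ j" for x
    using arg_cong[OF sum_L_scaleR[of x], of "\<lambda>y. y $ j"] by simp
  moreover have "x $ j * (\<Prod>i\<in>UNIV. x $ i ^ ?a i) = (\<Prod>i\<in>UNIV. x $ i ^ a i)" for x :: "real^'n"
  proof -
    have "(\<Prod>i\<in>UNIV. x $ i ^ ?a i) = x $ j ^ (a j - 1) * (\<Prod>i\<in>UNIV - {j}. x $ i ^ a i)"
      by (simp add: prod.remove[of UNIV j])
    moreover have "(\<Prod>i\<in>UNIV. x $ i ^ a i) = x $ j ^ a j * (\<Prod>i\<in>UNIV - {j}. x $ i ^ a i)"
      by (simp add: prod.remove[of UNIV j])
    moreover have "x $ j ^ a j = x $ j * x $ j ^ (a j - 1)" using j by (cases "a j") simp_all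
    ultimately show ?thesis by simp
  qed
  ultimately show ?case by simp
qed

lemma Poly_eq_Bernstein: "Poly r = span (bern ` exponents V r)"
proof
  have up: "span (bern ` exponents V d) \<subseteq> span (bern ` exponents V r)" if "d \<le> r" for d
    using that Bernstein_Suc by (induction rule: dec_induct) blast+
  show "Poly r \<subseteq> span (bern ` exponents V r)"
    unfolding Poly_def using monomial_in_Bernstein up by (intro span_minimal subspace_span) blast
  show "span (bern ` exponents V r) \<subseteq> Poly r"
    unfolding Poly_def using bern_in_Poly unfolding Poly_def
    by (intro span_minimal subspace_span) (auto simp: exponents_def)
qed

text \<open>Dividing positive values \<open>t\<close> by their sum \<open>s\<close> gives
  barycentric coordinates of a point of the face, and homogeneity then reduces the claim to
  monomials in \<open>t\<close>.\<close>

lemma indep_bern_face: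
  assumes S: "S \<subseteq> V" "S \<noteq> {}"
  shows "indep_on bern (exponents S r) (convex hull S)"
  unfolding indep_on_def
proof (intro allI impI ballI)
  fix c \<alpha> assume c: "\<forall>x\<in>convex hull S. (\<Sum>\<alpha>\<in>exponents S r. bern \<alpha> x * c \<alpha>) = 0"
    and \<alpha>: "\<alpha> \<in> exponents S r"
  have fS: "finite S" using finite_subset[OF S(1) finite_V] .
  show "c \<alpha> = 0"
  proof (rule monomials_independent[of S "exponents S r"])
    fix t :: "real^'n \<Rightarrow> real" assume t: "\<And>u. u \<in> S \<Longrightarrow> 0 < t u"
    show "(\<Sum>\<alpha>\<in>exponents S r. c \<alpha> * (\<Prod>u\<in>S. t u ^ \<alpha> u)) = 0"
    proof -
      define s where "s = (\<Sum>u\<in>S. t u)"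
      have s: "s > 0" unfolding s_def using S(2) fS t by (intro sum_pos)
      define a where "a u = (if u \<in> S then t u / s else 0)" for u
      define x where "x = (\<Sum>u\<in>V. a u *\<^sub>R u)"
      have aS: "(\<Sum>u\<in>S. a u) = 1" using s by (simp add: a_def sum_divide_distrib[symmetric] s_def[symmetric])
      have a1: "(\<Sum>u\<in>V. a u) = 1"
        unfolding aS[symmetric] using S by (intro sum.mono_neutral_right) (auto simp: a_def)
      have xS: "x = (\<Sum>u\<in>S. a u *\<^sub>R u)"
        unfolding x_def using S by (intro sum.mono_neutral_right) (auto simp: a_def)
      have "x \<in> convex hull S"
        unfolding convex_hull_finite[OF fS] using aS xS t s
        by (intro CollectI exI[of _ a]) (auto simp: a_def less_imp_le)
      then have z: "(\<Sum>\<alpha>\<in>exponents S r. bern \<alpha> x * c \<alpha>) = 0" using c by blast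
      \<comment> \<open>All exponents have the same total \<open>r\<close>, so the scaling
        contributes one common nonzero factor.\<close>
      have m: "bern \<gamma> x = (1 / s) ^ r * (\<Prod>u\<in>S. t u ^ \<gamma> u)" if "\<gamma> \<in> exponents S r" for \<gamma>
      proof -
        have "bern \<gamma> x = (\<Prod>u\<in>V. a u ^ \<gamma> u)"
          unfolding bern_def using L_eq[OF a1 x_def[symmetric]] by simp
        also have "\<dots> = (\<Prod>u\<in>S. a u ^ \<gamma> u)"
          using S that by (intro prod.mono_neutral_right) (auto simp: exponents_def)
        also have "\<dots> = (\<Prod>u\<in>S. (1 / s) ^ \<gamma> u * t u ^ \<gamma> u)"
          by (intro prod.cong) (simp_all add: a_def power_mult_distrib[symmetric])
        also have "\<dots> = (1 / s) ^ r * (\<Prod>u\<in>S. t u ^ \<gamma> u)"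
          using that by (simp add: prod.distrib power_sum[symmetric] exponents_def)
        finally show ?thesis .
      qed
      have "(1 / s) ^ r * (\<Sum>\<alpha>\<in>exponents S r. c \<alpha> * (\<Prod>u\<in>S. t u ^ \<alpha> u)) = 0"
        using z m by (simp add: sum_distrib_left mult.assoc mult.commute mult.left_commute)
      then show ?thesis using s by simp
    qed
  qed (use \<alpha> fS finite_exponents[OF fS] in \<open>auto simp: exponents_def\<close>)
qed

end

section \<open>Bubble spaces and their sums\<close>

lemma supp_subset: "\<alpha> \<in> exponents V r \<Longrightarrow> supp \<alpha> \<subseteq> V"
  by (auto simp: exponents_def supp_def)

lemma supp_ne_empty:
  assumes "\<alpha> \<in> exponents V r" "r \<ge> 1"
  shows "supp \<alpha> \<noteq> {}"
proof
  assume "supp \<alpha> = {}"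
  then have "\<alpha> u = 0" for u by (auto simp: supp_def)
  then have "(\<Sum>u\<in>V. \<alpha> u) = 0" by simp
  then show False using assms by (simp add: exponents_def)
qed

context full_simplex
begin

lemma indep_bern: "indep_on bern (exponents V r) UNIV"
proof -
  have "V \<noteq> {}" using card_V by auto
  then show ?thesis using indep_bern_face[of V r] unfolding indep_on_def by blast
qed

text \<open>Multiplication by the bubble raises each exponent on \<open>S\<close> by 1, so the
  products are exactly the monomials of degree \<open>r\<close> with full support on
  \<open>S\<close>. If r < l+1, both families of monomials are empty.\<close>

lemma bubble_space_eq:
  assumes S: "S \<subseteq> V" "card S = l + 1" and W: "subspace W"
  shows "bubble_space (convex hull V) r l (convex hull S) W
    = comb bern {\<alpha> \<in> exponents V r. supp \<alpha> = S} (\<lambda>_. W)"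
proof -
  let ?m = "int r - int (l + 1)"
  let ?G = "{(\<lambda>x. \<Prod>v\<in>S. L v x ^ a v) | a. int (\<Sum>v\<in>S. a v) = ?m}"
  let ?B = "\<lambda>x. \<Prod>v\<in>S. L v x"
  have fS: "finite S" using finite_subset[OF S(1) finite_V] .
  have lin: "linear (\<lambda>p x. ?B x * p x)"
    by (rule linearI) (simp_all add: fun_eq_iff algebra_simps)
  have "{(\<lambda>x. bubble (convex hull V) (convex hull S) x * p x) | p.
      p \<in> Bernstein (convex hull V) (convex hull S) ?m} = (\<lambda>p x. ?B x * p x) ` span ?G"
    unfolding Bernstein_def bubble_def verts_hull[OF S(1)] by blast
  also have "\<dots> = span ((\<lambda>p x. ?B x * p x) ` ?G)" by (rule linear_span_image[OF lin, symmetric])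
  also have "(\<lambda>p x. ?B x * p x) ` ?G = bern ` {\<alpha> \<in> exponents V r. supp \<alpha> = S}"
  proof (intro equalityI subsetI)
    fix f assume "f \<in> (\<lambda>p x. ?B x * p x) ` ?G"
    then obtain a where a: "f = (\<lambda>x. ?B x * (\<Prod>v\<in>S. L v x ^ a v))" "int (\<Sum>v\<in>S. a v) = ?m"
      by blast
    define \<alpha> where "\<alpha> v = (if v \<in> S then Suc (a v) else 0)" for v
    have "supp \<alpha> = S" by (auto simp: supp_def \<alpha>_def)
    moreover have "(\<Sum>v\<in>S. \<alpha> v) = r"
    proof -
      have "(\<Sum>v\<in>S. \<alpha> v) = (\<Sum>v\<in>S. a v + 1)" by (intro sum.cong) (auto simp: \<alpha>_def)
      also have "\<dots> = (\<Sum>v\<in>S. a v) + (l + 1)" using S(2) by (simp only: sum.distrib) simp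
      finally show ?thesis using a(2) by linarith
    qed
    then have "\<alpha> \<in> exponents S r" by (simp add: exponents_def \<alpha>_def)
    then have "\<alpha> \<in> exponents V r" using exponents_mono[OF S(1) finite_V] by blast
    moreover have "f = bern \<alpha>"
    proof
      fix x
      have "bern \<alpha> x = (\<Prod>v\<in>S. L v x ^ \<alpha> v)"
        unfolding bern_def using S by (intro prod.mono_neutral_right) (auto simp: \<alpha>_def)
      also have "\<dots> = (\<Prod>v\<in>S. L v x * L v x ^ a v)" by (intro prod.cong) (auto simp: \<alpha>_def)
      finally show "f x = bern \<alpha> x" by (simp add: a(1) prod.distrib)
    qed
    ultimately show "f \<in> bern ` {\<alpha> \<in> exponents V r. supp \<alpha> = S}" by blast
  next
    fix f assume "f \<in> bern ` {\<alpha> \<in> exponents V r. supp \<alpha> = S}"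
    then obtain \<alpha> where \<alpha>: "f = bern \<alpha>" "\<alpha> \<in> exponents V r" "supp \<alpha> = S" by blast
    then have \<alpha>S: "\<alpha> \<in> exponents S r" using exponents_mono[OF S(1) finite_V] by blast
    have n0: "\<alpha> v = Suc (\<alpha> v - 1)" if "v \<in> S" for v using that \<alpha>(3) by (auto simp: supp_def)
    have "r = (\<Sum>v\<in>S. (\<alpha> v - 1) + 1)"
    proof -
      have "(\<Sum>v\<in>S. \<alpha> v) = (\<Sum>v\<in>S. (\<alpha> v - 1) + 1)"
        using n0 by (intro sum.cong refl) (metis Suc_eq_plus1)
      then show ?thesis using \<alpha>S by (simp add: exponents_def)
    qed
    also have "\<dots> = (\<Sum>v\<in>S. \<alpha> v - 1) + (l + 1)" using S(2) by (simp only: sum.distrib) simp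
    finally have "int (\<Sum>v\<in>S. \<alpha> v - 1) = ?m" by linarith
    moreover have "f = (\<lambda>x. ?B x * (\<Prod>v\<in>S. L v x ^ (\<alpha> v - 1)))"
    proof
      fix x
      have "f x = (\<Prod>v\<in>S. L v x ^ \<alpha> v)"
        unfolding \<alpha>(1) bern_def using S \<alpha>S
        by (intro prod.mono_neutral_right) (auto simp: exponents_def)
      also have "\<dots> = (\<Prod>v\<in>S. L v x * L v x ^ (\<alpha> v - 1))"
        by (intro prod.cong refl) (metis n0 power_Suc)
      finally show "f x = ?B x * (\<Prod>v\<in>S. L v x ^ (\<alpha> v - 1))" by (simp add: prod.distrib)
    qed
    ultimately show "f \<in> (\<lambda>p x. ?B x * p x) ` ?G"
      by (intro image_eqI[of _ _ "\<lambda>x. \<Prod>v\<in>S. L v x ^ (\<alpha> v - 1)"] CollectI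
        exI[of _ "\<lambda>v. \<alpha> v - 1"] conjI refl)
  qed
  finally have e: "{(\<lambda>x. bubble (convex hull V) (convex hull S) x * p x) | p.
      p \<in> Bernstein (convex hull V) (convex hull S) ?m} = span (bern ` {\<alpha> \<in> exponents V r. supp \<alpha> = S})" .
  show ?thesis
    unfolding bubble_space_def e
    by (rule field_tensor_comb) (use W finite_exponents[OF finite_V] in auto)
qed

text \<open>The range of dimensions is a parameter because tangential and normal bubbles use
  different ones. A simplex determines its vertices, so distinct faces own disjoint sets of
  exponents.\<close>

lemma bubble_spaces_sum:
  fixes W :: "nat \<Rightarrow> (real^'n) set \<Rightarrow> 'n dform set" and lo hi :: nat
  assumes W: "\<And>l f. subspace (W l f)" and r: "r \<ge> 1"
  defines "J \<equiv> SIGMA l:{lo..hi}. subsimplices l (convex hull V)"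
    and "I \<equiv> {\<alpha> \<in> exponents V r. card (supp \<alpha>) - 1 \<in> {lo..hi}}"
  shows "family_sum J (\<lambda>(l, f). bubble_space (convex hull V) r l f (W l f))
      = comb bern I (\<lambda>\<alpha>. W (card (supp \<alpha>) - 1) (convex hull supp \<alpha>))" (is ?sum)
    and "direct_family J (\<lambda>(l, f). bubble_space (convex hull V) r l f (W l f))" (is ?direct)
proof -
  \<comment> \<open>The face carrying \<alpha>, together with its dimension, which is one less than
    the number of its vertices.\<close>
  define \<iota> where "\<iota> \<alpha> = (card (supp \<alpha>) - 1, convex hull supp \<alpha>)" for \<alpha> :: "real^'n \<Rightarrow> nat"
  have sI: "supp \<alpha> \<subseteq> V" "card (supp \<alpha>) = card (supp \<alpha>) - 1 + 1" if "\<alpha> \<in> exponents V r" for \<alpha>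
  proof -
    show s: "supp \<alpha> \<subseteq> V" using supp_subset[OF that] .
    have "finite (supp \<alpha>)" using finite_subset[OF s finite_V] .
    then have "card (supp \<alpha>) \<noteq> 0" using supp_ne_empty[OF that r] by simp
    then show "card (supp \<alpha>) = card (supp \<alpha>) - 1 + 1" by simp
  qed
  have "finite (subsimplices l (convex hull V))" for l
    unfolding subsimplices_eq by (rule finite_subset[of _ "(\<lambda>S. convex hull S) ` Pow V"]) auto
  then have J: "finite J" unfolding J_def by auto
  have I: "finite I" unfolding I_def using finite_exponents[OF finite_V] by simp
  have \<iota>: "\<iota> ` I \<subseteq> J"
    unfolding \<iota>_def I_def J_def subsimplices_eq using sI by blast
  have S: "(case j of (l, f) \<Rightarrow> bubble_space (convex hull V) r l f (W l f))
      = comb bern {\<alpha> \<in> I. \<iota> \<alpha> = j} (\<lambda>_. case j of (l, f) \<Rightarrow> W l f)" if j: "j \<in> J" for j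
  proof -
    obtain l S where jl: "j = (l, convex hull S)" "l \<in> {lo..hi}" "S \<subseteq> V" "card S = l + 1"
      using j unfolding J_def subsimplices_eq by blast
    have "{\<alpha> \<in> I. \<iota> \<alpha> = j} = {\<alpha> \<in> exponents V r. supp \<alpha> = S}"
    proof (intro Collect_cong iffI)
      fix \<alpha> assume "\<alpha> \<in> I \<and> \<iota> \<alpha> = j"
      then have a: "\<alpha> \<in> exponents V r" "convex hull supp \<alpha> = convex hull S"
        by (simp_all add: I_def \<iota>_def jl)
      have "supp \<alpha> = verts (convex hull supp \<alpha>)" by (rule verts_hull[OF sI(1)[OF a(1)], symmetric])
      also have "\<dots> = verts (convex hull S)" by (simp only: a(2))
      also have "\<dots> = S" by (rule verts_hull[OF jl(3)])
      finally show "\<alpha> \<in> exponents V r \<and> supp \<alpha> = S" using a(1) by blast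
    next
      fix \<alpha> assume "\<alpha> \<in> exponents V r \<and> supp \<alpha> = S"
      then show "\<alpha> \<in> I \<and> \<iota> \<alpha> = j" using jl(2,4) unfolding jl(1) I_def \<iota>_def by simp
    qed
    then show ?thesis using bubble_space_eq[OF jl(3,4) W] by (simp add: jl(1))
  qed
  show ?sum
    using family_sum_comb[OF J I \<iota> S] by (simp add: \<iota>_def)
  have "indep_on bern I UNIV"
    by (rule indep_on_subset[OF _ finite_exponents[OF finite_V] indep_bern]) (auto simp: I_def)
  then show ?direct using direct_family_comb[OF J I \<iota> S] by blast
qed

lemma PolyX_eq: "PolyX r k = comb bern (exponents V r) (\<lambda>_. XX k)"
  unfolding PolyX_def Poly_eq_Bernstein
  by (rule field_tensor_comb[OF finite_exponents[OF finite_V] subspace_XX])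

lemma card_exponents_card_supp:
  assumes r: "r \<ge> 1"
  shows "card {\<alpha> \<in> exponents V r. card (supp \<alpha>) = Suc l}
    = ((CARD('n) + 1) choose (l + 1)) * ((r - 1) choose l)"
proof -
  let ?Q = "{S. S \<subseteq> V \<and> card S = Suc l}"
  have e: "{\<alpha> \<in> exponents V r. card (supp \<alpha>) = Suc l} = (\<Union>S\<in>?Q. {\<alpha> \<in> exponents V r. supp \<alpha> = S})"
    using supp_subset by blast
  have "card (\<Union>S\<in>?Q. {\<alpha> \<in> exponents V r. supp \<alpha> = S})
    = (\<Sum>S\<in>?Q. card {\<alpha> \<in> exponents V r. supp \<alpha> = S})"
    by (rule card_UN_disjoint) (use finite_exponents[OF finite_V] in auto)
  also have "\<dots> = (\<Sum>S\<in>?Q. (r - 1) choose l)"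
  proof (rule sum.cong[OF refl])
    fix S assume S: "S \<in> ?Q"
    then have "{\<alpha> \<in> exponents V r. supp \<alpha> = S} = {\<alpha> \<in> exponents S r. supp \<alpha> = S}"
      using exponents_mono[of S V _ r] by auto
    moreover have "finite S" using S finite_subset[OF _ finite_V] by blast
    ultimately show "card {\<alpha> \<in> exponents V r. supp \<alpha> = S} = (r - 1) choose l"
      using card_exponents_supp[of S l r] S r by simp
  qed
  also have "\<dots> = card ?Q * ((r - 1) choose l)" by simp
  also have "card ?Q = (CARD('n) + 1) choose (l + 1)"
    using n_subsets[OF finite_V, of "Suc l"] card_V by (simp add: Suc_eq_plus1)
  finally show ?thesis unfolding e .
qed

end

section \<open>The trace\<close>

lemma
  shows dual_bases_std: "dual_bases (\<lambda>i. axis (coord i) 1 :: real^'n::{finite,linorder}) (\<lambda>i. axis (coord i) 1)"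
    and covectors_std: "covectors (\<lambda>i. axis (coord i) 1 :: real^'n::{finite,linorder}) = dx"
proof -
  have "coord i = (coord j :: 'n) \<longleftrightarrow> i = j" if "i \<in> {1..CARD('n)}" "j \<in> {1..CARD('n)}" for i j
  proof -
    have "i - 1 < CARD('n)" "j - 1 < CARD('n)" using that by auto
    then have "coord i = (coord j :: 'n) \<longleftrightarrow> i - 1 = j - 1"
      unfolding coord_def by (subst nth_eq_iff_index_eq) auto
    then show ?thesis using that by auto
  qed
  then show "dual_bases (\<lambda>i. axis (coord i) 1 :: (real, 'n) vec) (\<lambda>i. axis (coord i) 1)"
    by unfold_locales (simp add: inner_axis_axis)
  show "covectors (\<lambda>i. axis (coord i) 1 :: (real, 'n) vec) = dx"
    by (simp add: covectors_def dx_def inner_axis' fun_eq_iff)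
qed

interpretation std: dual_bases "\<lambda>i. axis (coord i) 1 :: real^'n::{finite,linorder}" "\<lambda>i. axis (coord i) 1"
  by (rule dual_bases_std)

lemma tr_face_eq:
  fixes F :: "(real^'n::{finite,linorder}) set"
  assumes "\<omega> x \<in> Alt2 k (CARD('n) - 1)"
  shows "tr_face k F m \<omega> x = (if x \<in> F then \<Sum>\<sigma>\<in>Seqs k CARD('n).
    (\<Sum>i=1..CARD('n). (m \<bullet> axis (coord i) 1) * std.cf (\<omega> x) \<sigma> i) *\<^sub>R wedge_at dx \<sigma> else 0)"
proof -
  have "coeff_of k dx (\<omega> x) \<sigma> i * m $ coord i = (m \<bullet> axis (coord i) 1) * std.cf (\<omega> x) \<sigma> i"
    if "\<sigma> \<in> Seqs k CARD('n)" "i \<in> {1..CARD('n)}" for \<sigma> i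
    using std.coeff_of_eq_cf[OF assms that] by (simp add: covectors_std inner_axis)
  then have "(\<Sum>i=1..CARD('n). coeff_of k dx (\<omega> x) \<sigma> i * m $ coord i)
    = (\<Sum>i=1..CARD('n). (m \<bullet> axis (coord i) 1) * std.cf (\<omega> x) \<sigma> i)"
    if "\<sigma> \<in> Seqs k CARD('n)" for \<sigma>
    using that by (intro sum.cong refl)
  then show ?thesis unfolding tr_face_def by (auto intro!: sum.cong)
qed

text \<open>The forms \<open>wedge_at dx \<sigma>\<close> are independent, so the trace vanishes iff
  each of its components does, and these are the sums in \<open>contraction_zero_iff\<close> for the
  standard basis.\<close>

lemma tr_face_eq_0_iff:
  fixes F :: "(real^'n::{finite,linorder}) set"
  assumes \<omega>: "\<omega> x \<in> Alt2 k (CARD('n) - 1)" and x: "x \<in> F"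
  shows "tr_face k F m \<omega> x = 0 \<longleftrightarrow> contraction_zero m (\<omega> x)"
proof
  let ?c = "\<lambda>\<sigma>. \<Sum>i=1..CARD('n). (m \<bullet> axis (coord i) 1) * std.cf (\<omega> x) \<sigma> i"
  let ?e = "\<lambda>\<sigma>. map (\<lambda>i. axis (coord i) 1 :: (real, 'n) vec) (sorted_list_of_set \<sigma>)"
  assume "tr_face k F m \<omega> x = 0"
  then have z: "(\<Sum>\<sigma>\<in>Seqs k CARD('n). ?c \<sigma> *\<^sub>R (wedge_at dx \<sigma> :: 'n form)) = 0"
    using tr_face_eq[of \<omega> x k F m, OF \<omega>] x by simp
  have "?c \<rho> = 0" if \<rho>: "\<rho> \<in> Seqs k CARD('n)" for \<rho>
  proof -
    have "0 = (\<Sum>\<sigma>\<in>Seqs k CARD('n). ?c \<sigma> *\<^sub>R (wedge_at dx \<sigma> :: 'n form)) (?e \<rho>)"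
      unfolding z by simp
    also have "\<dots> = (\<Sum>\<sigma>\<in>Seqs k CARD('n). if \<sigma> = \<rho> then ?c \<sigma> else 0)"
      unfolding sum_fun_apply scaleR_fun_apply
      using std.wedge_at_dual[OF _ \<rho>] by (intro sum.cong) (auto simp: covectors_std)
    also have "\<dots> = ?c \<rho>" using \<rho> by simp
    finally show ?thesis by simp
  qed
  then show "contraction_zero m (\<omega> x)" unfolding std.contraction_zero_iff[OF \<omega>] by blast
next
  assume "contraction_zero m (\<omega> x)"
  then show "tr_face k F m \<omega> x = 0"
    unfolding std.contraction_zero_iff[OF \<omega>] using tr_face_eq[of \<omega> x k F m, OF \<omega>] by simp
qed

text \<open>The values must lie in \<open>Alt2\<close>, since \<open>representation\<close> returns
  0 outside the span and is linear only within it.\<close>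

lemma tr_div_diff:
  fixes T :: "(real^'n::{finite,linorder}) set"
  assumes "\<And>x. \<omega> x \<in> Alt2 k (CARD('n) - 1)" "\<And>x. \<eta> x \<in> Alt2 k (CARD('n) - 1)"
  shows "tr_div k T \<nu> (\<omega> - \<eta>) = tr_div k T \<nu> \<omega> - tr_div k T \<nu> \<eta>"
proof -
  have "tr_face k F m (\<omega> - \<eta>) = tr_face k F m \<omega> - tr_face k F m \<eta>" for F m
  proof
    fix x
    have d: "(\<omega> - \<eta>) x \<in> Alt2 k (CARD('n) - 1)"
      using subspace_diff[OF subspace_Alt2 assms(1)[of x] assms(2)[of x]] by simp
    show "tr_face k F m (\<omega> - \<eta>) x = (tr_face k F m \<omega> - tr_face k F m \<eta>) x"
      using tr_face_eq[of "\<omega> - \<eta>" x k F m, OF d] tr_face_eq[of \<omega> x k F m, OF assms(1)]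
        tr_face_eq[of \<eta> x k F m, OF assms(2)]
      by (simp add: right_diff_distrib sum_subtractf scaleR_diff_left)
  qed
  then show ?thesis by (simp add: tr_div_def fun_eq_iff)
qed

text \<open>On the facet opposite \<open>v\<close> the coordinate of \<open>v\<close> vanishes,
  which removes the exponents supported at \<open>v\<close>; the others remain independent there. As
  the contraction is linear in the form, it can be tested on each coefficient.\<close>

lemma tr_div_eq_0_iff:
  fixes V :: "(real^'n::{finite,linorder}) set"
  assumes V: "full_simplex V" and A: "\<And>\<alpha>. \<alpha> \<in> exponents V r \<Longrightarrow> A \<alpha> \<in> Alt2 k (CARD('n) - 1)"
  defines "\<omega> \<equiv> \<lambda>x. \<Sum>\<alpha>\<in>exponents V r. full_simplex.bern V \<alpha> x *\<^sub>R A \<alpha>"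
  shows "tr_div k (convex hull V) \<nu> \<omega> = 0 \<longleftrightarrow>
    (\<forall>\<alpha>\<in>exponents V r. \<forall>v\<in>V - supp \<alpha>. contraction_zero (\<nu> (convex hull (V - {v}))) (A \<alpha>))"
proof -
  interpret full_simplex V by fact
  let ?E = "exponents V r"
  let ?\<nu> = "\<lambda>v. \<nu> (convex hull (V - {v}))"
  \<comment> \<open>Component \<sigma> of the coefficient matrix of \<open>B\<close> applied to
    \<open>m\<close>, in standard coordinates.\<close>
  define \<kappa> where "\<kappa> m \<sigma> B = (\<Sum>i=1..CARD('n). (m \<bullet> axis (coord i) 1) * std.cf B \<sigma> i)"
    for m :: "(real, 'n) vec" and \<sigma> and B :: "'n dform"
  have \<omega>A: "\<omega> x \<in> Alt2 k (CARD('n) - 1)" for x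
    unfolding \<omega>_def using A by (intro subspace_sum[OF subspace_Alt2] subspace_scale[OF subspace_Alt2])
  have czA: "contraction_zero m (A \<alpha>) \<longleftrightarrow> (\<forall>\<sigma>\<in>Seqs k CARD('n). \<kappa> m \<sigma> (A \<alpha>) = 0)" if "\<alpha> \<in> ?E" for m \<alpha>
    using std.contraction_zero_iff[OF A[OF that]] by (simp add: \<kappa>_def)
  have cz\<omega>: "contraction_zero m (\<omega> x) \<longleftrightarrow> (\<forall>\<sigma>\<in>Seqs k CARD('n). (\<Sum>\<alpha>\<in>?E. bern \<alpha> x * \<kappa> m \<sigma> (A \<alpha>)) = 0)" for m x
  proof -
    have "\<kappa> m \<sigma> (\<omega> x) = (\<Sum>\<alpha>\<in>?E. bern \<alpha> x * \<kappa> m \<sigma> (A \<alpha>))" for \<sigma>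
      unfolding \<kappa>_def \<omega>_def std.cf_simps sum_distrib_left
      by (subst sum.swap) (simp add: mult.left_commute)
    then show ?thesis using std.contraction_zero_iff[OF \<omega>A, of m x] by (simp add: \<kappa>_def)
  qed
  have facets: "subsimplices (CARD('n) - 1) (convex hull V) = {convex hull (V - {v}) | v. v \<in> V}"
  proof -
    have N: "CARD('n) - 1 + 1 = CARD('n)" using zero_less_card_finite[where 'a = 'n] by linarith
    have iff: "S \<subseteq> V \<and> card S = CARD('n) \<longleftrightarrow> (\<exists>v\<in>V. S = V - {v})" for S
    proof
      assume S: "S \<subseteq> V \<and> card S = CARD('n)"
      then have "card (V - S) = 1"
        using card_V finite_subset[OF _ finite_V] by (subst card_Diff_subset) auto
      then obtain v where "V - S = {v}" by (meson card_1_singletonE)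
      then show "\<exists>v\<in>V. S = V - {v}" using S by blast
    next
      assume "\<exists>v\<in>V. S = V - {v}"
      then show "S \<subseteq> V \<and> card S = CARD('n)" using card_V by auto
    qed
    show ?thesis unfolding subsimplices_eq N iff by blast
  qed
  have tr: "tr_div k (convex hull V) \<nu> \<omega> = 0 \<longleftrightarrow>
    (\<forall>v\<in>V. \<forall>x\<in>convex hull (V - {v}). contraction_zero (?\<nu> v) (\<omega> x))"
  proof -
    have "tr_div k (convex hull V) \<nu> \<omega> = 0 \<longleftrightarrow>
      (\<forall>v\<in>V. tr_face k (convex hull (V - {v})) (?\<nu> v) \<omega> = 0)"
      unfolding tr_div_def facets fun_eq_iff[of _ "0 :: ((real, 'n) vec) set \<Rightarrow> _"] by auto
    also have "\<dots> \<longleftrightarrow> (\<forall>v\<in>V. \<forall>x\<in>convex hull (V - {v}). tr_face k (convex hull (V - {v})) (?\<nu> v) \<omega> x = 0)"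
      unfolding fun_eq_iff[of _ "0 :: (real, 'n) vec \<Rightarrow> _"] by (auto simp: tr_face_def)
    finally show ?thesis using tr_face_eq_0_iff[of \<omega> _ k, OF \<omega>A] by simp
  qed
  have face: "(\<Sum>\<alpha>\<in>?E. bern \<alpha> x * d \<alpha>) = (\<Sum>\<alpha>\<in>exponents (V - {v}) r. bern \<alpha> x * d \<alpha>)"
    if "v \<in> V" "x \<in> convex hull (V - {v})" for v x d
  proof (rule sum.mono_neutral_right[OF finite_exponents[OF finite_V]])
    have sub: "\<alpha> \<in> exponents (V - {v}) r \<longleftrightarrow> \<alpha> \<in> ?E \<and> \<alpha> v = 0" for \<alpha>
      using exponents_mono[of "V - {v}" V \<alpha> r] supp_subset[of \<alpha> V r] by (auto simp: supp_def)
    then show "exponents (V - {v}) r \<subseteq> ?E" by blast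
    have Lv: "L v x = 0" using L_face[of "V - {v}" x v] that by simp
    show "\<forall>\<alpha>\<in>?E - exponents (V - {v}) r. bern \<alpha> x * d \<alpha> = 0"
    proof
      fix \<alpha> assume "\<alpha> \<in> ?E - exponents (V - {v}) r"
      then have "\<alpha> v \<noteq> 0" using sub[of \<alpha>] by simp
      then have "L v x ^ \<alpha> v = 0" using Lv by simp
      then have "bern \<alpha> x = 0"
        unfolding bern_def using that(1) by (intro prod_zero finite_V bexI[of _ v])
      then show "bern \<alpha> x * d \<alpha> = 0" by simp
    qed
  qed
  have sub: "\<alpha> \<in> exponents (V - {v}) r \<longleftrightarrow> \<alpha> \<in> ?E \<and> v \<notin> supp \<alpha>" for \<alpha> v
    using exponents_mono[of "V - {v}" V \<alpha> r] supp_subset[of \<alpha> V r] by auto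
  show ?thesis
    unfolding tr
  proof (intro iffI ballI)
    fix \<alpha> v assume z: "\<forall>v\<in>V. \<forall>x\<in>convex hull (V - {v}). contraction_zero (?\<nu> v) (\<omega> x)"
      and \<alpha>: "\<alpha> \<in> ?E" and v: "v \<in> V - supp \<alpha>"
    have "card (V - {v}) \<noteq> 0" using v card_V by simp
    then have ne: "V - {v} \<noteq> {}" by (metis card.empty)
    show "contraction_zero (?\<nu> v) (A \<alpha>)"
      unfolding czA[OF \<alpha>]
    proof
      fix \<sigma> assume \<sigma>: "\<sigma> \<in> Seqs k CARD('n)"
      have "(\<Sum>\<alpha>\<in>exponents (V - {v}) r. bern \<alpha> x * \<kappa> (?\<nu> v) \<sigma> (A \<alpha>)) = 0"
        if x: "x \<in> convex hull (V - {v})" for x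
        using z v x \<sigma> unfolding cz\<omega> by (subst face[symmetric]) auto
      then show "\<kappa> (?\<nu> v) \<sigma> (A \<alpha>) = 0"
        \<comment> \<open>The scalar independence on the facet is applied to one component at a
          time.\<close>
        using indep_bern_face[OF Diff_subset ne, of r, unfolded indep_on_def, rule_format,
            of "\<lambda>\<alpha>. \<kappa> (?\<nu> v) \<sigma> (A \<alpha>)" \<alpha>] \<alpha> v sub[of \<alpha> v] by auto
    qed
  next
    fix v x assume z: "\<forall>\<alpha>\<in>?E. \<forall>v\<in>V - supp \<alpha>. contraction_zero (?\<nu> v) (A \<alpha>)"
      and v: "v \<in> V" and x: "x \<in> convex hull (V - {v})"
    have "\<kappa> (?\<nu> v) \<sigma> (A \<alpha>) = 0" if "\<alpha> \<in> exponents (V - {v}) r" "\<sigma> \<in> Seqs k CARD('n)" for \<alpha> \<sigma>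
      using z v that czA unfolding sub by blast
    then show "contraction_zero (?\<nu> v) (\<omega> x)"
      unfolding cz\<omega> face[OF v x] by simp
  qed
qed

text \<open>A vertex has no tangential and the full simplex no normal directions; this accounts for
  the ranges of l in the two direct sums.\<close>

lemma TX_0: "TX k 0 b = {0}" and NX_top: "NX k CARD('n) (b :: nat \<Rightarrow> real^'n::finite) = {0}"
  by (simp_all add: TX_def NX_def)

lemma comb_mono: "(\<And>\<alpha>. \<alpha> \<in> I \<Longrightarrow> W \<alpha> \<subseteq> W' \<alpha>) \<Longrightarrow> comb \<beta> I W \<subseteq> comb \<beta> I W'"
  unfolding comb_def by blast

section \<open>Coefficientwise assembly of the decomposition, the bijection and the
  dimension\<close>

theorem theorem6p3:
  fixes T :: "(real, 'n::{finite,linorder}) vec set"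
    and tn :: "(real, 'n) vec set \<Rightarrow> nat \<Rightarrow> (real, 'n) vec"
    and \<nu> :: "(real, 'n) vec set \<Rightarrow> (real, 'n) vec"
    and k r n :: nat
  assumes n: "n = CARD('n)" "n \<ge> 2"
    and k: "1 \<le> k" "k \<le> n - 1"
    and r: "r \<ge> 2"
    and T: "int n simplex T"
    and tn: "\<And>l f. l \<le> n \<Longrightarrow> f \<in> subsimplices l T \<Longrightarrow> tn_basis l f (tn f)"
    and \<nu>: "\<And>F. F \<in> subsimplices (n - 1) T \<Longrightarrow> unit_normal F (\<nu> F)"
  shows
    "direct_family (SIGMA l:{1..n}. subsimplices l T) (\<lambda>(l, f). BTX T r k tn l f) \<and>
     Bdiv r k T \<nu> =
       family_sum (SIGMA l:{1..n}. subsimplices l T) (\<lambda>(l, f). BTX T r k tn l f) \<and>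
     direct_family (SIGMA l:{0..n - 1}. subsimplices l T) (\<lambda>(l, f). BNX T r k tn l f) \<and>
     bij_betw (tr_div k T \<nu>)
       (family_sum (SIGMA l:{0..n - 1}. subsimplices l T) (\<lambda>(l, f). BNX T r k tn l f))
       (tr_div k T \<nu> ` PolyX r k) \<and>
     int (dim (Bdiv r k T \<nu>)) =
       (\<Sum>l = 1..n. int ((n + 1) choose (l + 1)) * int ((r - 1) choose l) *
          (int l * int (n choose k) + int ((n - l) choose (n - k + 1)) - int (n choose (k - 1))))"
proof -
  obtain V where V: "\<not> affine_dependent V" "int (card V) = int n + 1" "T = convex hull V"
    using T unfolding simplex_def by blast
  have fsV: "full_simplex V"
    by unfold_locales (use V n(1) in auto)
  interpret full_simplex V by (rule fsV)
  let ?N = "CARD('n)" and ?E = "exponents V r"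
  have k': "1 \<le> k" "k \<le> ?N" using k n by auto
  have r1: "1 \<le> r" using r by simp
  have finE: "finite ?E" by (rule finite_exponents[OF finite_V])
  \<comment> \<open>Both \<open>d\<close> and \<open>b\<close> depend on the exponent only through
    its support: the dimension of the carrying face and the basis chosen there.\<close>
  define d where "d \<alpha> = card (supp \<alpha>) - 1" for \<alpha> :: "(real, 'n) vec \<Rightarrow> nat"
  define b where "b \<alpha> = tn (convex hull supp \<alpha>)" for \<alpha> :: "(real, 'n) vec \<Rightarrow> nat"
  let ?TX = "\<lambda>\<alpha>. TX k (d \<alpha>) (b \<alpha>)" and ?NX = "\<lambda>\<alpha>. NX k (d \<alpha>) (b \<alpha>)"
  have S: "supp \<alpha> \<subseteq> V" "card (supp \<alpha>) = d \<alpha> + 1" "d \<alpha> \<le> ?N" "tn_basis (d \<alpha>) (convex hull supp \<alpha>) (b \<alpha>)"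
    if "\<alpha> \<in> ?E" for \<alpha>
  proof -
    show s: "supp \<alpha> \<subseteq> V" using supp_subset[OF that] .
    have "finite (supp \<alpha>)" using finite_subset[OF s finite_V] .
    then have "card (supp \<alpha>) \<noteq> 0" using supp_ne_empty[OF that r1] by simp
    then show c: "card (supp \<alpha>) = d \<alpha> + 1" by (simp add: d_def)
    have "card (supp \<alpha>) \<le> card V" using s by (intro card_mono) auto
    then show l: "d \<alpha> \<le> ?N" using c card_V by simp
    show "tn_basis (d \<alpha>) (convex hull supp \<alpha>) (b \<alpha>)"
      unfolding b_def by (rule tn) (use l n s c in \<open>auto simp: V(3) subsimplices_eq\<close>)
  qed
  have \<nu>': "unit_normal (convex hull (V - {v})) (\<nu> (convex hull (V - {v})))" if v: "v \<in> V" for v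
  proof (rule \<nu>)
    have "card (V - {v}) = n - 1 + 1" using v card_V n by simp
    then show "convex hull (V - {v}) \<in> subsimplices (n - 1) T"
      unfolding V(3) subsimplices_eq by blast
  qed
  have dual: "\<exists>e. dual_bases (b \<alpha>) e" if "\<alpha> \<in> ?E" for \<alpha>
    using tn_basis_dual[OF S(4,3)[OF that]] by blast
  have TX_sub: "?TX \<alpha> \<subseteq> XX k" and NX_sub: "?NX \<alpha> \<subseteq> XX k" if "\<alpha> \<in> ?E" for \<alpha>
    using dual[OF that] dual_bases.TX_iff[OF _ k'] dual_bases.NX_iff[OF _ k'] by blast+
  have sub: "subspace (TX k l c)" "subspace (NX k l c)" for l and c :: "nat \<Rightarrow> (real, 'n) vec"
    unfolding TX_def NX_def by (rule subspace_span)+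

  let ?JT = "SIGMA l:{1..n}. subsimplices l T" and ?JN = "SIGMA l:{0..n - 1}. subsimplices l T"
  have TX: "direct_family ?JT (\<lambda>(l, f). BTX T r k tn l f)"
    and sumT: "family_sum ?JT (\<lambda>(l, f). BTX T r k tn l f) = comb bern ?E ?TX"
  proof -
    note bs = bubble_spaces_sum[of "\<lambda>l f. TX k l (tn f)" r 1 n, OF sub(1) r1, folded V(3)]
    show "direct_family ?JT (\<lambda>(l, f). BTX T r k tn l f)"
      using bs(2) unfolding BTX_def .
    have "comb bern ?E ?TX = comb bern {\<alpha> \<in> ?E. card (supp \<alpha>) - 1 \<in> {1..n}} ?TX"
    proof (rule comb_restrict[OF finE])
      fix \<alpha> assume "\<alpha> \<in> ?E - {\<alpha> \<in> ?E. card (supp \<alpha>) - 1 \<in> {1..n}}"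
      then have "d \<alpha> = 0" using S(3)[of \<alpha>] n by (auto simp: d_def)
      then show "?TX \<alpha> = {0}" by (simp add: TX_0)
    qed auto
    then show "family_sum ?JT (\<lambda>(l, f). BTX T r k tn l f) = comb bern ?E ?TX"
      using bs(1) unfolding BTX_def by (simp add: d_def b_def)
  qed
  have NX: "direct_family ?JN (\<lambda>(l, f). BNX T r k tn l f)"
    and sumN: "family_sum ?JN (\<lambda>(l, f). BNX T r k tn l f) = comb bern ?E ?NX"
  proof -
    note bs = bubble_spaces_sum[of "\<lambda>l f. NX k l (tn f)" r 0 "n - 1", OF sub(2) r1, folded V(3)]
    show "direct_family ?JN (\<lambda>(l, f). BNX T r k tn l f)"
      using bs(2) unfolding BNX_def .
    have "comb bern ?E ?NX = comb bern {\<alpha> \<in> ?E. card (supp \<alpha>) - 1 \<in> {0..n - 1}} ?NX"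
    proof (rule comb_restrict[OF finE])
      fix \<alpha> assume "\<alpha> \<in> ?E - {\<alpha> \<in> ?E. card (supp \<alpha>) - 1 \<in> {0..n - 1}}"
      then have "d \<alpha> = ?N" using S(3)[of \<alpha>] n by (auto simp: d_def)
      then show "?NX \<alpha> = {0}" by (simp add: NX_top)
    qed auto
    then show "family_sum ?JN (\<lambda>(l, f). BNX T r k tn l f) = comb bern ?E ?NX"
      using bs(1) unfolding BNX_def by (simp add: d_def b_def)
  qed

  \<comment> \<open>The facets containing the carrying face are those opposite to vertices outside
    the support, so the trace criterion and the tangential criterion range over the same
    normals.\<close>
  have kernel: "tr_div k T \<nu> (\<lambda>x. \<Sum>\<alpha>\<in>?E. bern \<alpha> x *\<^sub>R A \<alpha>) = 0 \<longleftrightarrow> (\<forall>\<alpha>\<in>?E. A \<alpha> \<in> ?TX \<alpha>)"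
    if A: "\<And>\<alpha>. \<alpha> \<in> ?E \<Longrightarrow> A \<alpha> \<in> XX k" for A
  proof -
    have "A \<alpha> \<in> ?TX \<alpha> \<longleftrightarrow> (\<forall>v\<in>V - supp \<alpha>. contraction_zero (\<nu> (convex hull (V - {v}))) (A \<alpha>))"
      if "\<alpha> \<in> ?E" for \<alpha>
      using \<nu>' by (intro TX_iff_contraction[OF S(1,2)[OF that] k' S(4)[OF that] _ A[OF that]]) auto
    moreover have "A \<alpha> \<in> Alt2 k (?N - 1)" if "\<alpha> \<in> ?E" for \<alpha>
      using A[OF that] by (simp add: XX_def)
    ultimately show ?thesis
      using tr_div_eq_0_iff[OF fsV, of r A k \<nu>] unfolding V(3) by simp
  qed
  have Bdiv: "Bdiv r k T \<nu> = comb bern ?E ?TX"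
  proof (intro equalityI subsetI)
    fix \<omega> assume "\<omega> \<in> Bdiv r k T \<nu>"
    then have "\<omega> \<in> comb bern ?E (\<lambda>_. XX k)" "tr_div k T \<nu> \<omega> = 0"
      unfolding Bdiv_def PolyX_eq by auto
    then obtain A where A: "\<omega> = (\<lambda>x. \<Sum>\<alpha>\<in>?E. bern \<alpha> x *\<^sub>R A \<alpha>)" "\<forall>\<alpha>\<in>?E. A \<alpha> \<in> XX k"
      unfolding comb_def by blast
    then have "\<forall>\<alpha>\<in>?E. A \<alpha> \<in> ?TX \<alpha>" using kernel[of A] \<open>tr_div k T \<nu> \<omega> = 0\<close> by simp
    with A(1) show "\<omega> \<in> comb bern ?E ?TX" unfolding comb_def by blast
  next
    fix \<omega> assume "\<omega> \<in> comb bern ?E ?TX"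
    then obtain A where A: "\<omega> = (\<lambda>x. \<Sum>\<alpha>\<in>?E. bern \<alpha> x *\<^sub>R A \<alpha>)" "\<forall>\<alpha>\<in>?E. A \<alpha> \<in> ?TX \<alpha>"
      unfolding comb_def by blast
    then have X: "\<forall>\<alpha>\<in>?E. A \<alpha> \<in> XX k" using TX_sub by blast
    then have "\<omega> \<in> PolyX r k" unfolding PolyX_eq comb_def using A(1) by blast
    then show "\<omega> \<in> Bdiv r k T \<nu>" using kernel[of A] X A unfolding Bdiv_def by simp
  qed

  have Alt2_PolyX: "\<omega> x \<in> Alt2 k (?N - 1)" if "\<omega> \<in> PolyX r k"
    for \<omega> :: "(real, 'n) vec \<Rightarrow> 'n dform" and x
  proof -
    from that obtain A where A: "\<omega> = (\<lambda>x. \<Sum>\<alpha>\<in>?E. bern \<alpha> x *\<^sub>R A \<alpha>)" "\<forall>\<alpha>\<in>?E. A \<alpha> \<in> XX k"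
      unfolding PolyX_eq comb_def by blast
    have "\<omega> x \<in> XX k"
      unfolding A(1) by (intro subspace_sum[OF subspace_XX] subspace_scale[OF subspace_XX] A(2)[rule_format])
    then show ?thesis by (simp add: XX_def)
  qed
  have subN: "comb bern ?E ?NX \<subseteq> PolyX r k"
    unfolding PolyX_eq by (rule comb_mono) (rule NX_sub)
  have diff: "tr_div k T \<nu> (\<omega> - \<eta>) = tr_div k T \<nu> \<omega> - tr_div k T \<nu> \<eta>"
    if "\<omega> \<in> PolyX r k" "\<eta> \<in> PolyX r k" for \<omega> \<eta> :: "(real, 'n) vec \<Rightarrow> 'n dform"
    using that by (intro tr_div_diff Alt2_PolyX)
  have "inj_on (tr_div k T \<nu>) (comb bern ?E ?NX)"
  proof (rule inj_onI)
    fix \<omega> \<eta> assume \<omega>: "\<omega> \<in> comb bern ?E ?NX" and \<eta>: "\<eta> \<in> comb bern ?E ?NX"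
      and eq: "tr_div k T \<nu> \<omega> = tr_div k T \<nu> \<eta>"
    have "\<omega> - \<eta> \<in> comb bern ?E ?NX"
      by (rule subspace_diff[OF subspace_comb \<omega> \<eta>]) (rule sub)
    then obtain A where A: "\<omega> - \<eta> = (\<lambda>x. \<Sum>\<alpha>\<in>?E. bern \<alpha> x *\<^sub>R A \<alpha>)" "\<forall>\<alpha>\<in>?E. A \<alpha> \<in> ?NX \<alpha>"
      unfolding comb_def by blast
    have "tr_div k T \<nu> (\<omega> - \<eta>) = 0" using diff[of \<omega> \<eta>] \<omega> \<eta> subN eq by auto
    then have TA: "\<forall>\<alpha>\<in>?E. A \<alpha> \<in> ?TX \<alpha>" using kernel[of A] A NX_sub by auto
    \<comment> \<open>Each coefficient is normal by choice and tangential because the trace of the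
      difference vanishes.\<close>
    have "A \<alpha> = 0" if \<alpha>: "\<alpha> \<in> ?E" for \<alpha>
    proof -
      obtain e where "dual_bases (b \<alpha>) e" using dual[OF \<alpha>] by blast
      from dual_bases.TX_inter_NX[OF this k', of "d \<alpha>"] show ?thesis using A(2) TA \<alpha> by blast
    qed
    then have "\<omega> - \<eta> = 0" unfolding A(1) by (simp add: fun_eq_iff)
    then show "\<omega> = \<eta>" by simp
  qed
  moreover have "tr_div k T \<nu> ` comb bern ?E ?NX = tr_div k T \<nu> ` PolyX r k"
  proof
    show "tr_div k T \<nu> ` comb bern ?E ?NX \<subseteq> tr_div k T \<nu> ` PolyX r k"
      using subN by (rule image_mono)
    show "tr_div k T \<nu> ` PolyX r k \<subseteq> tr_div k T \<nu> ` comb bern ?E ?NX"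
    proof
      fix t assume "t \<in> tr_div k T \<nu> ` PolyX r k"
      then obtain \<omega> where \<omega>: "\<omega> \<in> PolyX r k" "t = tr_div k T \<nu> \<omega>" by blast
      from \<omega>(1) obtain A where A: "\<omega> = (\<lambda>x. \<Sum>\<alpha>\<in>?E. bern \<alpha> x *\<^sub>R A \<alpha>)" "\<forall>\<alpha>\<in>?E. A \<alpha> \<in> XX k"
        unfolding PolyX_eq comb_def by blast
      \<comment> \<open>Dropping the tangential part of every coefficient changes the field by an
        element of the kernel, so the normal remainder has the same trace.\<close>
      have "\<forall>\<alpha>\<in>?E. \<exists>B. B \<in> ?NX \<alpha> \<and> A \<alpha> - B \<in> ?TX \<alpha>"
      proof
        fix \<alpha> assume \<alpha>: "\<alpha> \<in> ?E"
        obtain e where "dual_bases (b \<alpha>) e" using dual[OF \<alpha>] by blast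
        from dual_bases.XX_split[OF this k' A(2)[rule_format, OF \<alpha>], of "d \<alpha>"]
        obtain \<eta> \<theta> where "\<eta> \<in> ?TX \<alpha>" "\<theta> \<in> ?NX \<alpha>" "A \<alpha> = \<eta> + \<theta>" by blast
        then show "\<exists>B. B \<in> ?NX \<alpha> \<and> A \<alpha> - B \<in> ?TX \<alpha>" by (intro exI[of _ \<theta>]) simp
      qed
      then obtain B where B: "\<forall>\<alpha>\<in>?E. B \<alpha> \<in> ?NX \<alpha> \<and> A \<alpha> - B \<alpha> \<in> ?TX \<alpha>" by metis
      let ?\<theta> = "\<lambda>x. \<Sum>\<alpha>\<in>?E. bern \<alpha> x *\<^sub>R B \<alpha>"
      have \<theta>: "?\<theta> \<in> comb bern ?E ?NX" unfolding comb_def using B by blast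
      have "\<omega> - ?\<theta> = (\<lambda>x. \<Sum>\<alpha>\<in>?E. bern \<alpha> x *\<^sub>R (A \<alpha> - B \<alpha>))"
        unfolding A(1) by (simp add: fun_eq_iff right_diff_distrib sum_subtractf)
      moreover have "tr_div k T \<nu> (\<lambda>x. \<Sum>\<alpha>\<in>?E. bern \<alpha> x *\<^sub>R (A \<alpha> - B \<alpha>)) = 0"
        using B TX_sub by (subst kernel) auto
      ultimately have "tr_div k T \<nu> \<omega> - tr_div k T \<nu> ?\<theta> = 0"
        using diff[OF \<omega>(1) subsetD[OF subN \<theta>]] by simp
      then have "t = tr_div k T \<nu> ?\<theta>" using \<omega>(2) by simp
      then show "t \<in> tr_div k T \<nu> ` comb bern ?E ?NX" using \<theta> by blast
    qed
  qed
  ultimately have bij: "bij_betw (tr_div k T \<nu>) (comb bern ?E ?NX) (tr_div k T \<nu> ` PolyX r k)"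
    unfolding bij_betw_def by blast

  have "int (dim (comb bern ?E ?TX)) = (\<Sum>l = 1..n. int ((n + 1) choose (l + 1)) * int ((r - 1) choose l) *
      (int l * int (n choose k) + int ((n - l) choose (n - k + 1)) - int (n choose (k - 1))))"
  proof -
    let ?F = "\<lambda>l. free_indices ?N k {1..l}"
    let ?G = "\<lambda>\<alpha>. (\<lambda>(\<sigma>, i). proj_val (covectors (b \<alpha>)) \<sigma> i) ` ?F (d \<alpha>)"
    have G: "span (?G \<alpha>) = ?TX \<alpha>" "independent (?G \<alpha>)" "finite (?G \<alpha>)" "card (?G \<alpha>) = card (?F (d \<alpha>))"
      if \<alpha>: "\<alpha> \<in> ?E" for \<alpha>
    proof -
      obtain e where e: "dual_bases (b \<alpha>) e" using dual[OF \<alpha>] by blast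
      show "span (?G \<alpha>) = ?TX \<alpha>" "independent (?G \<alpha>)" "finite (?G \<alpha>)" "card (?G \<alpha>) = card (?F (d \<alpha>))"
        using dual_bases.TX_eq[OF e k', of "d \<alpha>"] dual_bases.proj_val_basis[OF e k', of "{1..d \<alpha>}"]
          finite_free_indices[of ?N k "{1..d \<alpha>}"] by (simp_all add: card_image)
    qed
    have "dim (comb bern ?E ?TX) = (\<Sum>\<alpha>\<in>?E. card (?G \<alpha>))"
      by (rule dim_comb[OF finE indep_bern G(1-3)])
    also have "\<dots> = (\<Sum>\<alpha>\<in>?E. card (?F (d \<alpha>)))" by (rule sum.cong[OF refl]) (rule G(4))
    \<comment> \<open>The number of tangential free indices depends only on the dimension of the
      carrying face, so exponents are grouped by it.\<close>
    also have "\<dots> = (\<Sum>l=0..n. \<Sum>\<alpha>\<in>{\<alpha> \<in> ?E. d \<alpha> = l}. card (?F (d \<alpha>)))"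
      using S(3) n finE by (intro sum.group[symmetric]) auto
    also have "\<dots> = (\<Sum>l=0..n. ((n + 1) choose (l + 1)) * ((r - 1) choose l) * card (?F l))"
    proof (rule sum.cong[OF refl])
      fix l
      have "{\<alpha> \<in> ?E. d \<alpha> = l} = {\<alpha> \<in> ?E. card (supp \<alpha>) = Suc l}" using S(2) by auto
      then have "card {\<alpha> \<in> ?E. d \<alpha> = l} = ((n + 1) choose (l + 1)) * ((r - 1) choose l)"
        using card_exponents_card_supp[OF r1, of l] n(1) by simp
      then show "(\<Sum>\<alpha>\<in>{\<alpha> \<in> ?E. d \<alpha> = l}. card (?F (d \<alpha>)))
        = ((n + 1) choose (l + 1)) * ((r - 1) choose l) * card (?F l)" by simp
    qed
    \<comment> \<open>For l = 0 there is no tangential index, so that summand is 0.\<close>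
    also have "\<dots> = (\<Sum>l=1..n. ((n + 1) choose (l + 1)) * ((r - 1) choose l) * card (?F l))"
    proof (rule sum.mono_neutral_right)
      have "?F 0 = {}" by (simp add: free_indices_def)
      moreover have "l = 0" if "l \<in> {0..n} - {1..n}" for l using that by auto
      ultimately show "\<forall>l\<in>{0..n} - {1..n}. ((n + 1) choose (l + 1)) * ((r - 1) choose l) * card (?F l) = 0"
        by (metis card.empty mult_0_right)
    qed auto
    finally have dim: "dim (comb bern ?E ?TX)
      = (\<Sum>l=1..n. ((n + 1) choose (l + 1)) * ((r - 1) choose l) * card (?F l))" .
    show ?thesis
      unfolding dim of_nat_sum of_nat_mult
    proof (rule sum.cong[OF refl])
      fix l assume "l \<in> {1..n}"
      then have "l \<le> ?N" using n(1) by simp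
      from card_free_indices[OF k' this]
      show "int ((n + 1) choose (l + 1)) * int ((r - 1) choose l) * int (card (?F l))
        = int ((n + 1) choose (l + 1)) * int ((r - 1) choose l) *
          (int l * int (n choose k) + int ((n - l) choose (n - k + 1)) - int (n choose (k - 1)))"
        unfolding n(1) by simp
    qed
  qed
  then show ?thesis
    using TX NX bij unfolding Bdiv sumT sumN by blast
qed

end
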